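(* Let $I=\{1,\dots,k\}$. For each $i\in I$ let $\Phi_i:\mathbb{R}^{n_i}\to\mathbb{R}^{p_i}$ be $\mathcal{C}^2$, $h_i:\mathbb{R}^{p_i}\to\overline{\mathbb{R}}$, $f_i=h_i\circ\Phi_i:\mathbb{R}^{n_i}\to\overline{\mathbb{R}}$, $\bar{x}_i\in\operatorname{dom}\Phi_i$, and suppose that $h_i$ has a fast track $\Phi_i(\bar{x}_i)+(u_i+v_i(u_i))$ at $\Phi_i(\bar{x}_i)$, where $u_i$ ranges over the $\mathcal{U}$-space $\mathcal{U}_{h_i}$ of $h_i$ at $\Phi_i(\bar{x}_i)$, and that $\Phi_i$ is transversal at $\bar{x}_i$ to the manifold $\mathcal{M}_i=\{\Phi_i(\bar{x}_i)+(u_i+v_i(u_i)):u_i\in\mathcal{U}_{h_i}\}$. Define on $\mathbb{R}^{n_1}\times\cdots\times\mathbb{R}^{n_k}$ the function $$f(x)=\sum_{i\in I}f_i(x_i)=(h\circ\Phi)(x),\qquad h(y_1,\dots,y_k)=\sum_{i\in I}h_i(y_i),\quad \Phi(x)=(\Phi_1(x_1),\dots,\Phi_k(x_k)),$$ and let $\bar{x}=(\bar{x}_1,\dots,\bar{x}_k)$. Then $h$ has a fast track at $\Phi(\bar{x})$ and $\Phi$ is transversal at $\bar{x}$ to the manifold defined by that fast track, and $$\nabla_{\mathcal{U}}f(\bar{x})=\left(\nabla_{\mathcal{U}_1}f_1(\bar{x}_1),\nabla_{\mathcal{U}_2}f_2(\bar{x}_2),\dots,\nabla_{\mathcal{U}_k}f_k(\bar{x}_k)\right)^\top,$$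 where $\mathcal{U}_i$ is the $\mathcal{U}$-space of $f_i$ at $\bar{x}_i$ with $\mathcal{U}$-basis matrix $\overline{U}_i$, and $\mathcal{U}$ is the $\mathcal{U}$-space of $f$ at $\bar{x}$, which has as basis matrix the block-diagonal matrix with blocks $\overline{U}_1,\dots,\overline{U}_k$.
   Context: $\overline{\mathbb{R}}=\mathbb{R}\cup\{+\infty\}$; lsc means lower semicontinuous; $\partial f$ is the limiting (Mordukhovich) subdifferential; $\operatorname{ri}$ is relative interior; $N_S$ is the limiting normal cone; $\nabla\Phi(\bar x)$ is the Jacobian. A set $\mathcal{M}\subseteq\mathbb{R}^n$ is a $d$-dimensional ($\mathcal{C}^2$) manifold about $\bar{x}\in\mathcal{M}$ if near $\bar{x}$ it is the solution set of $F(x)=0$ for a $\mathcal{C}^2$ map $F$ into $\mathbb{R}^{n-d}$ with surjective Jacobian at $\bar x$. PDG structure: an lsc $f:\mathbb{R}^n\to\overline{\mathbb{R}}$ has primal-dual gradient (PDG) structure at $\bar{x}$ relative to a manifold $\mathcal{M}\subseteq\mathbb{R}^n$ if there are functions $f_0,\dots,f_{m_1},\varphi_1,\dots,\varphi_{m_2}$ that are $\mathcal{C}^2$ on a ball $B_\delta(\bar{x})$ and a closed convex set $\Delta\subseteq\mathbb{R}^{m_1+1+m_2}$ such that: (i) $\bar{x}\in\{x\in B_\delta(\bar{x}):f_i(x)=f(x)\ \forall i,\ \varphi_j(x)=0\ \forall j\}\subseteq\mathcal{M}\cap B_\delta(\bar{x})$; (ii) $(\alpha,\beta)\in\Delta$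 implies $\alpha_i\ge 0$ and $\sum_{i=0}^{m_1}\alpha_i=1$; (iii) for $i=0,\dots,m_1$ the canonical vector with $\alpha_i=1$ and all other entries zero is in $\Delta$; (iv) for each $\bar{j}$ there is $(\alpha,\beta)\in\Delta$ with $\beta_{\bar{j}}\ne0$ and $\beta_j=0$ for $j\neq\bar{j}$; (v) for each $x\in\mathcal{M}\cap B_\delta(\bar{x})$: $f(x)=f_i(x)$ for some $i$, and $g\in\partial f(x)$ iff $g=\sum_i\alpha_i\nabla f_i(x)+\sum_j\beta_j\nabla\varphi_j(x)$ for some $(\alpha,\beta)\in\Delta$ with $\alpha_i=0$ whenever $f_i(x)\ne f(x)$ and $\beta_j=0$ whenever $\varphi_j(x)\neq0$. $\mathcal{VU}$-decomposition: for $f$ lsc with $\partial f(\bar{x})\ne\emptyset$ and any $\bar{g}\in\operatorname{ri}\partial f(\bar{x})$, $\mathcal{V}=\operatorname{span}(\partial f(\bar{x})-\bar{g})$ and $\mathcal{U}=N_{\partial f(\bar{x})}(\bar{g})$ (orthogonally complementary subspaces, independent of $\bar{g}$). $\overline{V}$ denotes a matrix whose columns form a basis of $\mathcal{V}$; a $\mathcal{U}$-basis matrix $\overline{U}$ is a matrix whose columns form an orthonormal basis of $\mathcal{U}$. Vectors of $\mathcal{U},\mathcal{V}$ are identified with their coordinates with respect to $\overline{U},\overline{V}$. $\mathcal{U}$-Lagrangian (for $f$ PDG at $\bar x$): $L_{\mathcal{U}}f(u;\bar{g})=\min_{v\in\mathcal{V}}\{f(\bar{x}+\overline{U}u+\overline{V}v)-\bar{g}^\top\overline{V}v\}$,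 and $W_{\mathcal{U}}f(u;\bar{g})$ is the corresponding set of minimizers $v$. Fast track: let $f$ be PDG at $\bar{x}$ relative to a $d$-dimensional manifold, with $\dim\mathcal{V}=n-d$. The function $\chi(u)=\bar{x}+\overline{U}u+\overline{V}v(u)$ (also written $\bar{x}+(u+v(u))$), $v:\mathcal{U}\to\mathcal{V}$, is a fast track of $f$ at $\bar{x}$ if for every $\bar{g}\in\operatorname{ri}\partial f(\bar{x})$ and for $u$ near $0$: (i) $v$ is $\mathcal{C}^2$ with $v(u)\in W_{\mathcal{U}}f(u;\bar{g})$; (ii) $L_{\mathcal{U}}f(u;\bar{g})$ is $\mathcal{C}^2$ in $u$. The manifold defined by the fast track is $\{\bar{x}+(u+v(u)):u\in\mathcal{U}\}$. $\mathcal{U}$-gradient: $\nabla_{\mathcal{U}}f(\bar{x})=\overline{U}\,\nabla L_{\mathcal{U}}f(\bar{x})\in\mathbb{R}^n$, where $\nabla L_{\mathcal{U}}f(\bar{x})$ is the gradient of $u\mapsto L_{\mathcal{U}}f(u;\bar{g})$ at $u=0$. Transversality: a $\mathcal{C}^2$ map $\Phi:\mathbb{R}^m\to\mathbb{R}^n$ is transversal to a manifold $\mathcal{M}\subseteq\mathbb{R}^n$ at $\bar{x}$, where $\Phi(\bar{x})\in\mathcal{M}$, if $\{z\in N_{\mathcal{M}}(\Phi(\bar{x})):\nabla\Phi(\bar{x})^\top z=0\}=\{0\}$.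
   Formalization: In the definition of fast track, the manifold of the PDG structure is taken to be the manifold defined by the fast track; the U-gradient equation is stated as: the left side exists iff all components on the right exist, and then they are equal. The claim fails otherwise. *)

theory Defs
  imports "HOL-Analysis.Analysis"
begin

text \<open>
  The spaces \<open>R^(n_i)\<close> have dimensions varying with \<open>i\<close>. Such a space is a linear subspace \<open>E\<close> of a
  Euclidean space type, and every notion below is relative to \<open>E\<close>: only points of \<open>E\<close>, values on \<open>E\<close>,
  derivatives along \<open>E\<close> and (sub)gradients and normals in \<open>E\<close> matter. For \<open>E = UNIV\<close> they are the
  usual notions on the whole space.
\<close>

definition prod_space :: "('k \<Rightarrow> 'a::euclidean_space set) \<Rightarrow> ('a ^ 'k) set" where
  "prod_space X = {x. \<forall>i. x $ i \<in> X i}"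


subsection \<open>Derivatives\<close>

text \<open>
  The derivative along \<open>E\<close>, extended by zero to the orthogonal complement of \<open>E\<close>; this makes it unique,
  and makes its adjoint take values in \<open>E\<close>.
\<close>
definition jacobian ::
    "'a::euclidean_space set \<Rightarrow> ('a \<Rightarrow> 'b::euclidean_space) \<Rightarrow> 'a \<Rightarrow> 'a \<Rightarrow> 'b" where
  "jacobian E F x =
     (THE D. (F has_derivative D) (at x within E) \<and> (\<forall>d\<in>orthogonal_comp E. D d = 0))"

definition gradient ::
    "'a::euclidean_space set \<Rightarrow> ('a \<Rightarrow> real) \<Rightarrow> 'a \<Rightarrow> 'a" where
  "gradient E F x = (THE g. g \<in> E \<and> (F has_derivative (\<lambda>d. g \<bullet> d)) (at x within E))"

text \<open>Meant for \<open>S\<close> relatively open in a linear subspace.\<close>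
definition C2_on ::
    "'a::euclidean_space set \<Rightarrow> ('a \<Rightarrow> 'b::euclidean_space) \<Rightarrow> bool" where
  "C2_on S F \<longleftrightarrow>
     (\<exists>(D :: 'a \<Rightarrow> 'a \<Rightarrow>\<^sub>L 'b) (D2 :: 'a \<Rightarrow> 'a \<Rightarrow>\<^sub>L ('a \<Rightarrow>\<^sub>L 'b)).
        (\<forall>x\<in>S. (F has_derivative blinfun_apply (D x)) (at x within S)) \<and>
        (\<forall>x\<in>S. (D has_derivative blinfun_apply (D2 x)) (at x within S)) \<and>
        continuous_on S D2)"

text \<open>A \<open>d\<close>-dimensional manifold about \<open>x\<close>; the subspace \<open>Z\<close> plays the role of \<open>R^(n - d)\<close>.\<close>
definition C2_manifold_about ::
    "'a::euclidean_space set \<Rightarrow> nat \<Rightarrow> 'a set \<Rightarrow> 'a \<Rightarrow> bool" where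
  "C2_manifold_about E d M x \<longleftrightarrow>
     x \<in> M \<and> M \<subseteq> E \<and>
     (\<exists>r>0. \<exists>Z (F :: 'a \<Rightarrow> 'a).
        subspace Z \<and> Z \<subseteq> E \<and> dim Z + d = dim E \<and>
        F ` (E \<inter> ball x r) \<subseteq> Z \<and> C2_on (E \<inter> ball x r) F \<and>
        jacobian E F x ` E = Z \<and>
        M \<inter> ball x r = {y \<in> E \<inter> ball x r. F y = 0})"


subsection \<open>Variational analysis\<close>

definition lsc_on :: "'a::euclidean_space set \<Rightarrow> ('a \<Rightarrow> ereal) \<Rightarrow> bool" where
  "lsc_on E f \<longleftrightarrow> (\<forall>x\<in>E. f x \<le> Liminf (at x within E) f)"

definition regular_subdiff ::
    "'a::euclidean_space set \<Rightarrow> ('a \<Rightarrow> ereal) \<Rightarrow> 'a \<Rightarrow> 'a set" where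
  "regular_subdiff E f x =
     {g \<in> E. x \<in> E \<and> \<bar>f x\<bar> \<noteq> \<infinity> \<and>
        (\<forall>e>0. \<forall>\<^sub>F y in at x within E. f x + ereal (g \<bullet> (y - x) - e * norm (y - x)) \<le> f y)}"

definition limiting_subdiff ::
    "'a::euclidean_space set \<Rightarrow> ('a \<Rightarrow> ereal) \<Rightarrow> 'a \<Rightarrow> 'a set" where
  "limiting_subdiff E f x =
     {g. x \<in> E \<and> \<bar>f x\<bar> \<noteq> \<infinity> \<and>
        (\<exists>xs gs. xs \<longlonglongrightarrow> x \<and> (\<lambda>n. f (xs n)) \<longlonglongrightarrow> f x \<and>
           (\<forall>n. gs n \<in> regular_subdiff E f (xs n)) \<and> gs \<longlonglongrightarrow> g)}"

definition regular_normal_cone ::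
    "'a::euclidean_space set \<Rightarrow> 'a set \<Rightarrow> 'a \<Rightarrow> 'a set" where
  "regular_normal_cone E S x =
     {z \<in> E. x \<in> S \<and> (\<forall>e>0. \<forall>\<^sub>F y in at x within S. z \<bullet> (y - x) \<le> e * norm (y - x))}"

definition limiting_normal_cone ::
    "'a::euclidean_space set \<Rightarrow> 'a set \<Rightarrow> 'a \<Rightarrow> 'a set" where
  "limiting_normal_cone E S x =
     {z. x \<in> S \<and> (\<exists>xs zs. xs \<longlonglongrightarrow> x \<and> (\<forall>n. zs n \<in> regular_normal_cone E S (xs n)) \<and> zs \<longlonglongrightarrow> z)}"

definition transversal ::
    "'a::euclidean_space set \<Rightarrow> 'b::euclidean_space set \<Rightarrow> ('a \<Rightarrow> 'b) \<Rightarrow> 'b set \<Rightarrow> 'a \<Rightarrow> bool" where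
  "transversal E1 E2 \<Phi> M x \<longleftrightarrow>
     \<Phi> x \<in> M \<and>
     {z \<in> limiting_normal_cone E2 M (\<Phi> x). adjoint (jacobian E1 \<Phi> x) z = 0} = {0}"


subsection \<open>Primal-dual gradient structure\<close>

text \<open>
  A vector \<open>(\<alpha>, \<beta>)\<close> of \<open>R^(m1 + 1 + m2)\<close> is a pair of sequences supported in \<open>{0..m1}\<close> and \<open>{1..m2}\<close>.
  On such pairs \<open>closed\<close> (product topology) is the Euclidean notion.
\<close>
definition PDG ::
    "'a::euclidean_space set \<Rightarrow> ('a \<Rightarrow> ereal) \<Rightarrow> 'a \<Rightarrow> 'a set \<Rightarrow> bool" where
  "PDG E f xbar M \<longleftrightarrow>
     xbar \<in> E \<and> M \<subseteq> E \<and> (\<forall>x\<in>E. f x \<noteq> -\<infinity>) \<and> lsc_on E f \<and>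
     (\<exists>\<delta>>0. \<exists>m1 m2 :: nat. \<exists>(fs :: nat \<Rightarrow> 'a \<Rightarrow> real) (\<phi> :: nat \<Rightarrow> 'a \<Rightarrow> real).
        \<exists>\<Delta> :: ((nat \<Rightarrow> real) \<times> (nat \<Rightarrow> real)) set.
        (\<forall>i\<le>m1. C2_on (E \<inter> ball xbar \<delta>) (fs i)) \<and>
        (\<forall>j\<in>{1..m2}. C2_on (E \<inter> ball xbar \<delta>) (\<phi> j)) \<and>
        (\<forall>(\<alpha>, \<beta>)\<in>\<Delta>. (\<forall>i. i > m1 \<longrightarrow> \<alpha> i = 0) \<and> (\<forall>j. j \<notin> {1..m2} \<longrightarrow> \<beta> j = 0)) \<and>
        closed \<Delta> \<and>
        (\<forall>(\<alpha>, \<beta>)\<in>\<Delta>. \<forall>(\<alpha>', \<beta>')\<in>\<Delta>. \<forall>t\<in>{0..1}.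
           (\<lambda>i. (1 - t) * \<alpha> i + t * \<alpha>' i, \<lambda>j. (1 - t) * \<beta> j + t * \<beta>' j) \<in> \<Delta>) \<and>
        \<comment> \<open>(i)\<close>
        xbar \<in> {x \<in> E \<inter> ball xbar \<delta>.
                  (\<forall>i\<le>m1. ereal (fs i x) = f x) \<and> (\<forall>j\<in>{1..m2}. \<phi> j x = 0)} \<and>
        {x \<in> E \<inter> ball xbar \<delta>.
                  (\<forall>i\<le>m1. ereal (fs i x) = f x) \<and> (\<forall>j\<in>{1..m2}. \<phi> j x = 0)}
           \<subseteq> M \<inter> ball xbar \<delta> \<and>
        \<comment> \<open>(ii)\<close>
        (\<forall>(\<alpha>, \<beta>)\<in>\<Delta>. (\<forall>i\<le>m1. \<alpha> i \<ge> 0) \<and> (\<Sum>i\<le>m1. \<alpha> i) = 1) \<and>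
        \<comment> \<open>(iii)\<close>
        (\<forall>i\<le>m1. (\<lambda>k. if k = i then 1 else 0, \<lambda>j. 0) \<in> \<Delta>) \<and>
        \<comment> \<open>(iv)\<close>
        (\<forall>j0\<in>{1..m2}. \<exists>(\<alpha>, \<beta>)\<in>\<Delta>. \<beta> j0 \<noteq> 0 \<and> (\<forall>j. j \<noteq> j0 \<longrightarrow> \<beta> j = 0)) \<and>
        \<comment> \<open>(v)\<close>
        (\<forall>x \<in> M \<inter> ball xbar \<delta>.
           (\<exists>i\<le>m1. f x = ereal (fs i x)) \<and>
           (\<forall>g. g \<in> limiting_subdiff E f x \<longleftrightarrow>
              (\<exists>(\<alpha>, \<beta>)\<in>\<Delta>.
                 (\<forall>i\<le>m1. ereal (fs i x) \<noteq> f x \<longrightarrow> \<alpha> i = 0) \<and>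
                 (\<forall>j\<in>{1..m2}. \<phi> j x \<noteq> 0 \<longrightarrow> \<beta> j = 0) \<and>
                 g = (\<Sum>i\<le>m1. \<alpha> i *\<^sub>R gradient E (fs i) x) +
                     (\<Sum>j\<in>{1..m2}. \<beta> j *\<^sub>R gradient E (\<phi> j) x)))))"


subsection \<open>VU-decomposition and U-Lagrangian\<close>

text \<open>
  \<open>V\<close> and \<open>U\<close> do not depend on the point of the relative interior that is used; \<open>ri_point\<close> is an
  arbitrary one. The definitions are meaningful only if the relative interior is nonempty.
\<close>
definition ri_point :: "'a::euclidean_space set \<Rightarrow> ('a \<Rightarrow> ereal) \<Rightarrow> 'a \<Rightarrow> 'a" where
  "ri_point E f x = (SOME g. g \<in> rel_interior (limiting_subdiff E f x))"

definition V_space :: "'a::euclidean_space set \<Rightarrow> ('a \<Rightarrow> ereal) \<Rightarrow> 'a \<Rightarrow> 'a set" where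
  "V_space E f x = span ((\<lambda>g. g - ri_point E f x) ` limiting_subdiff E f x)"

definition U_space :: "'a::euclidean_space set \<Rightarrow> ('a \<Rightarrow> ereal) \<Rightarrow> 'a \<Rightarrow> 'a set" where
  "U_space E f x = limiting_normal_cone E (limiting_subdiff E f x) (ri_point E f x)"

text \<open>
  Elements of \<open>U\<close> and \<open>V\<close> are used directly in place of their coordinate vectors, so \<open>u\<close> and \<open>v\<close> stand
  for the products of the basis matrices with the coordinates. The infimum is a minimum exactly if
  \<open>U_argmin\<close> is nonempty, which is required wherever the Lagrangian is used.
\<close>
definition U_Lagrangian ::
    "'a::euclidean_space set \<Rightarrow> ('a \<Rightarrow> ereal) \<Rightarrow> 'a \<Rightarrow> 'a \<Rightarrow> 'a \<Rightarrow> ereal" where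
  "U_Lagrangian E f x g u = (INF v \<in> V_space E f x. f (x + u + v) - ereal (g \<bullet> v))"

definition U_argmin ::
    "'a::euclidean_space set \<Rightarrow> ('a \<Rightarrow> ereal) \<Rightarrow> 'a \<Rightarrow> 'a \<Rightarrow> 'a \<Rightarrow> 'a set" where
  "U_argmin E f x g u =
     {v \<in> V_space E f x. f (x + u + v) - ereal (g \<bullet> v) = U_Lagrangian E f x g u}"

definition track_manifold ::
    "'a::euclidean_space set \<Rightarrow> ('a \<Rightarrow> ereal) \<Rightarrow> 'a \<Rightarrow> ('a \<Rightarrow> 'a) \<Rightarrow> 'a set" where
  "track_manifold E f x v = {x + (u + v u) |u. u \<in> U_space E f x}"

text \<open>
  The manifold relative to which \<open>f\<close> has PDG structure and the manifold defined by the fast track are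
  one and the same. If the former were left unrelated to the latter, fast tracks would not be stable
  under separable sums: PDG structure relative to a manifold that is not tangent to \<open>U\<close> allows the
  restriction of one summand to have convex kinks, and that of another to have concave kinks,
  accumulating at the base point, and their sum then need not have any PDG structure.
\<close>
definition fast_track ::
    "'a::euclidean_space set \<Rightarrow> ('a \<Rightarrow> ereal) \<Rightarrow> 'a \<Rightarrow> ('a \<Rightarrow> 'a) \<Rightarrow> bool" where
  "fast_track E f x v \<longleftrightarrow>
     (\<exists>d. C2_manifold_about E d (track_manifold E f x v) x \<and> dim (V_space E f x) + d = dim E) \<and>
     PDG E f x (track_manifold E f x v) \<and>
     v ` U_space E f x \<subseteq> V_space E f x \<and>
     (\<forall>g \<in> rel_interior (limiting_subdiff E f x). \<exists>\<epsilon>>0.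
        C2_on (U_space E f x \<inter> ball 0 \<epsilon>) v \<and>
        (\<forall>u \<in> U_space E f x \<inter> ball 0 \<epsilon>. v u \<in> U_argmin E f x g u) \<and>
        (\<forall>u \<in> U_space E f x \<inter> ball 0 \<epsilon>. \<bar>U_Lagrangian E f x g u\<bar> \<noteq> \<infinity>) \<and>
        C2_on (U_space E f x \<inter> ball 0 \<epsilon>) (\<lambda>u. real_of_ereal (U_Lagrangian E f x g u)))"


subsection \<open>U-gradient\<close>

text \<open>A matrix is the family \<open>Ub\<close> of its columns, indexed by the finite set \<open>C\<close>.\<close>
definition U_basis ::
    "'a::euclidean_space set \<Rightarrow> ('a \<Rightarrow> ereal) \<Rightarrow> 'a \<Rightarrow> 'c set \<Rightarrow> ('c \<Rightarrow> 'a) \<Rightarrow> bool" where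
  "U_basis E f x C Ub \<longleftrightarrow>
     rel_interior (limiting_subdiff E f x) \<noteq> {} \<and> finite C \<and>
     (\<forall>a\<in>C. \<forall>b\<in>C. Ub a \<bullet> Ub b = (if a = b then 1 else 0)) \<and>
     span (Ub ` C) = U_space E f x"

text \<open>Column \<open>j\<close> of block \<open>i\<close> becomes the column with index \<open>(i, j)\<close>.\<close>
definition block_diag :: "('k::finite \<Rightarrow> 'c \<Rightarrow> 'a::euclidean_space) \<Rightarrow> 'k \<times> 'c \<Rightarrow> 'a ^ 'k" where
  "block_diag Us = (\<lambda>(i, j). axis i (Us i j))"

text \<open>
  The U-gradient computed with \<open>g\<close> is defined: near \<open>0\<close> the minimum in the Lagrangian is attained and
  finite, and the Lagrangian is differentiable at \<open>0\<close>.
\<close>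
definition U_gradient_defined ::
    "'a::euclidean_space set \<Rightarrow> ('a \<Rightarrow> ereal) \<Rightarrow> 'a \<Rightarrow> 'a \<Rightarrow> bool" where
  "U_gradient_defined E f x g \<longleftrightarrow>
     g \<in> rel_interior (limiting_subdiff E f x) \<and>
     (\<exists>\<epsilon>>0. \<forall>u \<in> U_space E f x \<inter> ball 0 \<epsilon>.
        U_argmin E f x g u \<noteq> {} \<and> \<bar>U_Lagrangian E f x g u\<bar> \<noteq> \<infinity>) \<and>
     (\<lambda>u. real_of_ereal (U_Lagrangian E f x g u)) differentiable (at 0 within U_space E f x)"

text \<open>
  The basis matrix applied to the gradient of the Lagrangian with respect to the coordinates, whose entry
  at \<open>j\<close> is the derivative along column \<open>j\<close>.
\<close>
definition U_gradient ::
    "'a::euclidean_space set \<Rightarrow> ('a \<Rightarrow> ereal) \<Rightarrow> 'a \<Rightarrow> 'c set \<Rightarrow> ('c \<Rightarrow> 'a) \<Rightarrow> 'a \<Rightarrow> 'a" where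
  "U_gradient E f x C Ub g =
     (\<Sum>j\<in>C. jacobian (U_space E f x) (\<lambda>u. real_of_ereal (U_Lagrangian E f x g u)) 0 (Ub j) *\<^sub>R Ub j)"

end

theory Submission
  imports Defs
begin

text \<open>
  For lower semicontinuous summands, the limiting subdifferential of a separable sum is the product of
  the subdifferentials of the summands. Hence relative interiors, \<open>V\<close>-spaces, \<open>U\<close>-spaces, Lagrangians
  and their minimizers decompose as well, which gives the U-gradient formula; normal cones and Jacobians
  decompose too, which gives transversality.

  The delicate point is the PDG structure of the sum. Sums \<open>f\<^sub>1\<^sub>s + f\<^sub>2\<^sub>t\<close> of structure functions can be
  active by accident, when the deviations of the summands cancel. To avoid this, each summand \<open>h\<close> is first
  given another structure. For \<open>g\<close> in the relative interior of the subdifferential, the map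
  \<open>q y = L u + g \<bullet> v\<close>, where \<open>L\<close> is the U-Lagrangian and \<open>u\<close>, \<open>v\<close> are the projections of \<open>y - x\<close>, is a
  smooth minorant of \<open>h\<close> that agrees with \<open>h\<close> on the track, so its gradients there are subgradients. As the
  weights \<open>\<alpha>\<close> sum to 1, \<open>\<Sum>\<alpha>\<^sub>i \<nabla>f\<^sub>i = \<nabla>q + \<Sum>\<alpha>\<^sub>i \<nabla>(f\<^sub>i - q)\<close>: the function \<open>q\<close> alone can represent \<open>h\<close> on the
  track, with all \<open>f\<^sub>i - q\<close> demoted to functions \<open>\<phi>\<^sub>j\<close>, whose activity is not affected by the other summands.
\<close>

subsection \<open>Derivatives along subspaces\<close>

text \<open>Demotion has a price in two places. The coefficient vectors that come from
  \<open>\<Delta>\<close> have weights of total 1, so 0, which stands for the gradient of q alone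
  and which (iii) asks for, is not among them. The coefficient set has to grow to a closed convex
  set containing 0 and may still produce only subgradients on the track. This works because the
  gradient of q is a subgradient all along the track and the subdifferentials there are closed and
  convex; for unbounded \<open>\<Delta>\<close>, recession directions enter as well.

  Secondly, the vector that (iv) provides for one \<phi>_j also carries weights on the f_i, and
  after demotion these are further nonzero entries. This is why g is taken from the relative
  interior: q has gradient g at x, the gradient of \<phi>_j at x lies in V, so a small multiple of
  it can be added to g inside the subdifferential. The matching coefficient vector need not lie in
  the enlarged set; a second structure function, active only at x, makes room for it.\<close>

lemma at_within_subspace_ball:
  assumes "x \<in> ball a r"
  shows "at x within (E \<inter> ball a r) = at x within E"
  using assms by (intro at_within_nhd[where S = "ball a r"]) auto

lemma subspace_projection:
  fixes E :: "'a::euclidean_space set"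
  assumes "subspace E"
  obtains P where "bounded_linear P" "\<And>x. P x \<in> E" "\<And>x. x \<in> E \<Longrightarrow> P x = x"
    "\<And>x y. y \<in> E \<Longrightarrow> (x - P x) \<bullet> y = 0"
proof -
  obtain B where B: "B \<subseteq> E" "pairwise orthogonal B" "\<And>x. x \<in> B \<Longrightarrow> norm x = 1"
      "independent B" "card B = dim E" "span B = E"
    using orthonormal_basis_subspace[OF assms] by metis
  have fin: "finite B"
    using B(4) independent_imp_finite by blast
  define P where "P x = (\<Sum>b\<in>B. (x \<bullet> b) *\<^sub>R b)" for x
  have bl: "bounded_linear P"
    unfolding P_def
    by (intro bounded_linear_sum bounded_linear_scaleR_const bounded_linear_inner_left)
  have PE: "P x \<in> E" for x
    unfolding P_def using B(1) assms by (intro subspace_sum subspace_scale) auto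
  have orthB: "(x - P x) \<bullet> c = 0" if c: "c \<in> B" for x c
  proof -
    have "P x \<bullet> c = (\<Sum>b\<in>B. (x \<bullet> b) * (b \<bullet> c))"
      unfolding P_def by (simp add: inner_sum_left)
    also have "\<dots> = (\<Sum>b\<in>B. if b = c then x \<bullet> c else 0)"
    proof (rule sum.cong[OF refl])
      fix b assume b: "b \<in> B"
      show "(x \<bullet> b) * (b \<bullet> c) = (if b = c then x \<bullet> c else 0)"
      proof (cases "b = c")
        case True
        then show ?thesis using B(3)[OF c] by (simp add: norm_eq_1)
      next
        case False
        then show ?thesis using B(2) b c by (auto simp: pairwise_def orthogonal_def)
      qed
    qed
    also have "\<dots> = x \<bullet> c" using c fin by simp
    finally show ?thesis by (simp add: inner_diff_left)
  qed
  have orth: "(x - P x) \<bullet> y = 0" if "y \<in> E" for x y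
  proof -
    have "y \<in> span B" using B(6) that by simp
    then show ?thesis
      by (induction rule: span_induct_alt) (auto simp: inner_add_right orthB)
  qed
  have id: "P x = x" if "x \<in> E" for x
  proof -
    have "x - P x \<in> E" using that PE assms by (simp add: subspace_diff)
    then have "(x - P x) \<bullet> (x - P x) = 0" by (rule orth)
    then show ?thesis by simp
  qed
  show thesis using that bl PE id orth by blast
qed

text \<open>Within a subspace, difference quotients see a derivative only in directions of
  \<open>E\<close>, so it may be altered off \<open>E\<close>. This freedom is used to pass to the
  representatives that \<open>gradient\<close> and \<open>jacobian\<close> single out.\<close>

lemma has_derivative_subspace_cong:
  fixes F :: "'a::euclidean_space \<Rightarrow> 'b::real_normed_vector"
  assumes E: "subspace E" "x \<in> E" and D: "(F has_derivative D) (at x within E)"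
    and D': "bounded_linear D'" "\<And>d. d \<in> E \<Longrightarrow> D' d = D d"
  shows "(F has_derivative D') (at x within E)"
proof -
  have "((\<lambda>y. (1 / norm (y - x)) *\<^sub>R (F y - (F x + D (y - x)))) \<longlongrightarrow> 0) (at x within E)"
    using D by (simp add: has_derivative_within)
  moreover have "\<forall>\<^sub>F y in at x within E. (1 / norm (y - x)) *\<^sub>R (F y - (F x + D (y - x))) =
      (1 / norm (y - x)) *\<^sub>R (F y - (F x + D' (y - x)))"
    unfolding eventually_at_filter
    using E D'(2) by (intro always_eventually) (auto simp: subspace_diff)
  ultimately show ?thesis
    using D'(1) by (auto simp: has_derivative_within elim: Lim_transform_eventually)
qed

text \<open>Restriction to the line through \<open>x\<close> in direction \<open>d\<close>, which
  stays in \<open>E\<close>, reduces this to uniqueness of derivatives on the real line.\<close>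

lemma has_derivative_subspace_unique:
  fixes F :: "'a::euclidean_space \<Rightarrow> 'b::real_normed_vector"
  assumes E: "subspace E" "x \<in> E" and D: "(F has_derivative D) (at x within E)"
    and D': "(F has_derivative D') (at x within E)" and d: "d \<in> E"
  shows "D d = D' d"
proof -
  have line: "((\<lambda>t. x + t *\<^sub>R d) has_derivative (\<lambda>t. t *\<^sub>R d)) (at 0)"
    by (auto intro!: derivative_eq_intros)
  have im: "range (\<lambda>t. x + t *\<^sub>R d) \<subseteq> E"
    using E d by (auto intro!: subspace_add subspace_scale)
  have A: "((\<lambda>t. F (x + t *\<^sub>R d)) has_derivative (\<lambda>t. A (t *\<^sub>R d))) (at 0)"
    if "(F has_derivative A) (at x within E)" for A
  proof (rule has_derivative_in_compose[OF line])
    show "(F has_derivative A) (at (x + 0 *\<^sub>R d) within range (\<lambda>t. x + t *\<^sub>R d))"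
      using has_derivative_subset[OF that im] by simp
  qed
  have "(\<lambda>t. D (t *\<^sub>R d)) = (\<lambda>t. D' (t *\<^sub>R d))"
    using A[OF D] A[OF D'] by (rule has_derivative_unique)
  from fun_cong[OF this, of 1] show ?thesis by simp
qed

text \<open>The difference of two candidates lies in \<open>E\<close>, so the two derivatives may be
  compared on it.\<close>

lemma gradient_eqI:
  assumes "subspace E" "x \<in> E" "g \<in> E" "(F has_derivative (\<lambda>d. g \<bullet> d)) (at x within E)"
  shows "gradient E F x = g"
  unfolding gradient_def
proof (rule the_equality)
  show "g \<in> E \<and> (F has_derivative (\<lambda>d. g \<bullet> d)) (at x within E)" using assms by simp
next
  fix g' assume g': "g' \<in> E \<and> (F has_derivative (\<lambda>d. g' \<bullet> d)) (at x within E)"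
  have "g' \<bullet> (g' - g) = g \<bullet> (g' - g)"
    using has_derivative_subspace_unique[OF assms(1,2) conjunct2[OF g'] assms(4), of "g' - g"]
      g' assms(1,3) by (simp add: subspace_diff)
  then have "(g' - g) \<bullet> (g' - g) = 0" by (simp add: inner_diff_left)
  then show "g' = g" by simp
qed

lemma gradient_works:
  fixes F :: "'a::euclidean_space \<Rightarrow> real"
  assumes E: "subspace E" "x \<in> E" and D: "(F has_derivative D) (at x within E)"
  shows "gradient E F x \<in> E"
    and "(F has_derivative (\<lambda>d. gradient E F x \<bullet> d)) (at x within E)"
    and "\<And>d. d \<in> E \<Longrightarrow> D d = gradient E F x \<bullet> d"
proof -
  obtain P where P: "bounded_linear P" "\<And>x. P x \<in> E" "\<And>x. x \<in> E \<Longrightarrow> P x = x"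
    "\<And>x y. y \<in> E \<Longrightarrow> (x - P x) \<bullet> y = 0"
    using subspace_projection[OF E(1)] by metis
  have bl: "bounded_linear D" using D by (rule has_derivative_bounded_linear)
  \<comment> \<open>The Riesz vector of \<open>D\<close> on the whole space; its projection
    represents \<open>D\<close> on \<open>E\<close>.\<close>
  define a where "a = adjoint D 1"
  have a: "D d = a \<bullet> d" for d
    using adjoint_works[OF bounded_linear.linear[OF bl], of d 1] by (simp add: a_def inner_commute)
  have Pa: "D d = P a \<bullet> d" if "d \<in> E" for d
    using P(4)[OF that, of a] a[of d] by (simp add: inner_diff_left)
  have "(F has_derivative (\<lambda>d. P a \<bullet> d)) (at x within E)"
    by (rule has_derivative_subspace_cong[OF E D]) (auto simp: Pa bounded_linear_inner_right)
  moreover from gradient_eqI[OF E P(2) this] have "gradient E F x = P a" .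
  ultimately show "gradient E F x \<in> E"
    and "(F has_derivative (\<lambda>d. gradient E F x \<bullet> d)) (at x within E)"
    and "\<And>d. d \<in> E \<Longrightarrow> D d = gradient E F x \<bullet> d"
    using P(2) Pa by auto
qed

lemma jacobian_eqI:
  fixes F :: "'a::euclidean_space \<Rightarrow> 'b::euclidean_space"
  assumes E: "subspace E" "x \<in> E" and D: "(F has_derivative D) (at x within E)"
    and D0: "\<And>d. d \<in> orthogonal_comp E \<Longrightarrow> D d = 0"
  shows "jacobian E F x = D"
  unfolding jacobian_def
proof (rule the_equality)
  show "(F has_derivative D) (at x within E) \<and> (\<forall>d\<in>orthogonal_comp E. D d = 0)"
    using D D0 by simp
next
  fix D' assume D': "(F has_derivative D') (at x within E) \<and> (\<forall>d\<in>orthogonal_comp E. D' d = 0)"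
  obtain P where P: "bounded_linear P" "\<And>x. P x \<in> E" "\<And>x. x \<in> E \<Longrightarrow> P x = x"
    "\<And>x y. y \<in> E \<Longrightarrow> (x - P x) \<bullet> y = 0"
    using subspace_projection[OF E(1)] by metis
  show "D' = D"
  proof
    fix d
    have lin: "linear D" "linear D'"
      using D D' has_derivative_bounded_linear bounded_linear.linear by blast+
    \<comment> \<open>\<open>P\<close> splits \<open>d\<close> into a part in \<open>E\<close>,
      where both maps agree, and a part in the orthogonal complement, where both vanish.\<close>
    have "d - P d \<in> orthogonal_comp E"
      using P(4)[of _ d] by (auto simp: orthogonal_comp_def orthogonal_def inner_commute)
    then have "D (d - P d) = 0" "D' (d - P d) = 0" using D0 D' by auto
    then have "D d = D (P d)" "D' d = D' (P d)"
      using lin by (auto simp: linear_diff)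
    then show "D' d = D d"
      using has_derivative_subspace_unique[OF E D conjunct1[OF D'] P(2)] by simp
  qed
qed

lemma jacobian_works:
  fixes F :: "'a::euclidean_space \<Rightarrow> 'b::euclidean_space"
  assumes E: "subspace E" "x \<in> E" and D: "(F has_derivative D) (at x within E)"
  shows "(F has_derivative jacobian E F x) (at x within E)"
    and "\<And>d. d \<in> orthogonal_comp E \<Longrightarrow> jacobian E F x d = 0"
    and "\<And>d. d \<in> E \<Longrightarrow> jacobian E F x d = D d"
proof -
  obtain P where P: "bounded_linear P" "\<And>x. P x \<in> E" "\<And>x. x \<in> E \<Longrightarrow> P x = x"
    "\<And>x y. y \<in> E \<Longrightarrow> (x - P x) \<bullet> y = 0"
    using subspace_projection[OF E(1)] by metis
  have bl: "bounded_linear D" using D by (rule has_derivative_bounded_linear)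
  \<comment> \<open>Precomposition with the projection changes nothing on \<open>E\<close> and
    annihilates the orthogonal complement.\<close>
  have DP: "(F has_derivative (\<lambda>d. D (P d))) (at x within E)"
    by (rule has_derivative_subspace_cong[OF E D])
      (auto simp: P(3) bounded_linear_compose[OF bl P(1)])
  have D0: "D (P d) = 0" if "d \<in> orthogonal_comp E" for d
  proof -
    have "P d \<bullet> d = 0"
      using that P(2) by (auto simp: orthogonal_comp_def orthogonal_def)
    moreover have "(d - P d) \<bullet> P d = 0" using P(2,4) by blast
    ultimately have "P d \<bullet> P d = 0" by (simp add: inner_diff_left inner_diff_right inner_commute del: inner_eq_zero_iff)
    then have "P d = 0" by simp
    then show ?thesis using bl by (simp add: linear_simps)
  qed
  have eq: "jacobian E F x = (\<lambda>d. D (P d))" by (rule jacobian_eqI[OF E DP D0])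
  show "(F has_derivative jacobian E F x) (at x within E)"
    and "\<And>d. d \<in> orthogonal_comp E \<Longrightarrow> jacobian E F x d = 0"
    and "\<And>d. d \<in> E \<Longrightarrow> jacobian E F x d = D d"
    using DP D0 P(3) by (auto simp: eq)
qed

subsection \<open>Twice continuously differentiable maps\<close>

lemma C2_on_cong:
  assumes "C2_on S F" "\<And>x. x \<in> S \<Longrightarrow> G x = F x"
  shows "C2_on S G"
proof -
  obtain D D2 where F: "\<And>x. x \<in> S \<Longrightarrow> (F has_derivative blinfun_apply (D x)) (at x within S)"
    "\<And>x. x \<in> S \<Longrightarrow> (D has_derivative blinfun_apply (D2 x)) (at x within S)" "continuous_on S D2"
    using assms(1) unfolding C2_on_def by blast
  then have "(G has_derivative blinfun_apply (D x)) (at x within S)" if "x \<in> S" for x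
    using has_derivative_transform[OF that _ F(1)[OF that]] assms(2) by blast
  with F show ?thesis unfolding C2_on_def by blast
qed

lemma C2_on_subset:
  assumes "C2_on S F" "T \<subseteq> S"
  shows "C2_on T F"
proof -
  obtain D D2 where F: "\<And>x. x \<in> S \<Longrightarrow> (F has_derivative blinfun_apply (D x)) (at x within S)"
    "\<And>x. x \<in> S \<Longrightarrow> (D has_derivative blinfun_apply (D2 x)) (at x within S)" "continuous_on S D2"
    using assms(1) unfolding C2_on_def by blast
  have "(F has_derivative blinfun_apply (D x)) (at x within T)" if "x \<in> T" for x
    using F(1) that assms(2) has_derivative_subset by blast
  moreover have "(D has_derivative blinfun_apply (D2 x)) (at x within T)" if "x \<in> T" for x
    using F(2) that assms(2) has_derivative_subset by blast
  moreover have "continuous_on T D2" using F(3) assms(2) continuous_on_subset by blast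
  ultimately show ?thesis unfolding C2_on_def by blast
qed

lemma C2_on_differentiable:
  assumes "C2_on S F" "x \<in> S"
  obtains D where "(F has_derivative D) (at x within S)"
proof -
  obtain D where "\<forall>x\<in>S. (F has_derivative blinfun_apply (D x)) (at x within S)"
    using assms(1) unfolding C2_on_def by blast
  then show thesis using that assms(2) by blast
qed

lemma C2_on_ball_differentiable:
  assumes "C2_on (E \<inter> ball a r) F" "x \<in> E" "x \<in> ball a r"
  obtains D where "(F has_derivative D) (at x within E)"
  using C2_on_differentiable[OF assms(1), of x] assms(2,3) at_within_subspace_ball[of x a r E]
  by auto

lemma C2_on_linear:
  fixes L :: "'a::euclidean_space \<Rightarrow> 'b::euclidean_space"
  assumes "bounded_linear L"
  shows "C2_on S L"
  unfolding C2_on_def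
proof (intro exI conjI ballI)
  show "(L has_derivative blinfun_apply (Blinfun L)) (at x within S)" for x
    using assms by (simp add: bounded_linear_Blinfun_apply bounded_linear_imp_has_derivative)
  show "((\<lambda>_. Blinfun L) has_derivative blinfun_apply 0) (at x within S)" for x
    by (simp add: zero_blinfun.rep_eq)
qed auto

lemma C2_on_const:
  fixes c :: "'b::euclidean_space"
  shows "C2_on S (\<lambda>x::'a::euclidean_space. c)"
  unfolding C2_on_def
proof (intro exI conjI ballI)
  show "((\<lambda>_. c) has_derivative blinfun_apply 0) (at x within S)" for x::'a by (simp add: zero_blinfun.rep_eq)
  show "((\<lambda>_. 0) has_derivative blinfun_apply 0) (at x within S)" for x::'a by (simp add: zero_blinfun.rep_eq)
qed auto

lemma C2_on_add:
  fixes F G :: "'a::euclidean_space \<Rightarrow> 'b::euclidean_space"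
  assumes "C2_on S F" "C2_on S G"
  shows "C2_on S (\<lambda>x. F x + G x)"
proof -
  obtain D D2 where F: "\<And>x. x \<in> S \<Longrightarrow> (F has_derivative blinfun_apply (D x)) (at x within S)"
    "\<And>x. x \<in> S \<Longrightarrow> (D has_derivative blinfun_apply (D2 x)) (at x within S)" "continuous_on S D2"
    using assms(1) unfolding C2_on_def by blast
  obtain H H2 where G: "\<And>x. x \<in> S \<Longrightarrow> (G has_derivative blinfun_apply (H x)) (at x within S)"
    "\<And>x. x \<in> S \<Longrightarrow> (H has_derivative blinfun_apply (H2 x)) (at x within S)" "continuous_on S H2"
    using assms(2) unfolding C2_on_def by blast
  show ?thesis
    unfolding C2_on_def
  proof (intro exI conjI ballI)
    fix x assume x: "x \<in> S"
    show "((\<lambda>x. F x + G x) has_derivative blinfun_apply (D x + H x)) (at x within S)"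
      using has_derivative_add[OF F(1) G(1), OF x x] by (simp add: plus_blinfun.rep_eq)
    show "((\<lambda>x. D x + H x) has_derivative blinfun_apply (D2 x + H2 x)) (at x within S)"
      using has_derivative_add[OF F(2) G(2), OF x x] by (simp add: plus_blinfun.rep_eq)
  next
    show "continuous_on S (\<lambda>x. D2 x + H2 x)" using F(3) G(3) by (rule continuous_on_add)
  qed
qed

lemma C2_on_sum:
  fixes F :: "'i \<Rightarrow> 'a::euclidean_space \<Rightarrow> 'b::euclidean_space"
  assumes "\<And>i. i \<in> I \<Longrightarrow> C2_on S (F i)"
  shows "C2_on S (\<lambda>x. \<Sum>i\<in>I. F i x)"
  using assms
proof (induction I rule: infinite_finite_induct)
  case (insert i I)
  then show ?case by (simp add: C2_on_add)
qed (simp_all add: C2_on_const)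

text \<open>Composition with \<open>L\<close> acts linearly on derivatives too, so the second
  derivative arises by the same rule as the first, with the operator \<open>C\<close> in place of
  \<open>L\<close>.\<close>

lemma C2_on_bounded_linear:
  fixes F :: "'a::euclidean_space \<Rightarrow> 'b::euclidean_space"
    and L :: "'b \<Rightarrow> 'c::euclidean_space"
  assumes L: "bounded_linear L" and "C2_on S F"
  shows "C2_on S (\<lambda>x. L (F x))"
proof -
  obtain D D2 where F: "\<And>x. x \<in> S \<Longrightarrow> (F has_derivative blinfun_apply (D x)) (at x within S)"
    "\<And>x. x \<in> S \<Longrightarrow> (D has_derivative blinfun_apply (D2 x)) (at x within S)" "continuous_on S D2"
    using assms(2) unfolding C2_on_def by blast
  define LL where "LL = Blinfun L"
  have LL: "blinfun_apply LL = L" by (simp add: LL_def L bounded_linear_Blinfun_apply)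
  have bl: "bounded_linear (\<lambda>A :: 'a \<Rightarrow>\<^sub>L 'b. LL o\<^sub>L A)"
    by (rule bounded_bilinear.bounded_linear_right[OF bounded_bilinear_blinfun_compose])
  define C where "C = Blinfun (\<lambda>A :: 'a \<Rightarrow>\<^sub>L 'b. LL o\<^sub>L A)"
  have C: "blinfun_apply C = (\<lambda>A. LL o\<^sub>L A)" by (simp add: C_def bl bounded_linear_Blinfun_apply)
  show ?thesis
    unfolding C2_on_def
  proof (intro exI conjI ballI)
    fix x assume x: "x \<in> S"
    show "((\<lambda>x. L (F x)) has_derivative blinfun_apply (LL o\<^sub>L D x)) (at x within S)"
      using bounded_linear.has_derivative[OF L F(1)[OF x]]
      by (simp add: blinfun_compose.rep_eq LL o_def)
    show "((\<lambda>x. LL o\<^sub>L D x) has_derivative blinfun_apply (C o\<^sub>L D2 x)) (at x within S)"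
      using bounded_linear.has_derivative[OF bl F(2)[OF x]]
      by (simp add: blinfun_compose.rep_eq C o_def)
  next
    show "continuous_on S (\<lambda>x. C o\<^sub>L D2 x)"
      using F(3) by (intro continuous_intros)
  qed
qed

lemma C2_on_diff:
  fixes F G :: "'a::euclidean_space \<Rightarrow> 'b::euclidean_space"
  assumes "C2_on S F" "C2_on S G"
  shows "C2_on S (\<lambda>x. F x - G x)"
  using C2_on_add[OF assms(1) C2_on_bounded_linear[OF bounded_linear_minus[OF bounded_linear_ident] assms(2)]]
  by simp

text \<open>An affine inner map has a constant derivative, so the second derivative needs no product
  rule. This case covers coordinate maps and the projections behind the smooth minorant.\<close>

lemma C2_on_compose_affine:
  fixes F :: "'b::euclidean_space \<Rightarrow> 'c::euclidean_space" and L :: "'a::euclidean_space \<Rightarrow> 'b"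
  assumes L: "bounded_linear L" and "C2_on S F" and T: "\<And>x. x \<in> T \<Longrightarrow> L x + c \<in> S"
  shows "C2_on T (\<lambda>x. F (L x + c))"
proof -
  obtain D D2 where F: "\<And>x. x \<in> S \<Longrightarrow> (F has_derivative blinfun_apply (D x)) (at x within S)"
    "\<And>x. x \<in> S \<Longrightarrow> (D has_derivative blinfun_apply (D2 x)) (at x within S)" "continuous_on S D2"
    using assms(2) unfolding C2_on_def by blast
  have im: "(\<lambda>x. L x + c) ` T \<subseteq> S" using T by auto
  define LL where "LL = Blinfun L"
  have LL: "blinfun_apply LL = L" by (simp add: LL_def L bounded_linear_Blinfun_apply)
  have bl: "bounded_linear (\<lambda>A :: 'b \<Rightarrow>\<^sub>L 'c. A o\<^sub>L LL)"
    by (rule bounded_bilinear.bounded_linear_left[OF bounded_bilinear_blinfun_compose])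
  define C where "C = Blinfun (\<lambda>A :: 'b \<Rightarrow>\<^sub>L 'c. A o\<^sub>L LL)"
  have C: "blinfun_apply C = (\<lambda>A. A o\<^sub>L LL)" by (simp add: C_def bl bounded_linear_Blinfun_apply)
  have Ld: "((\<lambda>x. L x + c) has_derivative L) (at x within T)" for x
    using L by (intro has_derivative_add_const bounded_linear_imp_has_derivative)
  show ?thesis
    unfolding C2_on_def
  proof (intro exI conjI ballI)
    fix x assume x: "x \<in> T"
    have comp: "((\<lambda>x. G (L x + c)) has_derivative (\<lambda>d. A (L d))) (at x within T)"
      if "(G has_derivative A) (at (L x + c) within S)"
      for G :: "'b \<Rightarrow> 'd::real_normed_vector" and A
      by (rule has_derivative_in_compose[OF Ld has_derivative_subset[OF that im]])
    show "((\<lambda>x. F (L x + c)) has_derivative blinfun_apply (D (L x + c) o\<^sub>L LL)) (at x within T)"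
      using comp[OF F(1)[OF T[OF x]]] by (simp add: blinfun_compose.rep_eq LL o_def)
    show "((\<lambda>x. D (L x + c) o\<^sub>L LL) has_derivative
        blinfun_apply (C o\<^sub>L (D2 (L x + c) o\<^sub>L LL))) (at x within T)"
      using bounded_linear.has_derivative[OF bl comp[OF F(2)[OF T[OF x]]]]
      by (simp add: blinfun_compose.rep_eq LL C o_def)
  next
    have "continuous_on T (\<lambda>x. L x + c)"
      by (rule has_derivative_continuous_on) (rule Ld)
    then have "continuous_on T (\<lambda>x. D2 (L x + c))"
      by (rule continuous_on_compose2[OF F(3) _ im])
    then show "continuous_on T (\<lambda>x. C o\<^sub>L (D2 (L x + c) o\<^sub>L LL))"
      by (intro continuous_intros)
  qed
qed

lemma has_derivative_norm_square:
  fixes a :: "'a::euclidean_space"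
  shows "((\<lambda>y. (y - a) \<bullet> (y - a)) has_derivative (\<lambda>d. (2 *\<^sub>R (x - a)) \<bullet> d)) (at x within S)"
  by (auto intro!: derivative_eq_intros simp: inner_commute)

text \<open>Serves the structure function that touches \<open>q\<close> at the base point
  only.\<close>

lemma C2_on_norm_square:
  fixes a :: "'a::euclidean_space"
  shows "C2_on S (\<lambda>y. (y - a) \<bullet> (y - a))"
proof -
  have bl: "bounded_linear (\<lambda>y::'a. blinfun_inner_right (2 *\<^sub>R y))"
    by (intro bounded_linear_compose[OF bounded_linear_blinfun_inner_right] bounded_linear_scaleR_right)
  define A where "A = Blinfun (\<lambda>y::'a. blinfun_inner_right (2 *\<^sub>R y))"
  have A: "blinfun_apply A = (\<lambda>y. blinfun_inner_right (2 *\<^sub>R y))"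
    by (simp add: A_def bounded_linear_Blinfun_apply[OF bl])
  have 1: "((\<lambda>y. (y - a) \<bullet> (y - a)) has_derivative blinfun_apply (A (x - a))) (at x within S)" for x
    using has_derivative_norm_square[of a x S] by (simp only: A blinfun_inner_right.rep_eq)
  have "((\<lambda>x. x - a) has_derivative (\<lambda>d. d)) (at x within S)" for x
    by (auto intro!: derivative_eq_intros)
  then have 2: "((\<lambda>x. A (x - a)) has_derivative blinfun_apply A) (at x within S)" for x
    by (rule bounded_linear.has_derivative[OF blinfun.bounded_linear_right[of A]])
  show ?thesis
    unfolding C2_on_def
    by (rule exI[of _ "\<lambda>x. A (x - a)"], rule exI[of _ "\<lambda>_. A"]) (use 1 2 in simp)
qed

subsection \<open>Products of spaces\<close>

lemma mem_prod_space: "x \<in> prod_space X \<longleftrightarrow> (\<forall>i. x $ i \<in> X i)"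
  by (simp add: prod_space_def)

lemma axis_component: "axis i a $ j = (if j = i then a else 0)"
  by (simp add: axis_def)

lemma subspace_prod_space:
  assumes "\<And>i. subspace (X i)"
  shows "subspace (prod_space X)"
  using assms by (auto simp: subspace_def mem_prod_space)

lemma axis_in_prod_space:
  assumes "\<And>i. subspace (X i)"
  shows "axis i z \<in> prod_space X \<longleftrightarrow> z \<in> X i"
  using assms by (auto simp: mem_prod_space axis_component subspace_0)

lemma sum_axis: "(\<Sum>i\<in>UNIV. axis i (a i)) = (\<chi> i. a i)"
  for a :: "'k::finite \<Rightarrow> 'a::euclidean_space"
proof (subst vec_eq_iff, rule allI)
  fix j
  have "(\<Sum>i\<in>UNIV. axis i (a i)) $ j = (\<Sum>i\<in>UNIV. if j = i then a i else 0)"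
    by (simp only: sum_component axis_component)
  then show "(\<Sum>i\<in>UNIV. axis i (a i)) $ j = (\<chi> i. a i) $ j" by simp
qed

lemma sum_axis_component: "(\<Sum>i\<in>UNIV. axis i (x $ i)) = x"
  for x :: "'a::euclidean_space ^ 'k"
  by (simp add: sum_axis)

lemma linear_axis: "linear (axis i :: 'a::euclidean_space \<Rightarrow> 'a ^ 'k)"
  by (rule linearI) (auto simp: vec_eq_iff axis_component)

lemma bounded_linear_axis: "bounded_linear (axis i :: 'a::euclidean_space \<Rightarrow> 'a ^ 'k)"
  using linear_axis linear_conv_bounded_linear by blast

lemma norm_axis: "norm (axis i a) = norm a" for a :: "'a::euclidean_space"
  by (simp add: norm_eq_sqrt_inner inner_axis_axis)

lemma norm_le_sum_components: "norm x \<le> (\<Sum>i\<in>UNIV. norm (x $ i))"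
  by (simp add: norm_vec_def L2_set_le_sum)

lemma has_derivative_component:
  fixes x :: "'a::euclidean_space ^ 'k"
  assumes "(F has_derivative D) (at (x $ i) within X i)"
  shows "((\<lambda>y. F (y $ i)) has_derivative (\<lambda>d. D (d $ i))) (at x within prod_space X)"
proof (rule has_derivative_in_compose[OF bounded_linear_imp_has_derivative[OF bounded_linear_vec_nth]])
  show "(F has_derivative D) (at (x $ i) within (\<lambda>y. y $ i) ` prod_space X)"
    by (rule has_derivative_subset[OF assms]) (auto simp: mem_prod_space)
qed

lemma has_derivative_prod:
  fixes x :: "'a::euclidean_space ^ 'k" and F :: "'k::finite \<Rightarrow> 'a \<Rightarrow> 'b::euclidean_space"
  assumes "\<And>i. (F i has_derivative D i) (at (x $ i) within X i)"
  shows "((\<lambda>y. \<chi> i. F i (y $ i)) has_derivative (\<lambda>d. \<chi> i. D i (d $ i))) (at x within prod_space X)"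
  unfolding sum_axis[symmetric]
  by (intro has_derivative_sum bounded_linear.has_derivative[OF bounded_linear_axis]
      has_derivative_component assms)

lemma C2_on_component:
  fixes F :: "'a::euclidean_space \<Rightarrow> 'b::euclidean_space"
  assumes "C2_on S F" "\<And>y. y \<in> T \<Longrightarrow> y $ i \<in> S"
  shows "C2_on T (\<lambda>y :: 'a ^ 'k. F (y $ i))"
  using C2_on_compose_affine[OF bounded_linear_vec_nth assms(1), of T i 0] assms(2) by simp

lemma C2_on_prod:
  fixes F :: "'k::finite \<Rightarrow> 'a::euclidean_space \<Rightarrow> 'b::euclidean_space"
  assumes "\<And>i. C2_on (S i) (F i)" "\<And>y i. y \<in> T \<Longrightarrow> y $ i \<in> S i"
  shows "C2_on T (\<lambda>y :: 'a ^ 'k. \<chi> i. F i (y $ i))"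
  unfolding sum_axis[symmetric]
  by (intro C2_on_sum C2_on_bounded_linear[OF bounded_linear_axis] C2_on_component[OF assms(1)] assms(2))

text \<open>Orthogonal bases of the factors, placed on the axes, are orthogonal together. That they
  avoid 0 gives independence, and also injectivity of the indexing, as only 0 lies on two
  axes.\<close>

lemma dim_prod_space:
  fixes X :: "'k::finite \<Rightarrow> 'a::euclidean_space set"
  assumes X: "\<And>i. subspace (X i)"
  shows "dim (prod_space X) = (\<Sum>i\<in>UNIV. dim (X i))"
proof -
  have "\<exists>B. B \<subseteq> X i \<and> 0 \<notin> B \<and> pairwise orthogonal B \<and> independent B \<and> card B = dim (X i) \<and> span B = X i" for i
  proof -
    obtain B where B: "B \<subseteq> X i" "pairwise orthogonal B" "\<And>x. x \<in> B \<Longrightarrow> norm x = 1"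
      "independent B" "card B = dim (X i)" "span B = X i"
      using orthonormal_basis_subspace[OF X] by metis
    moreover have "0 \<notin> B" using B(3)[of 0] by auto
    ultimately show ?thesis by (intro exI[of _ B] conjI)
  qed
  then obtain B where B: "\<And>i. B i \<subseteq> X i" "\<And>i. 0 \<notin> B i" "\<And>i. pairwise orthogonal (B i)"
    "\<And>i. independent (B i)" "\<And>i. card (B i) = dim (X i)" "\<And>i. span (B i) = X i"
    by metis
  have fin: "finite (B i)" for i
    using B(4) independent_imp_finite by blast
  define C where "C = (\<lambda>(i, b). axis i b) ` (SIGMA i:UNIV. B i)"
  have inj: "inj_on (\<lambda>(i, b). axis i b) (SIGMA i:UNIV. B i)"
    using B(2) by (auto simp: inj_on_def axis_eq_axis)
  have "pairwise orthogonal C"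
    using B(3) by (auto simp: C_def pairwise_def orthogonal_def inner_axis_axis) metis
  moreover have "0 \<notin> C" using B(2) by (auto simp: C_def axis_eq_0_iff)
  ultimately have ind: "independent C" by (rule pairwise_orthogonal_independent)
  have sub: "C \<subseteq> prod_space X"
    using subsetD[OF B(1)] by (auto simp: C_def axis_in_prod_space[OF X])
  have "x \<in> span C" if x: "x \<in> prod_space X" for x
  proof -
    have "axis i (x $ i) \<in> span C" for i
    proof -
      have "x $ i \<in> span (B i)" using x B(6) by (simp add: mem_prod_space)
      then have "axis i (x $ i) \<in> axis i ` span (B i)" by blast
      also have "\<dots> = span (axis i ` B i)" by (rule linear_span_image[OF linear_axis, symmetric])
      also have "\<dots> \<subseteq> span C" by (intro span_mono) (auto simp: C_def)
      finally show ?thesis .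
    qed
    then have "(\<Sum>i\<in>UNIV. axis i (x $ i)) \<in> span C" by (intro span_sum)
    then show ?thesis by (simp add: sum_axis_component)
  qed
  then have "dim (prod_space X) = card C"
    using sub ind by (intro dim_unique[of C]) auto
  also have "\<dots> = card (SIGMA i:UNIV. B i)" unfolding C_def by (rule card_image[OF inj])
  also have "\<dots> = (\<Sum>i\<in>UNIV. card (B i))" using fin by simp
  finally show ?thesis by (simp add: B(5))
qed

lemma gradient_component:
  fixes x :: "'a::euclidean_space ^ 'k"
  assumes X: "\<And>i. subspace (X i)" and x: "x \<in> prod_space X"
    and D: "(F has_derivative D) (at (x $ i) within X i)"
  shows "gradient (prod_space X) (\<lambda>y. F (y $ i)) x = axis i (gradient (X i) F (x $ i))"
proof (rule gradient_eqI[OF subspace_prod_space[OF X] x])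
  have xi: "x $ i \<in> X i" using x by (simp add: mem_prod_space)
  note g = gradient_works[OF X xi D]
  show "axis i (gradient (X i) F (x $ i)) \<in> prod_space X"
    using g(1) by (simp add: axis_in_prod_space[OF X])
  have eq: "(\<bullet>) (axis i (gradient (X i) F (x $ i))) = (\<lambda>d. gradient (X i) F (x $ i) \<bullet> d $ i)"
    by (simp add: fun_eq_iff inner_axis')
  show "((\<lambda>y. F (y $ i)) has_derivative (\<bullet>) (axis i (gradient (X i) F (x $ i)))) (at x within prod_space X)"
    unfolding eq by (rule has_derivative_component) (rule g(2))
qed

lemma gradient_sum_components:
  fixes x :: "'a::euclidean_space ^ 'k"
  assumes X: "\<And>i. subspace (X i)" and x: "x \<in> prod_space X"
    and D: "\<And>i. (F i has_derivative D i) (at (x $ i) within X i)"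
  shows "gradient (prod_space X) (\<lambda>y. \<Sum>i\<in>UNIV. F i (y $ i)) x = (\<chi> i. gradient (X i) (F i) (x $ i))"
proof (rule gradient_eqI[OF subspace_prod_space[OF X] x])
  have xi: "x $ i \<in> X i" for i using x by (simp add: mem_prod_space)
  note g = gradient_works[OF X xi D]
  show "(\<chi> i. gradient (X i) (F i) (x $ i)) \<in> prod_space X"
    using g(1) by (simp add: mem_prod_space)
  have "((\<lambda>y. \<Sum>i\<in>UNIV. F i (y $ i)) has_derivative (\<lambda>d. \<Sum>i\<in>UNIV. gradient (X i) (F i) (x $ i) \<bullet> d $ i))
      (at x within prod_space X)"
    by (intro has_derivative_sum has_derivative_component g(2))
  moreover have "(\<bullet>) (\<chi> i. gradient (X i) (F i) (x $ i)) =
      (\<lambda>d. \<Sum>i\<in>UNIV. gradient (X i) (F i) (x $ i) \<bullet> d $ i)"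
    by (simp add: fun_eq_iff inner_vec_def)
  ultimately show "((\<lambda>y. \<Sum>i\<in>UNIV. F i (y $ i)) has_derivative
      (\<bullet>) (\<chi> i. gradient (X i) (F i) (x $ i))) (at x within prod_space X)"
    by simp
qed

subsection \<open>Lower semicontinuity and subdifferentials of separable sums\<close>

text \<open>The punctured neighbourhood may be filled, because \<open>c < f x\<close> holds at
  \<open>x\<close> itself.\<close>

lemma lsc_on_iff:
  "lsc_on E f \<longleftrightarrow> (\<forall>x\<in>E. \<forall>c<f x. \<exists>d>0. \<forall>y\<in>E. norm (y - x) < d \<longrightarrow> c < f y)"
proof -
  have "(\<forall>\<^sub>F y in at x within E. c < f y) \<longleftrightarrow> (\<exists>d>0. \<forall>y\<in>E. norm (y - x) < d \<longrightarrow> c < f y)"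
    if "c < f x" for x c
    using that by (auto simp: eventually_at dist_norm)
  then show ?thesis
    unfolding lsc_on_def le_Liminf_iff by blast
qed

lemma lsc_on_compose:
  assumes f: "lsc_on E f" and \<Phi>: "continuous_on X \<Phi>" "\<Phi> ` X \<subseteq> E"
  shows "lsc_on X (\<lambda>x. f (\<Phi> x))"
  unfolding lsc_on_iff
proof (intro ballI allI impI)
  fix x c assume x: "x \<in> X" and c: "c < f (\<Phi> x)"
  have "\<Phi> x \<in> E" using x \<Phi>(2) by blast
  then obtain d where d: "d > 0" "\<And>y. y \<in> E \<Longrightarrow> norm (y - \<Phi> x) < d \<Longrightarrow> c < f y"
    using f c unfolding lsc_on_iff by blast
  obtain r where r: "r > 0" "\<And>y. y \<in> X \<Longrightarrow> norm (y - x) < r \<Longrightarrow> norm (\<Phi> y - \<Phi> x) < d"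
    using \<Phi>(1) x d(1) unfolding continuous_on_iff dist_norm by blast
  show "\<exists>d>0. \<forall>y\<in>X. norm (y - x) < d \<longrightarrow> c < f (\<Phi> y)"
    using r d(2) \<Phi>(2) by (intro exI[of _ r]) blast
qed

lemma abs_infty_iff: "p \<noteq> -\<infinity> \<Longrightarrow> \<bar>p\<bar> = \<infinity> \<longleftrightarrow> p = \<infinity>" for p :: ereal
  by (cases p) auto

lemma sum_not_MInfty:
  fixes f :: "'i \<Rightarrow> ereal"
  assumes "\<And>i. i \<in> I \<Longrightarrow> f i \<noteq> -\<infinity>"
  shows "(\<Sum>i\<in>I. f i) \<noteq> -\<infinity>"
  using assms
proof (induction I rule: infinite_finite_induct)
  case (insert i I)
  then have "f i \<noteq> -\<infinity>" "(\<Sum>i\<in>I. f i) \<noteq> -\<infinity>" by blast+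
  with insert(1,2) show ?case by simp
qed simp_all

text \<open>Splits a lower bound for a sum into lower bounds for the summands, as semicontinuity of
  sums needs when values may be infinite.\<close>

lemma ereal_less_add_obtain:
  fixes c p q :: ereal
  assumes "c < p + q" "p \<noteq> -\<infinity>" "q \<noteq> -\<infinity>"
  shows "\<exists>a b. ereal a < p \<and> ereal b < q \<and> c \<le> ereal (a + b)"
proof -
  obtain C where C: "c \<le> ereal C" "ereal C < p + q"
    using assms(1) ereal_dense2[of c "p + q"] less_imp_le by blast
  show ?thesis
  proof (cases p)
    case (real P)
    show ?thesis
    proof (cases q)
      case (real Q)
      \<comment> \<open>Two finite values: the slack \<open>P + Q - C\<close> is shared
        equally.\<close>
      then show ?thesis using C \<open>p = ereal P\<close>
        by (intro exI[of _ "P - (P + Q - C) / 2"] exI[of _ "Q - (P + Q - C) / 2"]) (auto simp: field_simps)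
    next
      case PInf
      then show ?thesis using C \<open>p = ereal P\<close>
        by (intro exI[of _ "P - 1"] exI[of _ "C - P + 1"]) auto
    qed (use assms in auto)
  next
    case PInf
    obtain b where b: "ereal b < q"
      using assms(3) ereal_dense2[of "-\<infinity>" q] by auto
    show ?thesis using C b PInf by (intro exI[of _ "C - b"] exI[of _ b]) auto
  qed (use assms in auto)
qed

lemma lsc_on_add:
  assumes f: "lsc_on E f" "\<And>x. x \<in> E \<Longrightarrow> f x \<noteq> -\<infinity>" and g: "lsc_on E g" "\<And>x. x \<in> E \<Longrightarrow> g x \<noteq> -\<infinity>"
  shows "lsc_on E (\<lambda>x. f x + g x)"
  unfolding lsc_on_iff
proof (intro ballI allI impI)
  fix x c assume x: "x \<in> E" and c: "c < f x + g x"
  have "\<exists>a b. ereal a < f x \<and> ereal b < g x \<and> c \<le> ereal (a + b)"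
    using c f(2)[OF x] g(2)[OF x] by (rule ereal_less_add_obtain)
  then obtain a b where ab: "ereal a < f x" "ereal b < g x" "c \<le> ereal (a + b)" by blast
  obtain d where d: "d > 0" "\<And>y. y \<in> E \<Longrightarrow> norm (y - x) < d \<Longrightarrow> ereal a < f y"
    using f(1) x ab(1) unfolding lsc_on_iff by blast
  obtain e where e: "e > 0" "\<And>y. y \<in> E \<Longrightarrow> norm (y - x) < e \<Longrightarrow> ereal b < g y"
    using g(1) x ab(2) unfolding lsc_on_iff by blast
  have "c < f y + g y" if y: "y \<in> E" "norm (y - x) < min d e" for y
  proof -
    have "ereal a < f y" "ereal b < g y" using d(2) e(2) y by auto
    then have "ereal a + ereal b < f y + g y" by (rule ereal_add_strict_mono2)
    with ab(3) show ?thesis by simp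
  qed
  with d(1) e(1) show "\<exists>d>0. \<forall>y\<in>E. norm (y - x) < d \<longrightarrow> c < f y + g y"
    by (intro exI[of _ "min d e"]) auto
qed

lemma lsc_on_sum:
  assumes "finite I" "\<And>i. i \<in> I \<Longrightarrow> lsc_on E (f i)" "\<And>i x. i \<in> I \<Longrightarrow> x \<in> E \<Longrightarrow> f i x \<noteq> -\<infinity>"
  shows "lsc_on E (\<lambda>x. \<Sum>i\<in>I. f i x)"
  using assms
proof (induction I)
  case empty
  then show ?case by (auto simp: lsc_on_iff intro!: exI[of _ "1::real"])
next
  case (insert i I)
  have "lsc_on E (\<lambda>x. f i x + (\<Sum>i\<in>I. f i x))"
    using insert by (intro lsc_on_add) (auto simp: sum_not_MInfty)
  with insert show ?case by simp
qed

section \<open>Regular and limiting subgradients in epsilon form\<close>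

lemma regular_subdiff_iff:
  "g \<in> regular_subdiff E f x \<longleftrightarrow> g \<in> E \<and> x \<in> E \<and> \<bar>f x\<bar> \<noteq> \<infinity> \<and>
    (\<forall>e>0. \<exists>d>0. \<forall>y\<in>E. norm (y - x) < d \<longrightarrow> f x + ereal (g \<bullet> (y - x) - e * norm (y - x)) \<le> f y)"
proof -
  have "(\<forall>\<^sub>F y in at x within E. f x + ereal (g \<bullet> (y - x) - e * norm (y - x)) \<le> f y) \<longleftrightarrow>
    (\<exists>d>0. \<forall>y\<in>E. norm (y - x) < d \<longrightarrow> f x + ereal (g \<bullet> (y - x) - e * norm (y - x)) \<le> f y)" for e
  proof -
    have "f x + ereal (g \<bullet> (x - x) - e * norm (x - x)) \<le> f x"
      by (simp add: zero_ereal_def[symmetric])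
    then have "(y \<noteq> x \<and> norm (y - x) < d \<longrightarrow> f x + ereal (g \<bullet> (y - x) - e * norm (y - x)) \<le> f y) \<longleftrightarrow>
      (norm (y - x) < d \<longrightarrow> f x + ereal (g \<bullet> (y - x) - e * norm (y - x)) \<le> f y)" for y d
      by metis
    then show ?thesis by (simp only: eventually_at dist_norm)
  qed
  then show ?thesis unfolding regular_subdiff_def by auto
qed

text \<open>One term of an approximating sequence, at accuracy \<open>e\<close>. Comparing values
  through \<open>real_of_ereal\<close> loses nothing: \<open>f y\<close> is finite as soon as
  \<open>y\<close> has a regular subgradient, and \<open>f x\<close> is finite wherever the
  abbreviation is applied.\<close>

abbreviation near_subgradient ::
    "'a::euclidean_space set \<Rightarrow> ('a \<Rightarrow> ereal) \<Rightarrow> 'a \<Rightarrow> 'a \<Rightarrow> real \<Rightarrow> bool" where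
  "near_subgradient E f x g e \<equiv> \<exists>y g'. norm (y - x) < e \<and>
    \<bar>real_of_ereal (f y) - real_of_ereal (f x)\<bar> < e \<and> g' \<in> regular_subdiff E f y \<and> norm (g' - g) < e"

text \<open>Trades sequences for an accuracy condition: finitely many summands can then be treated
  at a common accuracy, and closedness needs no diagonal sequence.\<close>

lemma limiting_subdiff_iff:
  fixes f :: "'a::euclidean_space \<Rightarrow> ereal"
  shows "g \<in> limiting_subdiff E f x \<longleftrightarrow> x \<in> E \<and> \<bar>f x\<bar> \<noteq> \<infinity> \<and>
    (\<forall>e>0. near_subgradient E f x g e)" (is "?L \<longleftrightarrow> ?R")
proof
  assume ?L
  then obtain xs gs where x: "x \<in> E" "\<bar>f x\<bar> \<noteq> \<infinity>" and s: "xs \<longlonglongrightarrow> x" "(\<lambda>n. f (xs n)) \<longlonglongrightarrow> f x"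
    "\<forall>n. gs n \<in> regular_subdiff E f (xs n)" "gs \<longlonglongrightarrow> g"
    unfolding limiting_subdiff_def mem_Collect_eq by (elim conjE exE) (rule that)
  have "(\<lambda>n. f (xs n)) \<longlonglongrightarrow> ereal (real_of_ereal (f x))" using s(2) x(2) by (simp add: ereal_real')
  then have r: "(\<lambda>n. real_of_ereal (f (xs n))) \<longlonglongrightarrow> real_of_ereal (f x)"
    by (rule lim_real_of_ereal)
  have "near_subgradient E f x g e" if e: "e > 0" for e
  proof -
    have "\<forall>\<^sub>F n in sequentially. norm (xs n - x) < e \<and>
        \<bar>real_of_ereal (f (xs n)) - real_of_ereal (f x)\<bar> < e \<and> norm (gs n - g) < e"
      using tendstoD[OF s(1) e] tendstoD[OF r e] tendstoD[OF s(4) e]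
      by eventually_elim (auto simp: dist_norm)
    then obtain n where "norm (xs n - x) < e" "\<bar>real_of_ereal (f (xs n)) - real_of_ereal (f x)\<bar> < e"
      "norm (gs n - g) < e"
      using eventually_happens'[OF sequentially_bot] by blast
    then show ?thesis using s(3) by blast
  qed
  with x show ?R by blast
next
  assume R: ?R
  then have "\<forall>n. \<exists>y g'. norm (y - x) < 1 / real (Suc n) \<and>
      \<bar>real_of_ereal (f y) - real_of_ereal (f x)\<bar> < 1 / real (Suc n) \<and>
      g' \<in> regular_subdiff E f y \<and> norm (g' - g) < 1 / real (Suc n)"
    by simp
  then obtain xs gs where s: "\<And>n. norm (xs n - x) < 1 / real (Suc n)"
    "\<And>n. \<bar>real_of_ereal (f (xs n)) - real_of_ereal (f x)\<bar> < 1 / real (Suc n)"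
    "\<And>n. gs n \<in> regular_subdiff E f (xs n)" "\<And>n. norm (gs n - g) < 1 / real (Suc n)"
    by metis
  have lim: "a \<longlonglongrightarrow> b" if "\<And>n. norm (a n - b) < 1 / real (Suc n)" for a and b :: "'c::real_normed_vector"
    using that LIMSEQ_inverse_real_of_nat
    by (intro Lim_null_comparison[of "\<lambda>n. a n - b" "\<lambda>n. inverse (real (Suc n))", THEN LIM_zero_cancel])
      (auto intro!: always_eventually less_imp_le simp: inverse_eq_divide)
  have "(\<lambda>n. real_of_ereal (f (xs n))) \<longlonglongrightarrow> real_of_ereal (f x)"
    using s(2) by (intro lim) simp
  then have "(\<lambda>n. ereal (real_of_ereal (f (xs n)))) \<longlonglongrightarrow> ereal (real_of_ereal (f x))"
    by (rule tendsto_ereal)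
  moreover have "\<bar>f (xs n)\<bar> \<noteq> \<infinity>" for n using s(3)[of n] by (simp add: regular_subdiff_iff)
  ultimately have "(\<lambda>n. f (xs n)) \<longlonglongrightarrow> f x" using R by (simp add: ereal_real')
  moreover have "xs \<longlonglongrightarrow> x" "gs \<longlonglongrightarrow> g" using s(1,4) by (intro lim; simp)+
  ultimately have "\<exists>xs gs. xs \<longlonglongrightarrow> x \<and> (\<lambda>n. f (xs n)) \<longlonglongrightarrow> f x \<and>
      (\<forall>n. gs n \<in> regular_subdiff E f (xs n)) \<and> gs \<longlonglongrightarrow> g"
    using s(3) by metis
  with R show ?L unfolding limiting_subdiff_def mem_Collect_eq by (elim conjE) (intro conjI)
qed

lemma regular_subset_limiting: "regular_subdiff E f x \<subseteq> limiting_subdiff E f x"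
proof
  fix g assume g: "g \<in> regular_subdiff E f x"
  then have "near_subgradient E f x g e" if "e > 0" for e
    using that by (intro exI[of _ x] exI[of _ g]) auto
  with g show "g \<in> limiting_subdiff E f x"
    by (auto simp: limiting_subdiff_iff regular_subdiff_iff)
qed

lemma limiting_subdiff_subset:
  assumes "subspace E"
  shows "limiting_subdiff E f x \<subseteq> E"
proof
  fix g assume "g \<in> limiting_subdiff E f x"
  then obtain gs where "\<And>n. gs n \<in> E" "gs \<longlonglongrightarrow> g"
    unfolding limiting_subdiff_def regular_subdiff_def by blast
  then show "g \<in> E" using closed_subspace[OF assms] closed_sequentially by blast
qed

lemma closed_limiting_subdiff: "closed (limiting_subdiff E f x)"
proof (unfold closed_sequential_limits, intro allI impI, elim conjE)
  fix gs g assume gs: "\<forall>n. gs n \<in> limiting_subdiff E f x" "gs \<longlonglongrightarrow> g"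
  have x: "x \<in> E" "\<bar>f x\<bar> \<noteq> \<infinity>" using gs(1) by (auto simp: limiting_subdiff_iff)
  have "near_subgradient E f x g e" if e: "e > 0" for e
  proof -
    obtain n where n: "norm (gs n - g) < e / 2"
      using LIMSEQ_D[OF gs(2), of "e / 2"] e by auto
    have "0 < e / 2" using e by simp
    then obtain y g' where y: "norm (y - x) < e / 2"
      "\<bar>real_of_ereal (f y) - real_of_ereal (f x)\<bar> < e / 2"
      "g' \<in> regular_subdiff E f y" "norm (g' - gs n) < e / 2"
      using gs(1) unfolding limiting_subdiff_iff by blast
    have "norm (g' - g) < e" using norm_triangle_lt[of "g' - gs n" "gs n - g" e] n y(4) by simp
    then show ?thesis using y e by (intro exI[of _ y] exI[of _ g']) auto
  qed
  with x show "g \<in> limiting_subdiff E f x" by (simp add: limiting_subdiff_iff)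
qed

text \<open>Instantiated twice in the end, with the outer functions \<open>h i\<close> and with
  their compositions with \<open>\<Phi> i\<close>.\<close>

locale separable_sum =
  fixes X :: "'k::finite \<Rightarrow> 'a::euclidean_space set" and f :: "'k \<Rightarrow> 'a \<Rightarrow> ereal"
  assumes X: "\<And>i. subspace (X i)" and f: "\<And>i. lsc_on (X i) (f i)" "\<And>i y. y \<in> X i \<Longrightarrow> f i y \<noteq> -\<infinity>"
begin

definition total :: "'a ^ 'k \<Rightarrow> ereal" where
  "total x = (\<Sum>i\<in>UNIV. f i (x $ i))"

lemma subspace_X: "subspace (prod_space X)"
  by (rule subspace_prod_space[OF X])

lemma total_not_MInfty: "x \<in> prod_space X \<Longrightarrow> total x \<noteq> -\<infinity>"
  using f(2) unfolding total_def mem_prod_space by (intro sum_not_MInfty) auto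

lemma total_finite:
  assumes "x \<in> prod_space X"
  shows "\<bar>total x\<bar> \<noteq> \<infinity> \<longleftrightarrow> (\<forall>i. \<bar>f i (x $ i)\<bar> \<noteq> \<infinity>)"
proof -
  have "total x = \<infinity> \<longleftrightarrow> (\<exists>i. f i (x $ i) = \<infinity>)" by (auto simp: total_def sum_Pinfty)
  then show ?thesis
    using abs_infty_iff[OF total_not_MInfty[OF assms]] abs_infty_iff[OF f(2)] assms
    by (simp add: mem_prod_space)
qed

lemma total_real:
  assumes "\<And>i. \<bar>f i (x $ i)\<bar> \<noteq> \<infinity>"
  shows "total x = ereal (\<Sum>i\<in>UNIV. real_of_ereal (f i (x $ i)))"
proof -
  have "total x = (\<Sum>i\<in>UNIV. ereal (real_of_ereal (f i (x $ i))))"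
    unfolding total_def using assms by (intro sum.cong refl) (simp add: ereal_real')
  then show ?thesis by (simp only: sum_ereal)
qed

lemma lsc_total: "lsc_on (prod_space X) total"
proof -
  have "lsc_on (prod_space X) (\<lambda>x. f i (x $ i))" for i
    by (rule lsc_on_compose[OF f(1)[of i] linear_continuous_on[OF bounded_linear_vec_nth]])
      (auto simp: mem_prod_space)
  then show ?thesis
    unfolding total_def using f(2) by (intro lsc_on_sum) (auto simp: mem_prod_space)
qed

text \<open>A subgradient of the sum is tested by varying one component at a time. Conversely, the
  inequalities of the components add up, with the error \<open>e\<close> shared equally among
  them.\<close>

lemma regular_subdiff_total:
  "g \<in> regular_subdiff (prod_space X) total x \<longleftrightarrow> (\<forall>i. g $ i \<in> regular_subdiff (X i) (f i) (x $ i))"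
proof
  assume g: "g \<in> regular_subdiff (prod_space X) total x"
  then have x: "x \<in> prod_space X" and gX: "g \<in> prod_space X" and fin: "\<And>i. \<bar>f i (x $ i)\<bar> \<noteq> \<infinity>"
    using total_finite[of x] unfolding regular_subdiff_iff by auto
  show "\<forall>i. g $ i \<in> regular_subdiff (X i) (f i) (x $ i)"
    unfolding regular_subdiff_iff
  proof (intro allI conjI impI)
    fix i and e :: real assume e: "e > 0"
    obtain d where d: "d > 0" "\<And>y. y \<in> prod_space X \<Longrightarrow> norm (y - x) < d \<Longrightarrow>
        total x + ereal (g \<bullet> (y - x) - e * norm (y - x)) \<le> total y"
      using g e unfolding regular_subdiff_iff by blast
    have "f i (x $ i) + ereal (g $ i \<bullet> (y - x $ i) - e * norm (y - x $ i)) \<le> f i y"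
      if y: "y \<in> X i" "norm (y - x $ i) < d" for y
    proof (cases "f i y = \<infinity>")
      case False
      \<comment> \<open>Only component \<open>i\<close> moves; the terms of all other components are
        finite and cancel.\<close>
      define z where "z = x + axis i (y - x $ i)"
      have z: "z $ j = (if j = i then y else x $ j)" for j by (simp add: z_def axis_component)
      have zX: "z \<in> prod_space X" using x y by (auto simp: mem_prod_space z)
      have zx: "z - x = axis i (y - x $ i)" by (simp add: z_def)
      have fz: "\<bar>f j (z $ j)\<bar> \<noteq> \<infinity>" for j using fin f(2)[OF y(1)] False by (auto simp: z)
      have "total x + ereal (g \<bullet> (z - x) - e * norm (z - x)) \<le> total z"
        by (rule d(2)[OF zX]) (simp add: zx norm_axis y)
      then have "(\<Sum>j\<in>UNIV. real_of_ereal (f j (x $ j))) + (g $ i \<bullet> (y - x $ i) - e * norm (y - x $ i))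
          \<le> (\<Sum>j\<in>UNIV. real_of_ereal (f j (z $ j)))"
        by (simp add: total_real[OF fin] total_real[OF fz] zx norm_axis inner_axis)
      moreover have "(\<Sum>j\<in>UNIV. real_of_ereal (f j (x $ j))) =
          real_of_ereal (f i (x $ i)) + (\<Sum>j\<in>UNIV-{i}. real_of_ereal (f j (x $ j)))"
        by (rule sum.remove) auto
      moreover have "(\<Sum>j\<in>UNIV. real_of_ereal (f j (z $ j))) =
          real_of_ereal (f i y) + (\<Sum>j\<in>UNIV-{i}. real_of_ereal (f j (x $ j)))"
        by (subst sum.remove[of _ i]) (auto simp: z)
      ultimately have "real_of_ereal (f i (x $ i)) + (g $ i \<bullet> (y - x $ i) - e * norm (y - x $ i))
          \<le> real_of_ereal (f i y)" by linarith
      then have "ereal (real_of_ereal (f i (x $ i))) + ereal (g $ i \<bullet> (y - x $ i) - e * norm (y - x $ i))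
          \<le> ereal (real_of_ereal (f i y))" by simp
      then show ?thesis using fin[of i] fz[of i] by (simp add: z ereal_real')
    qed simp
    with d(1) show "\<exists>d>0. \<forall>y\<in>X i. norm (y - x $ i) < d \<longrightarrow>
        f i (x $ i) + ereal (g $ i \<bullet> (y - x $ i) - e * norm (y - x $ i)) \<le> f i y" by blast
  qed (use x gX fin in \<open>auto simp: mem_prod_space\<close>)
next
  assume g: "\<forall>i. g $ i \<in> regular_subdiff (X i) (f i) (x $ i)"
  then have x: "x \<in> prod_space X" and gX: "g \<in> prod_space X" and fin: "\<And>i. \<bar>f i (x $ i)\<bar> \<noteq> \<infinity>"
    unfolding regular_subdiff_iff by (auto simp: mem_prod_space)
  show "g \<in> regular_subdiff (prod_space X) total x"
    unfolding regular_subdiff_iff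
  proof (intro allI conjI impI)
    fix e :: real assume e: "e > 0"
    define e' where "e' = e / real CARD('k)"
    have e': "e' > 0" "(\<Sum>i\<in>(UNIV::'k set). e') = e" using e by (auto simp: e'_def)
    have "\<forall>i. \<exists>d>0. \<forall>y\<in>X i. norm (y - x $ i) < d \<longrightarrow>
        f i (x $ i) + ereal (g $ i \<bullet> (y - x $ i) - e' * norm (y - x $ i)) \<le> f i y"
      using g e'(1) unfolding regular_subdiff_iff by blast
    then obtain d where d: "\<And>i. d i > 0" "\<And>i y. y \<in> X i \<Longrightarrow> norm (y - x $ i) < d i \<Longrightarrow>
        f i (x $ i) + ereal (g $ i \<bullet> (y - x $ i) - e' * norm (y - x $ i)) \<le> f i y"
      by metis
    define r where "r = Min (range d)"
    have r: "r > 0" "\<And>i. r \<le> d i" using d(1) by (auto simp: r_def)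
    have "total x + ereal (g \<bullet> (y - x) - e * norm (y - x)) \<le> total y"
      if y: "y \<in> prod_space X" "norm (y - x) < r" for y
    proof -
      have ni: "norm (y $ i - x $ i) \<le> norm (y - x)" for i
        using Finite_Cartesian_Product.norm_nth_le[of "y - x" i] by simp
      have "(\<Sum>i\<in>UNIV. e' * norm (y $ i - x $ i)) \<le> (\<Sum>i\<in>(UNIV::'k set). e' * norm (y - x))"
        using ni e'(1) by (intro sum_mono mult_left_mono) auto
      also have "\<dots> = e * norm (y - x)" using e'(2) by (simp flip: sum_distrib_right)
      finally have "(\<Sum>i\<in>UNIV. e' * norm (y $ i - x $ i)) \<le> e * norm (y - x)" .
      then have "g \<bullet> (y - x) - e * norm (y - x)
          \<le> (\<Sum>i\<in>UNIV. g $ i \<bullet> (y $ i - x $ i) - e' * norm (y $ i - x $ i))"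
        by (simp add: inner_vec_def sum_subtractf)
      then have "total x + ereal (g \<bullet> (y - x) - e * norm (y - x)) \<le>
          total x + ereal (\<Sum>i\<in>UNIV. g $ i \<bullet> (y $ i - x $ i) - e' * norm (y $ i - x $ i))"
        by (intro add_left_mono) simp
      also have "\<dots> = (\<Sum>i\<in>UNIV. f i (x $ i) + ereal (g $ i \<bullet> (y $ i - x $ i) - e' * norm (y $ i - x $ i)))"
        by (simp only: total_def sum.distrib sum_ereal)
      also have "\<dots> \<le> total y"
        unfolding total_def
      proof (rule sum_mono)
        fix i
        show "f i (x $ i) + ereal (g $ i \<bullet> (y $ i - x $ i) - e' * norm (y $ i - x $ i)) \<le> f i (y $ i)"
        proof (rule d(2))
          show "y $ i \<in> X i" using y(1) by (simp add: mem_prod_space)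
          show "norm (y $ i - x $ i) < d i" using ni[of i] y(2) r(2)[of i] by linarith
        qed
      qed
      finally show ?thesis .
    qed
    with r(1) show "\<exists>d>0. \<forall>y\<in>prod_space X. norm (y - x) < d \<longrightarrow>
        total x + ereal (g \<bullet> (y - x) - e * norm (y - x)) \<le> total y" by blast
  qed (use x gX total_finite[OF x] fin in simp_all)
qed

text \<open>The hard direction is from the sum to the summands: convergence of the total values does
  not by itself control the single values. Semicontinuity bounds each of them from below, and then
  the convergent total bounds each from above.\<close>

lemma limiting_subdiff_total_iff:
  "g \<in> limiting_subdiff (prod_space X) total x \<longleftrightarrow> (\<forall>i. g $ i \<in> limiting_subdiff (X i) (f i) (x $ i))"
proof
  assume g: "g \<in> limiting_subdiff (prod_space X) total x"
  then have x: "x \<in> prod_space X" and fin: "\<And>i. \<bar>f i (x $ i)\<bar> \<noteq> \<infinity>"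
    using total_finite[of x] unfolding limiting_subdiff_iff by auto
  show "\<forall>i. g $ i \<in> limiting_subdiff (X i) (f i) (x $ i)"
  proof (subst limiting_subdiff_iff, intro allI conjI impI)
    fix i and e :: real assume e: "e > 0"
    \<comment> \<open>With this share the other summands can fall by at most \<open>e / 2\<close>
      together; the remaining \<open>e / 2\<close> is reserved for the deviation of the total, which
      is less than \<open>r\<close>.\<close>
    define e' where "e' = e / (2 * real CARD('k))"
    have e': "e' > 0" using e by (auto simp: e'_def)
    have "\<exists>d>0. \<forall>y\<in>X j. norm (y - x $ j) < d \<longrightarrow> ereal (real_of_ereal (f j (x $ j)) - e') < f j y" for j
    proof -
      have "ereal (real_of_ereal (f j (x $ j)) - e') < f j (x $ j)"
        using e' fin[of j] by (cases "f j (x $ j)") auto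
      moreover have "x $ j \<in> X j" using x by (simp add: mem_prod_space)
      ultimately show ?thesis using f(1)[of j] unfolding lsc_on_iff by blast
    qed
    then obtain d where d: "\<And>j. d j > 0" "\<And>j y. y \<in> X j \<Longrightarrow> norm (y - x $ j) < d j \<Longrightarrow>
        ereal (real_of_ereal (f j (x $ j)) - e') < f j y" by metis
    define r where "r = Min (insert (e / 2) (range d))"
    have r: "r > 0" "r \<le> e / 2" "\<And>j. r \<le> d j"
      using d(1) e by (auto simp: r_def intro: min.coboundedI2)
    obtain y g' where y: "norm (y - x) < r" "\<bar>real_of_ereal (total y) - real_of_ereal (total x)\<bar> < r"
      "g' \<in> regular_subdiff (prod_space X) total y" "norm (g' - g) < r"
      using g r(1) unfolding limiting_subdiff_iff by blast
    have gi: "g' $ j \<in> regular_subdiff (X j) (f j) (y $ j)" for j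
      using y(3) by (simp add: regular_subdiff_total)
    then have yX: "y $ j \<in> X j" and finy: "\<bar>f j (y $ j)\<bar> \<noteq> \<infinity>" for j
      by (auto simp: regular_subdiff_iff)
    have ni: "norm (y $ j - x $ j) < r" for j
      using Finite_Cartesian_Product.norm_nth_le[of "y - x" j] y(1) by simp
    define a where "a j = real_of_ereal (f j (x $ j))" for j
    define b where "b j = real_of_ereal (f j (y $ j))" for j
    have lo: "a j - e' < b j" for j
      using d(2)[OF yX, of j] ni[of j] r(3)[of j] finy[of j]
      by (cases "f j (y $ j)") (auto simp: a_def b_def)
    have tot: "\<bar>(\<Sum>j\<in>UNIV. b j) - (\<Sum>j\<in>UNIV. a j)\<bar> < r"
      using y(2) by (simp add: total_real[OF fin] total_real[OF finy] a_def b_def)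
    have "(\<Sum>j\<in>UNIV-{i}. a j - e') \<le> (\<Sum>j\<in>UNIV-{i}. b j)"
      using lo by (intro sum_mono less_imp_le)
    moreover have "(\<Sum>j\<in>UNIV-{i}. a j - e') \<ge> (\<Sum>j\<in>UNIV-{i}. a j) - e / 2"
    proof -
      have "(\<Sum>j\<in>UNIV-{i}. e') \<le> (\<Sum>j\<in>(UNIV::'k set). e')"
        using e' by (intro sum_mono2) auto
      also have "\<dots> = e / 2" by (simp add: e'_def)
      finally show ?thesis by (simp add: sum_subtractf)
    qed
    moreover have "(\<Sum>j\<in>UNIV. a j) = a i + (\<Sum>j\<in>UNIV-{i}. a j)"
      "(\<Sum>j\<in>UNIV. b j) = b i + (\<Sum>j\<in>UNIV-{i}. b j)"
      by (auto intro: sum.remove)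
    ultimately have "b i < a i + e" using tot r(2) by linarith
    moreover have "e' \<le> e"
    proof -
      have "real CARD('k) \<ge> 1" by (simp add: Suc_leI)
      then have "e * 1 \<le> e * (2 * real CARD('k))" using e by (intro mult_left_mono) linarith+
      then show ?thesis by (simp add: e'_def divide_le_eq)
    qed
    ultimately have "\<bar>b i - a i\<bar> < e" using lo[of i] by linarith
    moreover have "norm (y $ i - x $ i) < e" using ni[of i] r(2) e by linarith
    moreover have "norm (g' $ i - g $ i) < e"
      using Finite_Cartesian_Product.norm_nth_le[of "g' - g" i] y(4) r(2) e by simp
    ultimately show "near_subgradient (X i) (f i) (x $ i) (g $ i) e"
      using gi by (auto simp: a_def b_def)
  qed (use x fin in \<open>auto simp: mem_prod_space\<close>)
next
  assume g: "\<forall>i. g $ i \<in> limiting_subdiff (X i) (f i) (x $ i)"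
  then have x: "x \<in> prod_space X" and fin: "\<And>i. \<bar>f i (x $ i)\<bar> \<noteq> \<infinity>"
    unfolding limiting_subdiff_iff by (auto simp: mem_prod_space)
  show "g \<in> limiting_subdiff (prod_space X) total x"
    unfolding limiting_subdiff_iff
  proof (intro conjI allI impI)
    fix e :: real assume e: "e > 0"
    define e' where "e' = e / real CARD('k)"
    have e': "e' > 0" "(\<Sum>i\<in>(UNIV::'k set). e') = e" using e by (auto simp: e'_def)
    have "\<forall>i. near_subgradient (X i) (f i) (x $ i) (g $ i) e'"
      using g e'(1) unfolding limiting_subdiff_iff by blast
    then obtain y h where y: "\<And>i. norm (y i - x $ i) < e'"
      "\<And>i. \<bar>real_of_ereal (f i (y i)) - real_of_ereal (f i (x $ i))\<bar> < e'"
      "\<And>i. h i \<in> regular_subdiff (X i) (f i) (y i)" "\<And>i. norm (h i - g $ i) < e'"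
      by metis
    define yy where "yy = (\<chi> i. y i)"
    define hh where "hh = (\<chi> i. h i)"
    have finy: "\<bar>f i (yy $ i)\<bar> \<noteq> \<infinity>" for i using y(3)[of i] by (simp add: regular_subdiff_iff yy_def)
    have "hh \<in> regular_subdiff (prod_space X) total yy"
      using y(3) by (simp add: regular_subdiff_total yy_def hh_def)
    moreover have small: "(\<Sum>i\<in>(UNIV::'k set). a i) < e" if "\<And>i. a i < e'" for a
      using sum_strict_mono[of "UNIV::'k set" a "\<lambda>_. e'"] that e'(2) by simp
    have "norm (yy - x) < e"
      using norm_le_sum_components[of "yy - x"] small[of "\<lambda>i. norm (y i - x $ i)"] y(1) by (simp add: yy_def)
    moreover have "norm (hh - g) < e"
      using norm_le_sum_components[of "hh - g"] small[of "\<lambda>i. norm (h i - g $ i)"] y(4) by (simp add: hh_def)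
    moreover have "\<bar>real_of_ereal (total yy) - real_of_ereal (total x)\<bar> < e"
    proof -
      have "\<bar>real_of_ereal (total yy) - real_of_ereal (total x)\<bar>
          = \<bar>\<Sum>i\<in>UNIV. real_of_ereal (f i (y i)) - real_of_ereal (f i (x $ i))\<bar>"
        using total_real[OF fin] total_real[OF finy] by (simp add: sum_subtractf yy_def)
      also have "\<dots> \<le> (\<Sum>i\<in>UNIV. \<bar>real_of_ereal (f i (y i)) - real_of_ereal (f i (x $ i))\<bar>)"
        by (rule sum_abs)
      also have "\<dots> < e" by (rule small[OF y(2)])
      finally show ?thesis .
    qed
    ultimately show "near_subgradient (prod_space X) total x g e" by blast
  qed (use x fin total_finite[OF x] in simp_all)
qed

lemma limiting_subdiff_total:
  "limiting_subdiff (prod_space X) total x = prod_space (\<lambda>i. limiting_subdiff (X i) (f i) (x $ i))"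
  by (rule set_eqI) (simp only: limiting_subdiff_total_iff mem_prod_space)

end

subsection \<open>Relative interiors and the VU-decomposition\<close>

text \<open>The linear space parallel to the affine hull. Unlike \<open>V_space\<close> it names no
  base point, which makes it easy to handle in products.\<close>

definition diff_span :: "'a::euclidean_space set \<Rightarrow> 'a set" where
  "diff_span S = span {s - t |s t. s \<in> S \<and> t \<in> S}"

lemma subspace_diff_span: "subspace (diff_span S)"
  by (simp add: diff_span_def)

lemma diff_in_diff_span: "s \<in> S \<Longrightarrow> t \<in> S \<Longrightarrow> s - t \<in> diff_span S"
  unfolding diff_span_def by (intro span_base) blast

lemma diff_span_least:
  assumes "subspace T" "\<And>s t. s \<in> S \<Longrightarrow> t \<in> S \<Longrightarrow> s - t \<in> T"
  shows "diff_span S \<subseteq> T"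
  unfolding diff_span_def using assms by (intro span_minimal) auto

lemma span_diff_eq_diff_span:
  assumes "r \<in> S"
  shows "span ((\<lambda>s. s - r) ` S) = diff_span S"
proof
  show "span ((\<lambda>s. s - r) ` S) \<subseteq> diff_span S"
    using assms by (intro span_minimal subspace_diff_span) (auto intro: diff_in_diff_span)
  show "diff_span S \<subseteq> span ((\<lambda>s. s - r) ` S)"
  proof (rule diff_span_least)
    fix s t assume "s \<in> S" "t \<in> S"
    then have "(s - r) - (t - r) \<in> span ((\<lambda>s. s - r) ` S)"
      by (intro span_diff span_base) auto
    then show "s - t \<in> span ((\<lambda>s. s - r) ` S)" by simp
  qed simp
qed

text \<open>The affine hull is \<open>diff_span S\<close> translated by \<open>g\<close>, so the
  relative interior becomes a condition on small directions.\<close>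

lemma rel_interior_iff:
  "g \<in> rel_interior S \<longleftrightarrow> g \<in> S \<and> (\<exists>e>0. \<forall>d\<in>diff_span S. norm d < e \<longrightarrow> g + d \<in> S)"
proof (cases "g \<in> S")
  case True
  have "(\<lambda>x. - g + x) ` S = (\<lambda>s. s - g) ` S" by simp
  then have aff: "affine hull S = (+) g ` diff_span S"
    using affine_hull_span_gen[OF hull_inc[OF True]] span_diff_eq_diff_span[OF True] by simp
  have "ball g e \<inter> affine hull S \<subseteq> S \<longleftrightarrow> (\<forall>d\<in>diff_span S. norm d < e \<longrightarrow> g + d \<in> S)" for e
    by (auto simp: aff dist_norm)
  then show ?thesis using True by (simp add: mem_rel_interior_ball)
qed (simp add: mem_rel_interior_ball)

text \<open>Around a point of the relative interior, \<open>S\<close> contains small steps along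
  every direction of \<open>diff_span S\<close> and along its negative. A regular normal at a nearby
  point is therefore orthogonal to all of them, and orthogonality survives limits.\<close>

lemma normal_cone_rel_interior:
  assumes E: "subspace E" and g: "g \<in> rel_interior S"
  shows "limiting_normal_cone E S g = {z \<in> E. \<forall>d\<in>diff_span S. z \<bullet> d = 0}"
proof
  have gS: "g \<in> S" using g by (simp add: rel_interior_iff)
  obtain e where e: "e > 0" "\<And>d. d \<in> diff_span S \<Longrightarrow> norm d < e \<Longrightarrow> g + d \<in> S"
    using g by (auto simp: rel_interior_iff)
  have reg: "z \<bullet> d = 0"
    if z: "z \<in> regular_normal_cone E S x" and x: "norm (x - g) < e / 2" and d: "d \<in> diff_span S" for z x d
  proof -
    have xS: "x \<in> S" using z by (simp add: regular_normal_cone_def)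
    have le: "z \<bullet> d \<le> 0" if d: "d \<in> diff_span S" for d
    proof (rule ccontr)
      assume neg: "\<not> z \<bullet> d \<le> 0"
      then have d0: "d \<noteq> 0" by auto
      \<comment> \<open>Half the slope of \<open>z\<close> along \<open>d\<close>: short steps along
        \<open>d\<close> violate the cone inequality at this rate.\<close>
      define c where "c = z \<bullet> d / (2 * norm d)"
      have c: "c > 0" using neg d0 by (simp add: c_def)
      have "\<forall>\<^sub>F y in at x within S. z \<bullet> (y - x) \<le> c * norm (y - x)"
        using z c by (auto simp: regular_normal_cone_def)
      then obtain r where r: "r > 0" "\<And>y. y \<in> S \<Longrightarrow> y \<noteq> x \<Longrightarrow> norm (y - x) < r \<Longrightarrow> z \<bullet> (y - x) \<le> c * norm (y - x)"
        unfolding eventually_at dist_norm by blast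
      \<comment> \<open>The step must be short enough for the cone inequality (\<open>r\<close>)
        and, as \<open>x\<close> may be almost \<open>e / 2\<close> away from \<open>g\<close>, also
        for staying in \<open>S\<close>.\<close>
      define t where "t = min r (e / 2) / (2 * norm d)"
      have t: "t > 0" using r(1) e(1) d0 by (simp add: t_def)
      have td: "norm (t *\<^sub>R d) = min r (e / 2) / 2" using r(1) e(1) d0 by (simp add: t_def)
      have tdm: "norm (t *\<^sub>R d) < r" "norm (t *\<^sub>R d) < e / 2" using td r(1) e(1) by auto
      have "(x - g) + t *\<^sub>R d \<in> diff_span S"
        using subspace_add[OF subspace_diff_span diff_in_diff_span[OF xS gS] subspace_scale[OF subspace_diff_span d]] .
      moreover have "norm ((x - g) + t *\<^sub>R d) < e"
        using norm_triangle_ineq[of "x - g" "t *\<^sub>R d"] x tdm(2) by linarith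
      ultimately have "g + ((x - g) + t *\<^sub>R d) \<in> S" by (rule e(2))
      then have "x + t *\<^sub>R d \<in> S" by simp
      then have "z \<bullet> (x + t *\<^sub>R d - x) \<le> c * norm (x + t *\<^sub>R d - x)"
        using tdm(1) t d0 by (intro r(2)) auto
      then have "t * (z \<bullet> d) \<le> t * (c * norm d)" using t by (simp add: mult.left_commute)
      then have "z \<bullet> d \<le> c * norm d" using t by simp
      then show False using neg d0 by (simp add: c_def)
    qed
    show ?thesis
      using le[OF d] le[OF subspace_neg[OF subspace_diff_span d]] by simp
  qed
  show "limiting_normal_cone E S g \<subseteq> {z \<in> E. \<forall>d\<in>diff_span S. z \<bullet> d = 0}"
  proof
    fix z assume "z \<in> limiting_normal_cone E S g"
    then obtain xs zs where s: "xs \<longlonglongrightarrow> g" "\<forall>n. zs n \<in> regular_normal_cone E S (xs n)" "zs \<longlonglongrightarrow> z"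
      unfolding limiting_normal_cone_def mem_Collect_eq by (elim conjE exE) (rule that)
    have "z \<in> E"
      using closed_sequentially[OF closed_subspace[OF E] _ s(3)] s(2) by (simp add: regular_normal_cone_def)
    moreover have "z \<bullet> d = 0" if d: "d \<in> diff_span S" for d
    proof -
      have "\<forall>\<^sub>F n in sequentially. zs n \<bullet> d = 0"
        using tendstoD[OF s(1), of "e / 2"] e(1) s(2) by (auto simp: dist_norm elim!: eventually_mono intro: reg[OF _ _ d])
      then have "(\<lambda>n. zs n \<bullet> d) \<longlonglongrightarrow> 0" by (rule tendsto_eventually)
      moreover have "(\<lambda>n. zs n \<bullet> d) \<longlonglongrightarrow> z \<bullet> d" using s(3) by (intro tendsto_intros)
      ultimately show ?thesis using LIMSEQ_unique by blast
    qed
    ultimately show "z \<in> {z \<in> E. \<forall>d\<in>diff_span S. z \<bullet> d = 0}" by simp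
  qed
  show "{z \<in> E. \<forall>d\<in>diff_span S. z \<bullet> d = 0} \<subseteq> limiting_normal_cone E S g"
  proof
    fix z assume z: "z \<in> {z \<in> E. \<forall>d\<in>diff_span S. z \<bullet> d = 0}"
    have "z \<bullet> (y - g) \<le> e * norm (y - g)" if "y \<in> S" "e > 0" for y and e :: real
      using z diff_in_diff_span[OF that(1) gS] that(2) by simp
    then have "z \<in> regular_normal_cone E S g"
      using z gS by (auto simp: regular_normal_cone_def eventually_at intro!: exI[of _ "1::real"])
    then show "z \<in> limiting_normal_cone E S g"
      using gS unfolding limiting_normal_cone_def mem_Collect_eq
      by (intro conjI exI[of _ "\<lambda>_. g"] exI[of _ "\<lambda>_. z"]) auto
  qed
qed

text \<open>Nonemptiness puts \<open>ri_point\<close> into the relative interior, hence into the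
  subdifferential; the span of the differences then does not depend on it.\<close>

lemma V_space_eq:
  assumes "rel_interior (limiting_subdiff E f x) \<noteq> {}"
  shows "V_space E f x = diff_span (limiting_subdiff E f x)"
proof -
  have "ri_point E f x \<in> rel_interior (limiting_subdiff E f x)"
    unfolding ri_point_def using assms by (meson ex_in_conv someI_ex)
  then show ?thesis
    unfolding V_space_def by (intro span_diff_eq_diff_span) (simp add: rel_interior_iff)
qed

lemma U_space_eq:
  assumes "subspace E" "rel_interior (limiting_subdiff E f x) \<noteq> {}"
  shows "U_space E f x = {z \<in> E. \<forall>d\<in>V_space E f x. z \<bullet> d = 0}"
proof -
  have "ri_point E f x \<in> rel_interior (limiting_subdiff E f x)"
    unfolding ri_point_def using assms by (meson ex_in_conv someI_ex)
  then show ?thesis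
    unfolding U_space_def V_space_eq[OF assms(2)] by (rule normal_cone_rel_interior[OF assms(1)])
qed

lemma subspace_V_space: "subspace (V_space E f x)"
  by (simp add: V_space_def)

lemma subspace_U_space:
  assumes "subspace E" "rel_interior (limiting_subdiff E f x) \<noteq> {}"
  shows "subspace (U_space E f x)"
  using assms(1) unfolding U_space_eq[OF assms] by (auto simp: subspace_def inner_add_left)

lemma V_space_subset:
  assumes "subspace E" "rel_interior (limiting_subdiff E f x) \<noteq> {}"
  shows "V_space E f x \<subseteq> E"
  unfolding V_space_eq[OF assms(2)]
  using assms(1) limiting_subdiff_subset[OF assms(1), of f x]
  by (intro diff_span_least) (auto intro: subspace_diff)

text \<open>A direction on one axis is obtained as the difference of two points that share their
  other coordinates; such points exist because all factors are nonempty.\<close>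

lemma diff_span_prod_space:
  fixes S :: "'k::finite \<Rightarrow> 'a::euclidean_space set"
  assumes "\<And>i. S i \<noteq> {}"
  shows "diff_span (prod_space S) = prod_space (\<lambda>i. diff_span (S i))"
proof
  show "diff_span (prod_space S) \<subseteq> prod_space (\<lambda>i. diff_span (S i))"
    by (intro diff_span_least subspace_prod_space subspace_diff_span)
      (auto simp: mem_prod_space intro: diff_in_diff_span)
  have ax: "axis i d \<in> diff_span (prod_space S)" if d: "d \<in> diff_span (S i)" for i d
  proof -
    have sub: "subspace {d. axis i d \<in> diff_span (prod_space S)}"
      using linear_subspace_vimage[OF linear_axis subspace_diff_span] by (simp add: vimage_def)
    define c where "c j = (SOME s. s \<in> S j)" for j
    have c: "c j \<in> S j" for j unfolding c_def using assms[of j] by (meson ex_in_conv someI_ex)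
    have "diff_span (S i) \<subseteq> {d. axis i d \<in> diff_span (prod_space S)}"
    proof (rule diff_span_least[OF sub])
      fix s t assume st: "s \<in> S i" "t \<in> S i"
      have "axis i (s - t) = (\<chi> j. if j = i then s else c j) - (\<chi> j. if j = i then t else c j)"
        by (auto simp: vec_eq_iff axis_component)
      moreover have "\<dots> \<in> diff_span (prod_space S)"
        using st c by (intro diff_in_diff_span) (auto simp: mem_prod_space)
      ultimately show "s - t \<in> {d. axis i d \<in> diff_span (prod_space S)}" by simp
    qed
    with d show ?thesis by blast
  qed
  show "prod_space (\<lambda>i. diff_span (S i)) \<subseteq> diff_span (prod_space S)"
  proof
    fix d assume "d \<in> prod_space (\<lambda>i. diff_span (S i))"
    then have "(\<Sum>i\<in>UNIV. axis i (d $ i)) \<in> diff_span (prod_space S)"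
      by (intro subspace_sum[OF subspace_diff_span] ax) (simp add: mem_prod_space)
    then show "d \<in> diff_span (prod_space S)" by (simp add: sum_axis_component)
  qed
qed

text \<open>A point \<open>g\<close> of the product makes all factors nonempty, so that directions
  decompose; the radius in the product is the smallest of the radii.\<close>

lemma rel_interior_prod_space:
  fixes S :: "'k::finite \<Rightarrow> 'a::euclidean_space set"
  shows "rel_interior (prod_space S) = prod_space (\<lambda>i. rel_interior (S i))"
proof (rule set_eqI)
  fix g
  show "g \<in> rel_interior (prod_space S) \<longleftrightarrow> g \<in> prod_space (\<lambda>i. rel_interior (S i))"
  proof (cases "g \<in> prod_space S")
    case False
    then show ?thesis by (auto simp: rel_interior_iff mem_prod_space)
  next
    case True
    then have ne: "S i \<noteq> {}" for i by (auto simp: mem_prod_space)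
    note D = diff_span_prod_space[of S, OF ne]
    show ?thesis
    proof
      assume "g \<in> rel_interior (prod_space S)"
      then obtain e where e: "e > 0" "\<And>d. d \<in> prod_space (\<lambda>i. diff_span (S i)) \<Longrightarrow> norm d < e \<Longrightarrow> g + d \<in> prod_space S"
        by (auto simp: rel_interior_iff D)
      have "g $ i + d \<in> S i" if "d \<in> diff_span (S i)" "norm d < e" for i d
      proof -
        have "g + axis i d \<in> prod_space S"
          using that by (intro e(2)) (auto simp: axis_in_prod_space subspace_diff_span norm_axis)
        then have "(g + axis i d) $ i \<in> S i" by (simp only: mem_prod_space)
        then show ?thesis by simp
      qed
      with e(1) True show "g \<in> prod_space (\<lambda>i. rel_interior (S i))"
        by (auto simp: mem_prod_space rel_interior_iff)
    next
      assume "g \<in> prod_space (\<lambda>i. rel_interior (S i))"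
      then have "\<forall>i. \<exists>e>0. \<forall>d\<in>diff_span (S i). norm d < e \<longrightarrow> g $ i + d \<in> S i"
        by (simp add: mem_prod_space rel_interior_iff)
      then obtain e where e: "\<And>i. e i > 0" "\<And>i d. d \<in> diff_span (S i) \<Longrightarrow> norm d < e i \<Longrightarrow> g $ i + d \<in> S i"
        by metis
      have "g + d \<in> prod_space S" if d: "d \<in> diff_span (prod_space S)" "norm d < Min (range e)" for d
      proof -
        have "norm (d $ i) < e i" for i
          using d(2) Finite_Cartesian_Product.norm_nth_le[of d i] by (auto intro: le_less_trans)
        then show ?thesis using d(1) e(2) by (auto simp: D mem_prod_space)
      qed
      moreover have "Min (range e) > 0" using e(1) by auto
      ultimately show "g \<in> rel_interior (prod_space S)" using True unfolding rel_interior_iff by blast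
    qed
  qed
qed

subsection \<open>Normal cones of products\<close>

lemma regular_normal_cone_iff:
  "z \<in> regular_normal_cone E S x \<longleftrightarrow> z \<in> E \<and> x \<in> S \<and>
    (\<forall>e>0. \<exists>d>0. \<forall>y\<in>S. norm (y - x) < d \<longrightarrow> z \<bullet> (y - x) \<le> e * norm (y - x))"
proof -
  have "(y \<noteq> x \<and> norm (y - x) < d \<longrightarrow> z \<bullet> (y - x) \<le> e * norm (y - x)) \<longleftrightarrow>
      (norm (y - x) < d \<longrightarrow> z \<bullet> (y - x) \<le> e * norm (y - x))" for y d e
    by auto
  then show ?thesis by (simp only: regular_normal_cone_def mem_Collect_eq eventually_at dist_norm)
qed

lemma regular_normal_cone_prod_space_component:
  fixes E S :: "'k::finite \<Rightarrow> 'a::euclidean_space set"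
  assumes z: "z \<in> regular_normal_cone (prod_space E) (prod_space S) x"
  shows "z $ i \<in> regular_normal_cone (E i) (S i) (x $ i)"
  unfolding regular_normal_cone_iff
proof (intro allI conjI impI)
  fix e :: real assume e: "e > 0"
  obtain d where d: "d > 0" "\<And>y. y \<in> prod_space S \<Longrightarrow> norm (y - x) < d \<Longrightarrow> z \<bullet> (y - x) \<le> e * norm (y - x)"
    using z e unfolding regular_normal_cone_iff by blast
  have "z $ i \<bullet> (y - x $ i) \<le> e * norm (y - x $ i)" if y: "y \<in> S i" "norm (y - x $ i) < d" for y
  proof -
    have "z \<bullet> ((x + axis i (y - x $ i)) - x) \<le> e * norm ((x + axis i (y - x $ i)) - x)"
      using z y by (intro d(2)) (auto simp: regular_normal_cone_iff mem_prod_space axis_component norm_axis)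
    then show ?thesis by (simp add: norm_axis inner_axis)
  qed
  with d(1) show "\<exists>d>0. \<forall>y\<in>S i. norm (y - x $ i) < d \<longrightarrow> z $ i \<bullet> (y - x $ i) \<le> e * norm (y - x $ i)"
    by blast
qed (use z in \<open>auto simp: regular_normal_cone_iff mem_prod_space\<close>)

text \<open>Serves transversality, where a normal of the product is shown to vanish component by
  component.\<close>

lemma limiting_normal_cone_prod_space_component:
  fixes E S :: "'k::finite \<Rightarrow> 'a::euclidean_space set"
  assumes "z \<in> limiting_normal_cone (prod_space E) (prod_space S) x"
  shows "z $ i \<in> limiting_normal_cone (E i) (S i) (x $ i)"
proof -
  obtain xs zs where x: "x \<in> prod_space S" and s: "xs \<longlonglongrightarrow> x"
    "\<forall>n. zs n \<in> regular_normal_cone (prod_space E) (prod_space S) (xs n)" "zs \<longlonglongrightarrow> z"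
    using assms unfolding limiting_normal_cone_def mem_Collect_eq by (elim conjE exE) (rule that)
  have "(\<lambda>n. xs n $ i) \<longlonglongrightarrow> x $ i" "(\<lambda>n. zs n $ i) \<longlonglongrightarrow> z $ i"
    using s(1,3) by (auto intro: tendsto_vec_nth)
  moreover have "\<forall>n. zs n $ i \<in> regular_normal_cone (E i) (S i) (xs n $ i)"
    using s(2) regular_normal_cone_prod_space_component by blast
  moreover have "x $ i \<in> S i" using x by (simp add: mem_prod_space)
  ultimately show ?thesis
    unfolding limiting_normal_cone_def mem_Collect_eq
    by (intro conjI exI[of _ "\<lambda>n. xs n $ i"] exI[of _ "\<lambda>n. zs n $ i"])
qed

text \<open>\<open>transversal\<close> is an equality with \<open>{0}\<close>, so 0 has to be
  exhibited as a normal.\<close>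

lemma zero_in_limiting_normal_cone:
  assumes "subspace E" "x \<in> S"
  shows "0 \<in> limiting_normal_cone E S x"
proof -
  have "0 \<in> regular_normal_cone E S x"
    using assms by (auto simp: regular_normal_cone_def subspace_0)
  then show ?thesis
    using assms(2) unfolding limiting_normal_cone_def mem_Collect_eq
    by (intro conjI exI[of _ "\<lambda>_. x"] exI[of _ "\<lambda>_. 0"]) auto
qed

section \<open>Block-diagonal Jacobians and transversality\<close>

lemma adjoint_prod:
  fixes A :: "'k::finite \<Rightarrow> 'a::euclidean_space \<Rightarrow> 'b::euclidean_space"
  assumes "\<And>i. linear (A i)"
  shows "adjoint (\<lambda>d :: 'a ^ 'k. \<chi> i. A i (d $ i)) z = (\<chi> i. adjoint (A i) (z $ i))"
proof -
  have "adjoint (\<lambda>d :: 'a ^ 'k. \<chi> i. A i (d $ i)) = (\<lambda>z. \<chi> i. adjoint (A i) (z $ i))"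
    by (rule adjoint_unique) (simp add: inner_vec_def adjoint_works[OF assms])
  then show ?thesis by simp
qed

lemma jacobian_prod:
  fixes F :: "'k::finite \<Rightarrow> 'a::euclidean_space \<Rightarrow> 'b::euclidean_space"
  assumes X: "\<And>i. subspace (X i)" and x: "x \<in> prod_space X"
    and D: "\<And>i. (F i has_derivative D i) (at (x $ i) within X i)"
  shows "jacobian (prod_space X) (\<lambda>y. \<chi> i. F i (y $ i)) x = (\<lambda>d. \<chi> i. jacobian (X i) (F i) (x $ i) (d $ i))"
proof (rule jacobian_eqI[OF subspace_prod_space[OF X] x])
  have xi: "x $ i \<in> X i" for i using x by (simp add: mem_prod_space)
  note J = jacobian_works[OF X xi D]
  show "((\<lambda>y. \<chi> i. F i (y $ i)) has_derivative (\<lambda>d. \<chi> i. jacobian (X i) (F i) (x $ i) (d $ i)))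
      (at x within prod_space X)"
    by (rule has_derivative_prod) (rule J(1))
  fix d assume d: "d \<in> orthogonal_comp (prod_space X)"
  \<comment> \<open>Testing with vectors on a single axis yields orthogonality in each
    component.\<close>
  have "d $ i \<in> orthogonal_comp (X i)" for i
  proof -
    have "axis i y \<bullet> d = 0" if "y \<in> X i" for y
      using d that axis_in_prod_space[of X, OF X] by (auto simp: orthogonal_comp_def orthogonal_def)
    then show ?thesis by (auto simp: orthogonal_comp_def orthogonal_def inner_axis')
  qed
  then have "jacobian (X i) (F i) (x $ i) (d $ i) = 0" for i by (rule J(2))
  then show "(\<chi> i. jacobian (X i) (F i) (x $ i) (d $ i)) = 0" by (simp add: vec_eq_iff)
qed

lemma transversal_prod:
  fixes X :: "'k::finite \<Rightarrow> 'a::euclidean_space set" and Y :: "'k \<Rightarrow> 'b::euclidean_space set"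
  assumes X: "\<And>i. subspace (X i)" and Y: "\<And>i. subspace (Y i)" and x: "x \<in> prod_space X"
    and D: "\<And>i. (\<Phi> i has_derivative D i) (at (x $ i) within X i)"
    and tr: "\<And>i. transversal (X i) (Y i) (\<Phi> i) (M i) (x $ i)"
  shows "transversal (prod_space X) (prod_space Y) (\<lambda>x. \<chi> i. \<Phi> i (x $ i)) (prod_space M) x"
proof -
  let ?P = "\<lambda>x. \<chi> i. \<Phi> i (x $ i)"
  have PM: "?P x \<in> prod_space M" using tr by (simp add: transversal_def mem_prod_space)
  have xi: "x $ i \<in> X i" for i using x by (simp add: mem_prod_space)
  have lin: "linear (jacobian (X i) (\<Phi> i) (x $ i))" for i
    using jacobian_works(1)[OF X xi D] has_derivative_bounded_linear bounded_linear.linear by blast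
  have adj: "adjoint (jacobian (prod_space X) ?P x) z = (\<chi> i. adjoint (jacobian (X i) (\<Phi> i) (x $ i)) (z $ i))" for z
    unfolding jacobian_prod[OF X x D] by (rule adjoint_prod[OF lin])
  have "z = 0" if z: "z \<in> limiting_normal_cone (prod_space Y) (prod_space M) (?P x)"
      "adjoint (jacobian (prod_space X) ?P x) z = 0" for z
  proof -
    have "z $ i = 0" for i
    proof -
      have "z $ i \<in> limiting_normal_cone (Y i) (M i) (\<Phi> i (x $ i))"
        using limiting_normal_cone_prod_space_component[OF z(1), of i] by simp
      moreover have "adjoint (jacobian (X i) (\<Phi> i) (x $ i)) (z $ i) = 0"
        using z(2) unfolding adj by (simp add: vec_eq_iff)
      ultimately show ?thesis using tr[of i] unfolding transversal_def by blast
    qed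
    then show ?thesis by (simp add: vec_eq_iff)
  qed
  moreover have "0 \<in> limiting_normal_cone (prod_space Y) (prod_space M) (?P x)"
    by (rule zero_in_limiting_normal_cone[OF subspace_prod_space[OF Y] PM])
  moreover have "adjoint (jacobian (prod_space X) ?P x) 0 = 0"
  proof -
    have "adjoint (jacobian (X i) (\<Phi> i) (x $ i)) 0 = 0" for i
      by (rule linear_0[OF adjoint_linear[OF lin]])
    then show ?thesis unfolding adj by (simp add: vec_eq_iff)
  qed
  ultimately show ?thesis using PM unfolding transversal_def by blast
qed

subsection \<open>U-Lagrangians of separable sums\<close>

lemma prod_space_nonempty: "prod_space S \<noteq> {} \<longleftrightarrow> (\<forall>i. S i \<noteq> {})"
proof
  assume "\<forall>i. S i \<noteq> {}"
  then have "(\<chi> i. SOME s. s \<in> S i) \<in> prod_space S"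
    by (auto simp: mem_prod_space some_in_eq)
  then show "prod_space S \<noteq> {}" by blast
next
  assume "prod_space S \<noteq> {}"
  then obtain x where "x \<in> prod_space S" by blast
  then have "x $ i \<in> S i" for i by (simp add: mem_prod_space)
  then show "\<forall>i. S i \<noteq> {}" by blast
qed

section \<open>The spaces U and V and the Lagrangian of a sum\<close>

context separable_sum
begin

abbreviation "subdiff_comp x i \<equiv> limiting_subdiff (X i) (f i) (x $ i)"
abbreviation "U_comp x i \<equiv> U_space (X i) (f i) (x $ i)"
abbreviation "V_comp x i \<equiv> V_space (X i) (f i) (x $ i)"
abbreviation "L_comp x g i \<equiv> U_Lagrangian (X i) (f i) (x $ i) (g $ i)"
abbreviation "argmin_comp x g i \<equiv> U_argmin (X i) (f i) (x $ i) (g $ i)"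

abbreviation "subdiff_total \<equiv> limiting_subdiff (prod_space X) total"
abbreviation "U_total \<equiv> U_space (prod_space X) total"
abbreviation "V_total \<equiv> V_space (prod_space X) total"
abbreviation "L_total \<equiv> U_Lagrangian (prod_space X) total"
abbreviation "argmin_total \<equiv> U_argmin (prod_space X) total"

lemma rel_interior_subdiff_total:
  "rel_interior (subdiff_total x) =
    prod_space (\<lambda>i. rel_interior (subdiff_comp x i))"
  by (simp only: limiting_subdiff_total rel_interior_prod_space)

context
  fixes x
  assumes ne: "\<And>i. rel_interior (subdiff_comp x i) \<noteq> {}"
begin

lemma ne_total: "rel_interior (subdiff_total x) \<noteq> {}"
  using ne by (simp add: rel_interior_subdiff_total prod_space_nonempty)

lemma V_space_total: "V_total x = prod_space (\<lambda>i. V_comp x i)"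
proof -
  have "subdiff_comp x i \<noteq> {}" for i
    using ne[of i] rel_interior_subset[of "subdiff_comp x i"] by blast
  then show ?thesis
    unfolding V_space_eq[OF ne] V_space_eq[OF ne_total] limiting_subdiff_total
    by (rule diff_span_prod_space)
qed

text \<open>\<open>U\<close> is the orthogonal complement of \<open>V\<close> within the space, and
  orthogonality to a product of subspaces can be tested on the axes.\<close>

lemma U_space_total: "U_total x = prod_space (\<lambda>i. U_comp x i)"
proof -
  have "(\<forall>d\<in>prod_space (\<lambda>i. V_comp x i). z \<bullet> d = 0) \<longleftrightarrow>
      (\<forall>i. \<forall>d\<in>V_comp x i. z $ i \<bullet> d = 0)" for z :: "'a ^ 'k"
  proof (intro iffI allI ballI)
    fix i d assume z: "\<forall>d\<in>prod_space (\<lambda>i. V_comp x i). z \<bullet> d = 0"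
      and d: "d \<in> V_comp x i"
    have "axis i d \<in> prod_space (\<lambda>i. V_comp x i)"
      using d by (simp add: axis_in_prod_space subspace_V_space)
    with z have "z \<bullet> axis i d = 0" by blast
    then show "z $ i \<bullet> d = 0" by (simp add: inner_axis)
  next
    fix d assume z: "\<forall>i. \<forall>d\<in>V_comp x i. z $ i \<bullet> d = 0"
      and d: "d \<in> prod_space (\<lambda>i. V_comp x i)"
    have "z $ i \<bullet> d $ i = 0" for i using z d by (auto simp: mem_prod_space)
    then show "z \<bullet> d = 0" by (simp add: inner_vec_def)
  qed
  then show ?thesis
    unfolding U_space_eq[OF subspace_X ne_total] U_space_eq[OF X ne] V_space_total
    by (auto simp: mem_prod_space)
qed

lemma subspace_U: "subspace (U_comp x i)"
  by (rule subspace_U_space[OF X ne])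

lemma subspace_U_total: "subspace (U_total x)"
  by (rule subspace_U_space[OF subspace_X ne_total])

context
  assumes x: "x \<in> prod_space X"
begin

lemma shift_in_X:
  assumes "u \<in> prod_space X" "v \<in> V_comp x i"
  shows "x $ i + u $ i + v \<in> X i"
  using assms x V_space_subset[OF X ne] X by (auto simp: mem_prod_space intro!: subspace_add)

text \<open>The objective of the Lagrangian separates over the components; as \<open>V\<close> is a
  product, so does the minimization.\<close>

lemma total_shift:
  "total (x + u + v) - ereal (g \<bullet> v) = (\<Sum>i\<in>UNIV. f i (x $ i + u $ i + v $ i) - ereal (g $ i \<bullet> v $ i))"
proof -
  have "total (x + u + v) - ereal (g \<bullet> v) = total (x + u + v) + ereal (\<Sum>i\<in>UNIV. - (g $ i \<bullet> v $ i))"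
    by (simp add: inner_vec_def minus_ereal_def sum_negf)
  also have "\<dots> = (\<Sum>i\<in>UNIV. f i (x $ i + u $ i + v $ i) + ereal (- (g $ i \<bullet> v $ i)))"
    by (simp only: total_def sum.distrib sum_ereal vector_add_component)
  finally show ?thesis by (simp add: minus_ereal_def)
qed

lemma U_argmin_total_intro:
  assumes w: "\<And>i. w $ i \<in> argmin_comp x g i (u $ i)"
  shows "w \<in> argmin_total x g u"
    and "L_total x g u = (\<Sum>i\<in>UNIV. L_comp x g i (u $ i))"
proof -
  have wV: "w \<in> V_total x"
    using w by (simp add: V_space_total mem_prod_space U_argmin_def)
  have val: "total (x + u + w) - ereal (g \<bullet> w) = (\<Sum>i\<in>UNIV. L_comp x g i (u $ i))"
    unfolding total_shift using w by (intro sum.cong refl) (simp add: U_argmin_def)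
  show eq: "L_total x g u = (\<Sum>i\<in>UNIV. L_comp x g i (u $ i))"
  proof (rule antisym)
    show "L_total x g u \<le> (\<Sum>i\<in>UNIV. L_comp x g i (u $ i))"
      unfolding val[symmetric] unfolding U_Lagrangian_def by (rule INF_lower[OF wV])
    show "(\<Sum>i\<in>UNIV. L_comp x g i (u $ i)) \<le> L_total x g u"
      unfolding U_Lagrangian_def[of "prod_space X"]
    proof (rule INF_greatest)
      fix v assume v: "v \<in> V_total x"
      show "(\<Sum>i\<in>UNIV. L_comp x g i (u $ i)) \<le> total (x + u + v) - ereal (g \<bullet> v)"
        unfolding total_shift U_Lagrangian_def
        using v by (intro sum_mono INF_lower) (simp add: V_space_total mem_prod_space)
    qed
  qed
  show "w \<in> argmin_total x g u"
    using wV val eq by (simp add: U_argmin_def)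
qed

text \<open>Exchange argument: replacing one component of a minimizer leaves the other terms
  unchanged, and finiteness of the Lagrangian allows them to be cancelled.\<close>

lemma U_argmin_total_dest:
  assumes u: "u \<in> prod_space X" and w: "w \<in> argmin_total x g u"
    and fin: "\<bar>L_total x g u\<bar> \<noteq> \<infinity>"
  shows "w $ i \<in> argmin_comp x g i (u $ i)"
    and "\<bar>L_comp x g i (u $ i)\<bar> \<noteq> \<infinity>"
proof -
  define \<psi> where "\<psi> i v = f i (x $ i + u $ i + v) - ereal (g $ i \<bullet> v)" for i v
  have wV: "w $ i \<in> V_comp x i" for i
    using w by (simp add: V_space_total mem_prod_space U_argmin_def)
  have notM: "\<psi> i v \<noteq> -\<infinity>" if "v \<in> V_comp x i" for i v
    using f(2)[OF shift_in_X[OF u that]] unfolding \<psi>_def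
    by (cases "f i (x $ i + u $ i + v)") auto
  have L: "L_total x g u = (\<Sum>i\<in>UNIV. \<psi> i (w $ i))"
    using w by (simp add: U_argmin_def total_shift \<psi>_def)
  \<comment> \<open>A single infinite term would make the sum, and so the Lagrangian,
    infinite.\<close>
  have "\<psi> i (w $ i) \<noteq> \<infinity>" for i
  proof
    assume "\<psi> i (w $ i) = \<infinity>"
    then have "(\<Sum>i\<in>UNIV. \<psi> i (w $ i)) = \<infinity>" unfolding sum_Pinfty by (metis UNIV_I finite)
    with fin show False unfolding L by simp
  qed
  then have wfin: "\<bar>\<psi> i (w $ i)\<bar> \<noteq> \<infinity>" for i using notM[OF wV] by (simp add: abs_infty_iff)
  have min: "\<psi> i (w $ i) \<le> \<psi> i v" if v: "v \<in> V_comp x i" for v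
  proof -
    define z where "z = (\<chi> j. if j = i then v else w $ j)"
    have "z \<in> V_total x"
      using v wV by (simp add: V_space_total mem_prod_space z_def)
    then have "L_total x g u \<le> total (x + u + z) - ereal (g \<bullet> z)"
      unfolding U_Lagrangian_def by (rule INF_lower)
    then have "(\<Sum>j\<in>UNIV. \<psi> j (w $ j)) \<le> (\<Sum>j\<in>UNIV. \<psi> j (z $ j))"
      unfolding L total_shift \<psi>_def .
    moreover have "(\<Sum>j\<in>UNIV. \<psi> j (w $ j)) = \<psi> i (w $ i) + (\<Sum>j\<in>UNIV-{i}. \<psi> j (w $ j))"
      by (rule sum.remove) auto
    moreover have "(\<Sum>j\<in>UNIV. \<psi> j (z $ j)) = \<psi> i v + (\<Sum>j\<in>UNIV-{i}. \<psi> j (w $ j))"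
      by (subst sum.remove[of _ i]) (auto simp: z_def)
    moreover obtain R where "(\<Sum>j\<in>UNIV-{i}. \<psi> j (w $ j)) = ereal R"
    proof
      show "(\<Sum>j\<in>UNIV-{i}. \<psi> j (w $ j)) = ereal (\<Sum>j\<in>UNIV-{i}. real_of_ereal (\<psi> j (w $ j)))"
        unfolding sum_ereal[symmetric] using wfin by (simp add: ereal_real')
    qed
    ultimately have "\<psi> i (w $ i) + ereal R \<le> \<psi> i v + ereal R" by simp
    then show ?thesis by (cases "\<psi> i (w $ i)"; cases "\<psi> i v") simp_all
  qed
  have Li: "L_comp x g i (u $ i) = \<psi> i (w $ i)"
  proof -
    have "L_comp x g i (u $ i) = (INF v\<in>V_comp x i. \<psi> i v)"
      by (simp add: U_Lagrangian_def \<psi>_def)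
    also have "\<dots> = \<psi> i (w $ i)"
    proof (rule antisym)
      show "(INF v\<in>V_comp x i. \<psi> i v) \<le> \<psi> i (w $ i)" by (rule INF_lower[OF wV])
      show "\<psi> i (w $ i) \<le> (INF v\<in>V_comp x i. \<psi> i v)" by (rule INF_greatest) (rule min)
    qed
    finally show ?thesis .
  qed
  then show "w $ i \<in> argmin_comp x g i (u $ i)"
    using wV by (simp add: U_argmin_def \<psi>_def)
  show "\<bar>L_comp x g i (u $ i)\<bar> \<noteq> \<infinity>"
    unfolding Li by (rule wfin)
qed

lemma U_Lagrangian_total_real:
  assumes "\<And>i. argmin_comp x g i (u $ i) \<noteq> {}"
    and fin: "\<And>i. \<bar>L_comp x g i (u $ i)\<bar> \<noteq> \<infinity>"
  shows "argmin_total x g u \<noteq> {}"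
    and "L_total x g u =
      ereal (\<Sum>i\<in>UNIV. real_of_ereal (L_comp x g i (u $ i)))"
proof -
  define w where "w = (\<chi> i. SOME v. v \<in> argmin_comp x g i (u $ i))"
  have "w $ i \<in> argmin_comp x g i (u $ i)" for i
    using assms(1)[of i] by (simp add: w_def some_in_eq)
  note w = U_argmin_total_intro[of w g u, OF this]
  show "argmin_total x g u \<noteq> {}" using w(1) by blast
  show "L_total x g u =
      ereal (\<Sum>i\<in>UNIV. real_of_ereal (L_comp x g i (u $ i)))"
    unfolding w(2) sum_ereal[symmetric] using fin by (simp add: ereal_real')
qed

lemma U_space_subset_X: "u \<in> U_total x \<Longrightarrow> u \<in> prod_space X"
  by (simp add: U_space_eq[OF subspace_X ne_total])

text \<open>Along axis \<open>i\<close>, near 0, the total Lagrangian differs from that of summand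
  \<open>i\<close> only by a constant, the sum of the other Lagrangians at 0.\<close>

lemma U_gradient_defined_components:
  assumes "U_gradient_defined (prod_space X) total x g"
  shows "U_gradient_defined (X i) (f i) (x $ i) (g $ i)"
proof -
  let ?l = "\<lambda>u. real_of_ereal (L_total x g u)"
  let ?li = "\<lambda>i u. real_of_ereal (L_comp x g i u)"
  let ?U = "\<lambda>i. U_comp x i"
  obtain e where e: "e > 0" "\<And>u. u \<in> U_total x \<Longrightarrow> norm u < e \<Longrightarrow>
      argmin_total x g u \<noteq> {} \<and> \<bar>L_total x g u\<bar> \<noteq> \<infinity>"
    using assms unfolding U_gradient_defined_def by (auto simp: dist_norm)
  obtain D where D: "(?l has_derivative D) (at 0 within U_total x)"
    using assms unfolding U_gradient_defined_def differentiable_def by blast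
  have fin: "argmin_comp x g j (u $ j) \<noteq> {}"
      "\<bar>L_comp x g j (u $ j)\<bar> \<noteq> \<infinity>"
    if u: "u \<in> U_total x" "norm u < e" for u j
  proof -
    obtain w where w: "w \<in> argmin_total x g u" using e(2)[OF u] by blast
    have L: "\<bar>L_total x g u\<bar> \<noteq> \<infinity>" using e(2)[OF u] by simp
    show "argmin_comp x g j (u $ j) \<noteq> {}"
      using U_argmin_total_dest(1)[OF U_space_subset_X[OF u(1)] w L] by blast
    show "\<bar>L_comp x g j (u $ j)\<bar> \<noteq> \<infinity>"
      by (rule U_argmin_total_dest(2)[OF U_space_subset_X[OF u(1)] w L])
  qed
  have ax: "axis i u \<in> U_total x" if "u \<in> ?U i" for u
    using that by (simp add: U_space_total axis_in_prod_space subspace_U)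
  have "argmin_comp x g i u \<noteq> {} \<and> \<bar>L_comp x g i u\<bar> \<noteq> \<infinity>"
    if "u \<in> ?U i \<inter> ball 0 e" for u
    using fin[OF ax, of u i] that by (simp add: norm_axis)
  moreover have "g $ i \<in> rel_interior (subdiff_comp x i)"
    using assms unfolding U_gradient_defined_def by (simp add: rel_interior_subdiff_total mem_prod_space)
  moreover have "?li i differentiable (at 0 within ?U i)"
  proof -
    define c where "c = (\<Sum>j\<in>UNIV-{i}. ?li j 0)"
    have "((\<lambda>u. ?l (axis i u)) has_derivative (\<lambda>d. D (axis i d))) (at 0 within ?U i)"
    proof (rule has_derivative_in_compose[OF bounded_linear_imp_has_derivative[OF bounded_linear_axis]])
      show "(?l has_derivative D) (at (axis i 0) within axis i ` ?U i)"
        using has_derivative_subset[OF D image_subsetI[of "?U i" "axis i", OF ax]]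
        by (simp add: linear_0[OF linear_axis])
    qed
    then have "((\<lambda>u. ?l (axis i u) - c) has_derivative (\<lambda>d. D (axis i d))) (at 0 within ?U i)"
      using has_derivative_diff[OF _ has_derivative_const[of c]] by simp
    moreover have "?l (axis i u) - c = ?li i u" if u: "u \<in> ?U i" "norm u < e" for u
    proof -
      have "?l (axis i u) = (\<Sum>j\<in>UNIV. ?li j (axis i u $ j))"
        using U_Lagrangian_total_real(2)[of g "axis i u"] fin[OF ax[OF u(1)]] u(2) by (simp add: norm_axis)
      also have "\<dots> = ?li i u + c"
        unfolding c_def by (subst sum.remove[of _ i]) (auto simp: axis_component)
      finally show ?thesis by simp
    qed
    ultimately have "(?li i has_derivative (\<lambda>d. D (axis i d))) (at 0 within ?U i)"
      by (rule has_derivative_transform_within[where d = e, OF _ e(1) subspace_0[OF subspace_U]])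
        (simp_all add: dist_norm)
    then show ?thesis by (rule differentiableI)
  qed
  ultimately show ?thesis
    using e(1) unfolding U_gradient_defined_def by (intro conjI exI[of _ e]) simp_all
qed

section \<open>U-gradients from the Lagrangians of the summands\<close>

context
  fixes g
  assumes def: "\<And>i. U_gradient_defined (X i) (f i) (x $ i) (g $ i)"
begin

lemma U_Lagrangian_near_0:
  "\<exists>e>0. \<forall>u\<in>U_total x \<inter> ball 0 e. argmin_total x g u \<noteq> {} \<and>
    L_total x g u =
      ereal (\<Sum>i\<in>UNIV. real_of_ereal (L_comp x g i (u $ i)))"
proof -
  have "\<forall>i. \<exists>e>0. \<forall>u \<in> U_comp x i \<inter> ball 0 e.
        argmin_comp x g i u \<noteq> {} \<and> \<bar>L_comp x g i u\<bar> \<noteq> \<infinity>"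
    using def unfolding U_gradient_defined_def by blast
  then obtain e where e': "\<And>i. e i > 0 \<and> (\<forall>u \<in> U_comp x i \<inter> ball 0 (e i).
        argmin_comp x g i u \<noteq> {} \<and> \<bar>L_comp x g i u\<bar> \<noteq> \<infinity>)"
    by metis
  have e: "\<And>i. e i > 0" "\<And>i u. u \<in> U_comp x i \<Longrightarrow> norm u < e i \<Longrightarrow>
        argmin_comp x g i u \<noteq> {} \<and> \<bar>L_comp x g i u\<bar> \<noteq> \<infinity>"
    using e' by (simp_all add: dist_norm)
  define r where "r = Min (range e)"
  have r: "r > 0" "\<And>i. r \<le> e i" using e(1) by (auto simp: r_def)
  have *: "argmin_comp x g i (u $ i) \<noteq> {} \<and>
      \<bar>L_comp x g i (u $ i)\<bar> \<noteq> \<infinity>"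
    if u: "u \<in> U_total x" "norm u < r" for u i
  proof (rule e(2))
    show "u $ i \<in> U_comp x i" using u(1) by (simp add: U_space_total mem_prod_space)
    show "norm (u $ i) < e i"
      using Finite_Cartesian_Product.norm_nth_le[of u i] u(2) r(2)[of i] by linarith
  qed
  have "argmin_total x g u \<noteq> {} \<and> L_total x g u =
      ereal (\<Sum>i\<in>UNIV. real_of_ereal (L_comp x g i (u $ i)))"
    if u: "u \<in> U_total x \<inter> ball 0 r" for u
  proof -
    have "argmin_comp x g i (u $ i) \<noteq> {}"
      "\<bar>L_comp x g i (u $ i)\<bar> \<noteq> \<infinity>" for i
      using *[of u i] u by (simp_all add: dist_norm)
    from U_Lagrangian_total_real[of g u, OF this] show ?thesis by (rule conjI)
  qed
  with r(1) show ?thesis by (intro exI[of _ r]) blast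
qed

lemma U_Lagrangian_total_derivative:
  assumes D: "\<And>i. ((\<lambda>u. real_of_ereal (L_comp x g i u)) has_derivative D i)
      (at 0 within U_comp x i)"
  shows "((\<lambda>u. real_of_ereal (L_total x g u)) has_derivative (\<lambda>d. \<Sum>i\<in>UNIV. D i (d $ i)))
      (at 0 within U_total x)"
proof -
  obtain e where e: "e > 0"
    "\<forall>u\<in>U_total x \<inter> ball 0 e. argmin_total x g u \<noteq> {} \<and>
      L_total x g u =
      ereal (\<Sum>i\<in>UNIV. real_of_ereal (L_comp x g i (u $ i)))"
    using U_Lagrangian_near_0 by (elim exE conjE) (rule that)
  have "((\<lambda>u. \<Sum>i\<in>UNIV. real_of_ereal (L_comp x g i (u $ i)))
      has_derivative (\<lambda>d. \<Sum>i\<in>UNIV. D i (d $ i))) (at 0 within U_total x)"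
    unfolding U_space_total
  proof (rule has_derivative_sum)
    fix i
    show "((\<lambda>u. real_of_ereal (L_comp x g i (u $ i)))
      has_derivative (\<lambda>d. D i (d $ i))) (at 0 within prod_space (\<lambda>i. U_comp x i))"
      by (rule has_derivative_component[where F = "\<lambda>u. real_of_ereal (L_comp x g i u)"
            and i = i and D = "D i"])
        (use D[of i] in simp)
  qed
  then show ?thesis
    by (rule has_derivative_transform_within[where d = e, OF _ e(1) subspace_0[OF subspace_U_total]])
      (simp add: e(2) dist_norm)
qed

lemma U_gradient_defined_total: "U_gradient_defined (prod_space X) total x g"
  unfolding U_gradient_defined_def
proof (intro conjI)
  show "g \<in> rel_interior (subdiff_total x)"
    using def unfolding U_gradient_defined_def by (simp add: rel_interior_subdiff_total mem_prod_space)
  obtain e where e: "e > 0"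
    "\<forall>u\<in>U_total x \<inter> ball 0 e. argmin_total x g u \<noteq> {} \<and>
      L_total x g u =
      ereal (\<Sum>i\<in>UNIV. real_of_ereal (L_comp x g i (u $ i)))"
    using U_Lagrangian_near_0 by (elim exE conjE) (rule that)
  then show "\<exists>e>0. \<forall>u\<in>U_total x \<inter> ball 0 e.
      argmin_total x g u \<noteq> {} \<and> \<bar>L_total x g u\<bar> \<noteq> \<infinity>"
    by (intro exI[of _ e]) simp
  have "\<forall>i. \<exists>D. ((\<lambda>u. real_of_ereal (L_comp x g i u)) has_derivative D)
      (at 0 within U_comp x i)"
    using def unfolding U_gradient_defined_def differentiable_def by blast
  then obtain D where "\<And>i. ((\<lambda>u. real_of_ereal (L_comp x g i u)) has_derivative D i)
      (at 0 within U_comp x i)" by metis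
  from U_Lagrangian_total_derivative[OF this]
  show "(\<lambda>u. real_of_ereal (L_total x g u)) differentiable
      (at 0 within U_total x)" by (rule differentiableI)
qed

text \<open>The columns of a block lie on one axis, and along an axis only one summand of the
  derivative survives.\<close>

lemma U_gradient_total:
  assumes C: "\<And>i. finite (C i)" and B: "\<And>i j. j \<in> C i \<Longrightarrow> B i j \<in> U_comp x i"
  shows "U_gradient (prod_space X) total x (SIGMA i:UNIV. C i) (block_diag B) g =
    (\<chi> i. U_gradient (X i) (f i) (x $ i) (C i) (B i) (g $ i))"
proof -
  let ?J = "\<lambda>i. jacobian (U_comp x i) (\<lambda>u. real_of_ereal (L_comp x g i u)) 0"
  let ?JT = "jacobian (U_total x) (\<lambda>u. real_of_ereal (L_total x g u)) 0"
  have D: "((\<lambda>u. real_of_ereal (L_comp x g i u)) has_derivative ?J i)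
      (at 0 within U_comp x i)" for i
    using def[of i] jacobian_works(1)[OF subspace_U subspace_0[OF subspace_U]]
    unfolding U_gradient_defined_def differentiable_def by blast
  note DT = U_Lagrangian_total_derivative[OF D]
  have JT: "?JT (axis i b) = ?J i b" if b: "b \<in> U_comp x i" for i b
  proof -
    have "axis i b \<in> U_total x"
      using b by (simp add: U_space_total axis_in_prod_space subspace_U)
    then have "?JT (axis i b) = (\<Sum>j\<in>UNIV. ?J j (axis i b $ j))"
      by (rule jacobian_works(3)[OF subspace_U_total subspace_0[OF subspace_U_total] DT])
    also have "\<dots> = (\<Sum>j\<in>UNIV. if j = i then ?J i b else 0)"
      using linear_0[OF bounded_linear.linear[OF has_derivative_bounded_linear[OF D]]]
      by (intro sum.cong refl) (simp add: axis_component)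
    finally show ?thesis by simp
  qed
  have "U_gradient (prod_space X) total x (SIGMA i:UNIV. C i) (block_diag B) g =
      (\<Sum>(i, j)\<in>(SIGMA i:UNIV. C i). ?J i (B i j) *\<^sub>R axis i (B i j))"
    unfolding U_gradient_def block_diag_def using B by (intro sum.cong refl) (auto simp: JT)
  also have "\<dots> = (\<Sum>i\<in>UNIV. \<Sum>j\<in>C i. ?J i (B i j) *\<^sub>R axis i (B i j))"
    using C by (intro sum.Sigma[symmetric]) auto
  also have "\<dots> = (\<Sum>i\<in>UNIV. axis i (\<Sum>j\<in>C i. ?J i (B i j) *\<^sub>R B i j))"
    by (simp add: linear_sum[OF linear_axis] linear_scale[OF linear_axis])
  finally show ?thesis by (simp add: sum_axis U_gradient_def)
qed

end
end
end

lemma U_basis_total: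
  assumes B: "\<And>i. U_basis (X i) (f i) (x $ i) (C i) (B i)"
  shows "U_basis (prod_space X) total x (SIGMA i:UNIV. C i) (block_diag B)"
proof -
  have ne: "\<And>i. rel_interior (subdiff_comp x i) \<noteq> {}"
    using B by (simp add: U_basis_def)
  have sp: "span (B i ` C i) = U_comp x i" for i using B by (simp add: U_basis_def)
  have "span (block_diag B ` (SIGMA i:UNIV. C i)) = prod_space (\<lambda>i. U_comp x i)"
  proof
    have "axis i (B i j) \<in> prod_space (\<lambda>i. U_comp x i)" if "j \<in> C i" for i j
      using that by (auto simp: axis_in_prod_space subspace_U[OF ne] sp[symmetric] intro: span_base)
    then show "span (block_diag B ` (SIGMA i:UNIV. C i)) \<subseteq> prod_space (\<lambda>i. U_comp x i)"
      by (intro span_minimal subspace_prod_space subspace_U[OF ne]) (auto simp: block_diag_def)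
    show "prod_space (\<lambda>i. U_comp x i) \<subseteq> span (block_diag B ` (SIGMA i:UNIV. C i))"
    proof
      fix u assume u: "u \<in> prod_space (\<lambda>i. U_comp x i)"
      have "axis i (u $ i) \<in> span (block_diag B ` (SIGMA i:UNIV. C i))" for i
      proof -
        have "axis i (u $ i) \<in> axis i ` span (B i ` C i)" using u by (simp add: mem_prod_space sp)
        also have "\<dots> = span (axis i ` B i ` C i)" by (rule linear_span_image[OF linear_axis, symmetric])
        also have "\<dots> \<subseteq> span (block_diag B ` (SIGMA i:UNIV. C i))"
          by (intro span_mono) (force simp: block_diag_def)
        finally show ?thesis .
      qed
      then have "(\<Sum>i\<in>UNIV. axis i (u $ i)) \<in> span (block_diag B ` (SIGMA i:UNIV. C i))" by (intro span_sum)
      then show "u \<in> span (block_diag B ` (SIGMA i:UNIV. C i))" by (simp add: sum_axis_component)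
    qed
  qed
  moreover have "(block_diag B p \<bullet> block_diag B q) = (if p = q then 1 else 0)"
    if "p \<in> (SIGMA i:UNIV. C i)" "q \<in> (SIGMA i:UNIV. C i)" for p q
  proof -
    obtain i a j b where ab: "p = (i, a)" "q = (j, b)" "a \<in> C i" "b \<in> C j" using \<open>p \<in> _\<close> \<open>q \<in> _\<close> by auto
    have "B i a \<bullet> B i b = (if a = b then 1 else 0)" if "i = j"
      using B[of i] ab(3,4) that unfolding U_basis_def by blast
    then show ?thesis by (cases "i = j") (auto simp: ab(1,2) block_diag_def inner_axis_axis)
  qed
  moreover have "finite (SIGMA i:UNIV. C i)" using B by (auto simp: U_basis_def)
  ultimately show ?thesis
    unfolding U_basis_def U_space_total[OF ne] using ne_total[OF ne] by blast
qed

end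

subsection \<open>A normal form of primal-dual gradient structure\<close>

text \<open>Coefficient sets are closed in the product topology; this turns limits of coefficient
  vectors into limits of their entries.\<close>

lemma tendsto_fun_iff:
  fixes f :: "'c \<Rightarrow> 'a \<Rightarrow> 'b::topological_space"
  shows "(f \<longlongrightarrow> l) F \<longleftrightarrow> (\<forall>k. ((\<lambda>n. f n k) \<longlongrightarrow> l k) F)"
proof -
  have "(f \<longlongrightarrow> l) F \<longleftrightarrow> limitin (product_topology (\<lambda>_. euclidean) UNIV) f l F"
    by (simp only: euclidean_product_topology limitin_canonical_iff)
  then show ?thesis by (simp add: limitin_componentwise extensional_def)
qed

text \<open>
  One function \<open>q\<close> represents \<open>f\<close> on all of \<open>M\<close>, and \<open>0 \<in> \<Gamma>\<close> makes its gradient a subgradient there.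
  Activity of the functions \<open>\<phi> k\<close> is a condition on each of them separately; in a separable sum it
  therefore cannot arise accidentally, by cancellation between different summands.
\<close>
definition normal_form ::
    "'a::euclidean_space set \<Rightarrow> ('a \<Rightarrow> ereal) \<Rightarrow> 'a \<Rightarrow> 'a set \<Rightarrow> real \<Rightarrow> 'c set \<Rightarrow> ('a \<Rightarrow> real) \<Rightarrow>
      ('c \<Rightarrow> 'a \<Rightarrow> real) \<Rightarrow> ('c \<Rightarrow> real) set \<Rightarrow> bool" where
  "normal_form E f x M \<delta> K q \<phi> \<Gamma> \<longleftrightarrow>
     \<delta> > 0 \<and> finite K \<and> x \<in> M \<and> M \<subseteq> E \<and>
     C2_on (E \<inter> ball x \<delta>) q \<and> (\<forall>k\<in>K. C2_on (E \<inter> ball x \<delta>) (\<phi> k) \<and> \<phi> k x = 0) \<and>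
     closed \<Gamma> \<and> (\<forall>z\<in>\<Gamma>. \<forall>w\<in>\<Gamma>. \<forall>t\<in>{0..1}. (\<lambda>k. (1 - t) * z k + t * w k) \<in> \<Gamma>) \<and>
     (\<lambda>k. 0) \<in> \<Gamma> \<and> (\<forall>z\<in>\<Gamma>. \<forall>k. k \<notin> K \<longrightarrow> z k = 0) \<and>
     (\<forall>p\<in>M \<inter> ball x \<delta>. f p = ereal (q p) \<and>
        (\<forall>g. g \<in> limiting_subdiff E f p \<longleftrightarrow> (\<exists>z\<in>\<Gamma>. (\<forall>k\<in>K. \<phi> k p \<noteq> 0 \<longrightarrow> z k = 0) \<and>
           g = gradient E q p + (\<Sum>k\<in>K. z k *\<^sub>R gradient E (\<phi> k) p)))) \<and>
     (\<forall>k\<in>K. \<exists>b. b \<noteq> 0 \<and> \<bar>b\<bar> \<le> 1 \<and> gradient E q x + b *\<^sub>R gradient E (\<phi> k) x \<in> limiting_subdiff E f x)"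

text \<open>Subgradients of a sum are chosen independently in the components, so coefficient vectors
  may be as well: the new coefficient set is a product of the \<open>\<Gamma> i\<close>, read on
  pairs \<open>(i, k)\<close>.\<close>

lemma normal_form_prod:
  fixes x :: "'a::euclidean_space ^ 'k"
  assumes sep: "separable_sum X f"
    and nf: "\<And>i. normal_form (X i) (f i) (x $ i) (M i) (\<delta> i) (K i) (q i) (\<phi> i) (\<Gamma> i)"
  shows "normal_form (prod_space X) (separable_sum.total f) x (prod_space M) (Min (range \<delta>)) (SIGMA i:UNIV. K i)
    (\<lambda>y. \<Sum>i\<in>UNIV. q i (y $ i)) (\<lambda>(i, k) y. \<phi> i k (y $ i)) {z. \<forall>i. (\<lambda>k. z (i, k)) \<in> \<Gamma> i}"
proof -
  interpret separable_sum X f by (rule sep)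
  define r where "r = Min (range \<delta>)"
  define KK where "KK = (SIGMA i:UNIV. K i)"
  define Q where "Q y = (\<Sum>i\<in>UNIV. q i (y $ i))" for y
  define \<psi> where "\<psi> = (\<lambda>(i, k) y. \<phi> i k (y $ i))"
  define G where "G = {z. \<forall>i. (\<lambda>k. z (i, k)) \<in> \<Gamma> i}"
  have \<delta>: "\<And>i. \<delta> i > 0" and K: "\<And>i. finite (K i)" and xM: "\<And>i. x $ i \<in> M i" and M: "\<And>i. M i \<subseteq> X i"
    and q: "\<And>i. C2_on (X i \<inter> ball (x $ i) (\<delta> i)) (q i)"
    and \<phi>: "\<And>i k. k \<in> K i \<Longrightarrow> C2_on (X i \<inter> ball (x $ i) (\<delta> i)) (\<phi> i k)"
    and \<phi>0: "\<And>i k. k \<in> K i \<Longrightarrow> \<phi> i k (x $ i) = 0"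
    and cl: "\<And>i. closed (\<Gamma> i)"
    and conv: "\<And>i. \<forall>z\<in>\<Gamma> i. \<forall>w\<in>\<Gamma> i. \<forall>t\<in>{0..1}. (\<lambda>k. (1 - t) * z k + t * w k) \<in> \<Gamma> i"
    and zero: "\<And>i. (\<lambda>k. 0) \<in> \<Gamma> i" and supp: "\<And>i z k. z \<in> \<Gamma> i \<Longrightarrow> k \<notin> K i \<Longrightarrow> z k = 0"
    and fq: "\<And>i p. p \<in> M i \<inter> ball (x $ i) (\<delta> i) \<Longrightarrow> f i p = ereal (q i p)"
    and sub: "\<And>i p g. p \<in> M i \<inter> ball (x $ i) (\<delta> i) \<Longrightarrow> g \<in> limiting_subdiff (X i) (f i) p \<longleftrightarrow>
        (\<exists>z\<in>\<Gamma> i. (\<forall>k\<in>K i. \<phi> i k p \<noteq> 0 \<longrightarrow> z k = 0) \<and>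
           g = gradient (X i) (q i) p + (\<Sum>k\<in>K i. z k *\<^sub>R gradient (X i) (\<phi> i k) p))"
    and ax: "\<And>i k. k \<in> K i \<Longrightarrow> \<exists>b. b \<noteq> 0 \<and> \<bar>b\<bar> \<le> 1 \<and>
        gradient (X i) (q i) (x $ i) + b *\<^sub>R gradient (X i) (\<phi> i k) (x $ i) \<in> limiting_subdiff (X i) (f i) (x $ i)"
    using nf unfolding normal_form_def by blast+
  have r: "r > 0" "\<And>i. r \<le> \<delta> i" using \<delta> by (auto simp: r_def)
  have fin: "finite KK" using K by (auto simp: KK_def)
  have xX: "x \<in> prod_space X" using xM M by (auto simp: mem_prod_space)
  have comp: "y $ i \<in> ball (x $ i) (\<delta> i)" if "y \<in> ball x r" for y i
    using that r(2)[of i] Finite_Cartesian_Product.norm_nth_le[of "x - y" i] by (auto simp: dist_norm)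
  have "C2_on (prod_space X \<inter> ball x r) Q"
    unfolding Q_def by (intro C2_on_sum C2_on_component[OF q]) (use comp in \<open>simp add: mem_prod_space\<close>)
  moreover have "C2_on (prod_space X \<inter> ball x r) (\<psi> j) \<and> \<psi> j x = 0" if "j \<in> KK" for j
  proof -
    obtain i k where j: "j = (i, k)" "k \<in> K i" using \<open>j \<in> KK\<close> by (auto simp: KK_def)
    have "C2_on (prod_space X \<inter> ball x r) (\<lambda>y. \<phi> i k (y $ i))"
      by (rule C2_on_component[OF \<phi>[OF j(2)]]) (use comp in \<open>simp add: mem_prod_space\<close>)
    then show ?thesis using \<phi>0[OF j(2)] by (simp add: \<psi>_def j(1))
  qed
  moreover have "closed G"
  proof -
    have "closed ((\<lambda>z k. z (i, k)) -` \<Gamma> i)" for i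
      by (intro closed_vimage[OF cl] continuous_on_coordinatewise_then_product continuous_on_product_coordinates)
    then have "closed (\<Inter>i. (\<lambda>z k. z (i, k)) -` \<Gamma> i)" by blast
    moreover have "G = (\<Inter>i. (\<lambda>z k. z (i, k)) -` \<Gamma> i)" by (auto simp: G_def)
    ultimately show ?thesis by simp
  qed
  moreover have "\<forall>z\<in>G. \<forall>w\<in>G. \<forall>t\<in>{0..1}. (\<lambda>k. (1 - t) * z k + t * w k) \<in> G"
    using conv by (simp add: G_def)
  moreover have "(\<lambda>k. 0) \<in> G" using zero by (simp add: G_def)
  moreover have "\<forall>z\<in>G. \<forall>k. k \<notin> KK \<longrightarrow> z k = 0"
    using supp unfolding G_def KK_def by fastforce
  moreover have grQ: "gradient (prod_space X) Q p = (\<chi> i. gradient (X i) (q i) (p $ i))"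
    and grs: "\<And>z. (\<Sum>j\<in>KK. z j *\<^sub>R gradient (prod_space X) (\<psi> j) p) =
        (\<chi> i. \<Sum>k\<in>K i. z (i, k) *\<^sub>R gradient (X i) (\<phi> i k) (p $ i))"
    if p: "p \<in> prod_space X \<inter> ball x r" for p
  proof -
    have pX: "p $ i \<in> X i" for i using p by (simp add: mem_prod_space)
    have pb: "p $ i \<in> ball (x $ i) (\<delta> i)" for i using comp p by blast
    have "\<exists>D. (q i has_derivative D) (at (p $ i) within X i)" for i
      using C2_on_ball_differentiable[OF q pX pb] by blast
    then obtain D where D: "\<And>i. (q i has_derivative D i) (at (p $ i) within X i)" by metis
    show "gradient (prod_space X) Q p = (\<chi> i. gradient (X i) (q i) (p $ i))"
      unfolding Q_def by (rule gradient_sum_components[OF X _ D]) (use p in simp)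
    fix z
    have grk: "gradient (prod_space X) (\<psi> (i, k)) p = axis i (gradient (X i) (\<phi> i k) (p $ i))"
      if k: "k \<in> K i" for i k
    proof -
      obtain D where D: "(\<phi> i k has_derivative D) (at (p $ i) within X i)"
        using C2_on_ball_differentiable[OF \<phi>[OF k] pX pb] by blast
      show ?thesis unfolding \<psi>_def split_conv by (rule gradient_component[where F = "\<phi> i k" and i = i and X = X and x = p, OF X _ D]) (use p in simp)
    qed
    have "(\<Sum>j\<in>KK. z j *\<^sub>R gradient (prod_space X) (\<psi> j) p) =
        (\<Sum>(i, k)\<in>KK. z (i, k) *\<^sub>R axis i (gradient (X i) (\<phi> i k) (p $ i)))"
      by (rule sum.cong) (auto simp: KK_def grk)
    also have "\<dots> = (\<Sum>i\<in>UNIV. \<Sum>k\<in>K i. z (i, k) *\<^sub>R axis i (gradient (X i) (\<phi> i k) (p $ i)))"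
      unfolding KK_def using K by (intro sum.Sigma[symmetric]) auto
    also have "\<dots> = (\<Sum>i\<in>UNIV. axis i (\<Sum>k\<in>K i. z (i, k) *\<^sub>R gradient (X i) (\<phi> i k) (p $ i)))"
      by (simp add: linear_sum[OF linear_axis] linear_scale[OF linear_axis])
    finally show "(\<Sum>j\<in>KK. z j *\<^sub>R gradient (prod_space X) (\<psi> j) p) =
        (\<chi> i. \<Sum>k\<in>K i. z (i, k) *\<^sub>R gradient (X i) (\<phi> i k) (p $ i))"
      by (simp add: sum_axis)
  qed
  moreover have "total p = ereal (Q p)" "\<And>g. g \<in> limiting_subdiff (prod_space X) total p \<longleftrightarrow>
      (\<exists>z\<in>G. (\<forall>j\<in>KK. \<psi> j p \<noteq> 0 \<longrightarrow> z j = 0) \<and>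
        g = gradient (prod_space X) Q p + (\<Sum>j\<in>KK. z j *\<^sub>R gradient (prod_space X) (\<psi> j) p))"
    if p: "p \<in> prod_space M \<inter> ball x r" for p
  proof -
    have pi: "p $ i \<in> M i \<inter> ball (x $ i) (\<delta> i)" for i using p comp by (simp add: mem_prod_space)
    have pX: "p \<in> prod_space X \<inter> ball x r" using p M by (auto simp: mem_prod_space)
    show "total p = ereal (Q p)" using fq[OF pi] by (simp add: total_def Q_def sum_ereal)
    fix g
    have "g \<in> limiting_subdiff (prod_space X) total p \<longleftrightarrow>
        (\<forall>i. \<exists>z\<in>\<Gamma> i. (\<forall>k\<in>K i. \<phi> i k (p $ i) \<noteq> 0 \<longrightarrow> z k = 0) \<and>
           g $ i = gradient (X i) (q i) (p $ i) + (\<Sum>k\<in>K i. z k *\<^sub>R gradient (X i) (\<phi> i k) (p $ i)))"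
      by (simp only: limiting_subdiff_total_iff sub[OF pi])
    \<comment> \<open>Choice collects one coefficient vector per summand; the next step reads this
      family as a single vector on pairs.\<close>
    also have "\<dots> \<longleftrightarrow> (\<exists>z. \<forall>i. z i \<in> \<Gamma> i \<and> (\<forall>k\<in>K i. \<phi> i k (p $ i) \<noteq> 0 \<longrightarrow> z i k = 0) \<and>
           g $ i = gradient (X i) (q i) (p $ i) + (\<Sum>k\<in>K i. z i k *\<^sub>R gradient (X i) (\<phi> i k) (p $ i)))"
      by (simp only: Bex_def choice_iff)
    also have "\<dots> \<longleftrightarrow> (\<exists>z. \<forall>i. (\<lambda>k. z (i, k)) \<in> \<Gamma> i \<and> (\<forall>k\<in>K i. \<phi> i k (p $ i) \<noteq> 0 \<longrightarrow> z (i, k) = 0) \<and>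
           g $ i = gradient (X i) (q i) (p $ i) + (\<Sum>k\<in>K i. z (i, k) *\<^sub>R gradient (X i) (\<phi> i k) (p $ i)))"
      (is "(\<exists>z. ?A z) \<longleftrightarrow> (\<exists>z. ?B z)")
    proof
      assume "\<exists>z. ?A z"
      then obtain z where "?A z" by blast
      then have "?B (\<lambda>(i, k). z i k)" by simp
      then show "\<exists>z. ?B z" by blast
    next
      assume "\<exists>z. ?B z"
      then obtain z where "?B z" by blast
      then show "\<exists>z. ?A z" by (intro exI[of _ "\<lambda>i k. z (i, k)"])
    qed
    also have "\<dots> \<longleftrightarrow> (\<exists>z\<in>G. (\<forall>j\<in>KK. \<psi> j p \<noteq> 0 \<longrightarrow> z j = 0) \<and>
        g = gradient (prod_space X) Q p + (\<Sum>j\<in>KK. z j *\<^sub>R gradient (prod_space X) (\<psi> j) p))"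
      unfolding grQ[OF pX] grs[OF pX] by (auto simp: G_def KK_def \<psi>_def vec_eq_iff)
    finally show "g \<in> limiting_subdiff (prod_space X) total p \<longleftrightarrow>
      (\<exists>z\<in>G. (\<forall>j\<in>KK. \<psi> j p \<noteq> 0 \<longrightarrow> z j = 0) \<and>
        g = gradient (prod_space X) Q p + (\<Sum>j\<in>KK. z j *\<^sub>R gradient (prod_space X) (\<psi> j) p))" .
  qed
  moreover have "\<exists>b. b \<noteq> 0 \<and> \<bar>b\<bar> \<le> 1 \<and>
      gradient (prod_space X) Q x + b *\<^sub>R gradient (prod_space X) (\<psi> j) x \<in> limiting_subdiff (prod_space X) total x"
    if "j \<in> KK" for j
  proof -
    obtain i k where j: "j = (i, k)" "k \<in> K i" using \<open>j \<in> KK\<close> by (auto simp: KK_def)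
    obtain b where b: "b \<noteq> 0" "\<bar>b\<bar> \<le> 1"
      "gradient (X i) (q i) (x $ i) + b *\<^sub>R gradient (X i) (\<phi> i k) (x $ i) \<in> limiting_subdiff (X i) (f i) (x $ i)"
      using ax[OF j(2)] by blast
    have xp: "x \<in> prod_space X \<inter> ball x r" using xX r(1) by simp
    have xi: "x $ l \<in> M l \<inter> ball (x $ l) (\<delta> l)" for l using xM \<delta> by simp
    \<comment> \<open>As 0 is in \<open>\<Gamma> l\<close>, the gradient of \<open>q l\<close> is a
      subgradient. It fills all components but the one in which \<open>b\<close> acts.\<close>
    have g0: "gradient (X l) (q l) (x $ l) \<in> limiting_subdiff (X l) (f l) (x $ l)" for l
      unfolding sub[OF xi] using zero by (intro bexI[of _ "\<lambda>_. 0"]) auto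
    have "b *\<^sub>R gradient (prod_space X) (\<psi> j) x =
        (\<Sum>j'\<in>KK. (if j' = j then b else 0) *\<^sub>R gradient (prod_space X) (\<psi> j') x)"
      using fin that by (simp add: if_distrib[of "\<lambda>c. c *\<^sub>R _"] cong: if_cong)
    also have "\<dots> = (\<chi> i'. \<Sum>k'\<in>K i'. (if (i', k') = j then b else 0) *\<^sub>R gradient (X i') (\<phi> i' k') (x $ i'))"
      by (rule grs[OF xp])
    finally have eq: "b *\<^sub>R gradient (prod_space X) (\<psi> j) x =
        (\<chi> i'. \<Sum>k'\<in>K i'. (if (i', k') = j then b else 0) *\<^sub>R gradient (X i') (\<phi> i' k') (x $ i'))" .
    have "(gradient (prod_space X) Q x + b *\<^sub>R gradient (prod_space X) (\<psi> j) x) $ l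
        \<in> limiting_subdiff (X l) (f l) (x $ l)" for l
    proof (cases "l = i")
      case True
      have "(\<Sum>k'\<in>K i. (if k' = k then b else 0) *\<^sub>R gradient (X i) (\<phi> i k') (x $ i)) =
          b *\<^sub>R gradient (X i) (\<phi> i k) (x $ i)"
        using K[of i] j(2) by (simp add: if_distrib[of "\<lambda>c. c *\<^sub>R _"] cong: if_cong)
      then show ?thesis using b(3) unfolding vector_add_component eq grQ[OF xp] by (simp add: True j(1))
    next
      case False
      then show ?thesis using g0[of l] unfolding vector_add_component eq grQ[OF xp] by (simp add: j(1))
    qed
    with b(1,2) show ?thesis unfolding limiting_subdiff_total_iff by blast
  qed
  moreover have "x \<in> prod_space M" "prod_space M \<subseteq> prod_space X"
    using xM subsetD[OF M] by (auto simp: mem_prod_space)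
  ultimately have "normal_form (prod_space X) total x (prod_space M) r KK Q \<psi> G"
    unfolding normal_form_def using r(1) fin by blast
  then show ?thesis unfolding r_def KK_def Q_def \<psi>_def G_def .
qed

text \<open>Keeps the data that \<open>PDG\<close> quantifies away as parameters, so that facts
  about them can be stated one by one.\<close>

definition PDG_data ::
    "'a::euclidean_space set \<Rightarrow> ('a \<Rightarrow> ereal) \<Rightarrow> 'a \<Rightarrow> 'a set \<Rightarrow> real \<Rightarrow> nat \<Rightarrow> nat \<Rightarrow>
      (nat \<Rightarrow> 'a \<Rightarrow> real) \<Rightarrow> (nat \<Rightarrow> 'a \<Rightarrow> real) \<Rightarrow> ((nat \<Rightarrow> real) \<times> (nat \<Rightarrow> real)) set \<Rightarrow> bool" where
  "PDG_data E f xbar M \<delta> m1 m2 fs \<phi> \<Delta> \<longleftrightarrow>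
        (\<forall>i\<le>m1. C2_on (E \<inter> ball xbar \<delta>) (fs i)) \<and>
        (\<forall>j\<in>{1..m2}. C2_on (E \<inter> ball xbar \<delta>) (\<phi> j)) \<and>
        (\<forall>(\<alpha>, \<beta>)\<in>\<Delta>. (\<forall>i. i > m1 \<longrightarrow> \<alpha> i = 0) \<and> (\<forall>j. j \<notin> {1..m2} \<longrightarrow> \<beta> j = 0)) \<and>
        closed \<Delta> \<and>
        (\<forall>(\<alpha>, \<beta>)\<in>\<Delta>. \<forall>(\<alpha>', \<beta>')\<in>\<Delta>. \<forall>t\<in>{0..1}.
           (\<lambda>i. (1 - t) * \<alpha> i + t * \<alpha>' i, \<lambda>j. (1 - t) * \<beta> j + t * \<beta>' j) \<in> \<Delta>) \<and>
        xbar \<in> {x \<in> E \<inter> ball xbar \<delta>.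
                  (\<forall>i\<le>m1. ereal (fs i x) = f x) \<and> (\<forall>j\<in>{1..m2}. \<phi> j x = 0)} \<and>
        {x \<in> E \<inter> ball xbar \<delta>.
                  (\<forall>i\<le>m1. ereal (fs i x) = f x) \<and> (\<forall>j\<in>{1..m2}. \<phi> j x = 0)}
           \<subseteq> M \<inter> ball xbar \<delta> \<and>
        (\<forall>(\<alpha>, \<beta>)\<in>\<Delta>. (\<forall>i\<le>m1. \<alpha> i \<ge> 0) \<and> (\<Sum>i\<le>m1. \<alpha> i) = 1) \<and>
        (\<forall>i\<le>m1. (\<lambda>k. if k = i then 1 else 0, \<lambda>j. 0) \<in> \<Delta>) \<and>
        (\<forall>j0\<in>{1..m2}. \<exists>(\<alpha>, \<beta>)\<in>\<Delta>. \<beta> j0 \<noteq> 0 \<and> (\<forall>j. j \<noteq> j0 \<longrightarrow> \<beta> j = 0)) \<and>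
        (\<forall>x \<in> M \<inter> ball xbar \<delta>.
           (\<exists>i\<le>m1. f x = ereal (fs i x)) \<and>
           (\<forall>g. g \<in> limiting_subdiff E f x \<longleftrightarrow>
              (\<exists>(\<alpha>, \<beta>)\<in>\<Delta>.
                 (\<forall>i\<le>m1. ereal (fs i x) \<noteq> f x \<longrightarrow> \<alpha> i = 0) \<and>
                 (\<forall>j\<in>{1..m2}. \<phi> j x \<noteq> 0 \<longrightarrow> \<beta> j = 0) \<and>
                 g = (\<Sum>i\<le>m1. \<alpha> i *\<^sub>R gradient E (fs i) x) +
                     (\<Sum>j\<in>{1..m2}. \<beta> j *\<^sub>R gradient E (\<phi> j) x))))"

lemma PDG_iff_data:
  "PDG E f x M \<longleftrightarrow> x \<in> E \<and> M \<subseteq> E \<and> (\<forall>x\<in>E. f x \<noteq> -\<infinity>) \<and> lsc_on E f \<and>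
    (\<exists>\<delta>>0. \<exists>m1 m2 fs \<phi> \<Delta>. PDG_data E f x M \<delta> m1 m2 fs \<phi> \<Delta>)"
  unfolding PDG_def PDG_data_def ..

text \<open>
  A second structure function \<open>q + norm (y - x)^2\<close>, which equals \<open>f\<close> on \<open>M\<close> only at \<open>x\<close>, settles (i),
  and lets (iv) hold: coefficient vectors with a positive weight on it matter only at \<open>x\<close>, where they
  merely have to produce subgradients.
\<close>
lemma PDG_of_normal_form:
  fixes K :: "'c set"
  assumes E: "subspace E" and f: "lsc_on E f" "\<And>y. y \<in> E \<Longrightarrow> f y \<noteq> -\<infinity>"
    and nf: "normal_form E f x M \<delta> K q \<phi> \<Gamma>"
  shows "PDG E f x M"
proof -
  have \<delta>: "\<delta> > 0" and K: "finite K" and xM: "x \<in> M" and M: "M \<subseteq> E"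
    and q: "C2_on (E \<inter> ball x \<delta>) q"
    and \<phi>: "\<And>k. k \<in> K \<Longrightarrow> C2_on (E \<inter> ball x \<delta>) (\<phi> k)"
    and \<phi>0: "\<And>k. k \<in> K \<Longrightarrow> \<phi> k x = 0"
    and cl: "closed \<Gamma>"
    and conv: "\<And>z w t. z \<in> \<Gamma> \<Longrightarrow> w \<in> \<Gamma> \<Longrightarrow> t \<in> {0..1} \<Longrightarrow> (\<lambda>k. (1 - t) * z k + t * w k) \<in> \<Gamma>"
    and zero: "(\<lambda>k. 0) \<in> \<Gamma>" and supp: "\<And>z k. z \<in> \<Gamma> \<Longrightarrow> k \<notin> K \<Longrightarrow> z k = 0"
    and fq: "\<And>p. p \<in> M \<inter> ball x \<delta> \<Longrightarrow> f p = ereal (q p)"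
    and sub: "\<And>p g. p \<in> M \<inter> ball x \<delta> \<Longrightarrow> g \<in> limiting_subdiff E f p \<longleftrightarrow>
        (\<exists>z\<in>\<Gamma>. (\<forall>k\<in>K. \<phi> k p \<noteq> 0 \<longrightarrow> z k = 0) \<and>
           g = gradient E q p + (\<Sum>k\<in>K. z k *\<^sub>R gradient E (\<phi> k) p))"
    and ax: "\<And>k. k \<in> K \<Longrightarrow> \<exists>b. b \<noteq> 0 \<and> \<bar>b\<bar> \<le> 1 \<and>
        gradient E q x + b *\<^sub>R gradient E (\<phi> k) x \<in> limiting_subdiff E f x"
    using nf unfolding normal_form_def by blast+
  have xE: "x \<in> E" using xM M by blast
  have xb: "x \<in> M \<inter> ball x \<delta>" using xM \<delta> by simp
  \<comment> \<open>\<open>PDG\<close> numbers its functions from 1, so \<open>K\<close> is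
    enumerated by \<open>{1..m}\<close>.\<close>
  define m where "m = card K"
  obtain en where en: "bij_betw en {1..m} K" using ex_bij_betw_nat_finite_1[OF K] unfolding m_def by blast
  have enK: "en j \<in> K" if "j \<in> {1..m}" for j using en that by (auto simp: bij_betw_def)
  have reindex: "(\<Sum>k\<in>K. F k) = (\<Sum>j\<in>{1..m}. F (en j))" for F :: "'c \<Rightarrow> 'a"
    using sum.reindex_bij_betw[OF en, of F] by simp
  define S where "S = limiting_subdiff E f x"
  \<comment> \<open>The vector that \<open>\<beta>\<close> produces at \<open>x\<close>. Both
    structure functions chosen below have the gradient of \<open>q\<close> there, and their weights
    total 1, so the weights do not enter.\<close>
  define G where "G \<beta> = gradient E q x + (\<Sum>j\<in>{1..m}. \<beta> j *\<^sub>R gradient E (\<phi> (en j)) x)" for \<beta> :: "nat \<Rightarrow> real"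
  have GS: "G (\<lambda>j. z (en j)) \<in> S" if "z \<in> \<Gamma>" for z
    unfolding S_def sub[OF xb] G_def using that \<phi>0 by (intro bexI[of _ z]) (auto simp: reindex)
  have mix: "G (\<lambda>j. (1 - t) * \<beta> j + t * \<beta>' j) = (1 - t) *\<^sub>R G \<beta> + t *\<^sub>R G \<beta>'" for t \<beta> \<beta>'
    by (simp add: G_def algebra_simps sum.distrib sum_subtractf scaleR_sum_right)
  \<comment> \<open>All \<open>\<phi> k\<close> vanish at \<open>x\<close>, so no coefficient is
    excluded there and \<open>S\<close> inherits convexity from \<open>\<Gamma>\<close>.\<close>
  have Sconv: "(1 - t) *\<^sub>R g + t *\<^sub>R g' \<in> S" if "g \<in> S" "g' \<in> S" "t \<in> {0..1}" for t g g'
  proof -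
    obtain z z' where z: "z \<in> \<Gamma>" "g = gradient E q x + (\<Sum>k\<in>K. z k *\<^sub>R gradient E (\<phi> k) x)"
      "z' \<in> \<Gamma>" "g' = gradient E q x + (\<Sum>k\<in>K. z' k *\<^sub>R gradient E (\<phi> k) x)"
      using \<open>g \<in> S\<close> \<open>g' \<in> S\<close> unfolding S_def sub[OF xb] by blast
    have "(1 - t) *\<^sub>R g + t *\<^sub>R g' = (1 - t) *\<^sub>R G (\<lambda>j. z (en j)) + t *\<^sub>R G (\<lambda>j. z' (en j))"
      by (simp add: z(2,4) G_def reindex)
    also have "\<dots> = G (\<lambda>j. (1 - t) * z (en j) + t * z' (en j))" by (simp only: mix)
    also have "\<dots> \<in> S" using GS[OF conv[OF z(1,3) that(3)]] .
    finally show ?thesis .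
  qed
  have Scl: "closed S" unfolding S_def by (rule closed_limiting_subdiff)
  \<comment> \<open>\<open>t\<close> is the weight of the second structure function. At
    \<open>t = 0\<close> the entries of \<open>\<beta>\<close> are those of a vector of
    \<open>\<Gamma>\<close>; for positive \<open>t\<close> each may deviate by up to
    \<open>t\<close>, provided that \<open>\<beta>\<close> still yields a subgradient at
    \<open>x\<close>. A tolerance linear in \<open>t\<close> keeps the set convex.\<close>
  define B :: "((nat \<Rightarrow> real) \<times> (nat \<Rightarrow> real)) set" where
    "B = {(\<alpha>, \<beta>). \<exists>t\<in>{0..1}. \<exists>z\<in>\<Gamma>. \<alpha> = (\<lambda>i. if i = 0 then 1 - t else if i = 1 then t else 0) \<and>
      (\<forall>j. j \<notin> {1..m} \<longrightarrow> \<beta> j = 0) \<and> G \<beta> \<in> S \<and> (\<forall>j\<in>{1..m}. \<bar>\<beta> j - z (en j)\<bar> \<le> t)}"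
  \<comment> \<open>The closure gives closedness outright; what has to survive the limit is
    collected in \<open>props\<close>.\<close>
  define \<Delta> where "\<Delta> = closure B"
  have B\<Delta>: "B \<subseteq> \<Delta>" unfolding \<Delta>_def by (rule closure_subset)
  have seq: "\<exists>a b. (\<forall>n. (a n, b n) \<in> B) \<and> (\<forall>i. (\<lambda>n. a n i) \<longlonglongrightarrow> \<alpha> i) \<and> (\<forall>j. (\<lambda>n. b n j) \<longlonglongrightarrow> \<beta> j)"
    if "(\<alpha>, \<beta>) \<in> \<Delta>" for \<alpha> \<beta>
  proof -
    obtain s where s: "\<And>n. s n \<in> B" "s \<longlonglongrightarrow> (\<alpha>, \<beta>)" using \<open>(\<alpha>, \<beta>) \<in> \<Delta>\<close> unfolding \<Delta>_def closure_sequential by blast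
    have "(\<lambda>n. fst (s n)) \<longlonglongrightarrow> \<alpha>" "(\<lambda>n. snd (s n)) \<longlonglongrightarrow> \<beta>"
      using tendsto_fst[OF s(2)] tendsto_snd[OF s(2)] by simp_all
    then show ?thesis using s(1)
      by (intro exI[of _ "\<lambda>n. fst (s n)"] exI[of _ "\<lambda>n. snd (s n)"]) (simp add: tendsto_fun_iff)
  qed
  have lim\<Delta>: "(\<alpha>, \<beta>) \<in> \<Delta>"
    if "\<And>n. (a n, b n) \<in> \<Delta>" "\<And>i. (\<lambda>n. a n i) \<longlonglongrightarrow> \<alpha> i" "\<And>j. (\<lambda>n. b n j) \<longlonglongrightarrow> \<beta> j" for \<alpha> \<beta> a b
  proof -
    have "(\<lambda>n. (a n, b n)) \<longlonglongrightarrow> (\<alpha>, \<beta>)"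
      using that(2,3) by (intro tendsto_Pair) (auto simp: tendsto_fun_iff)
    then show ?thesis
      using closed_sequentially[OF closed_closure, where f = "\<lambda>n. (a n, b n)"] that(1) unfolding \<Delta>_def by blast
  qed
  have props: "\<exists>t\<in>{0..1}. \<alpha> = (\<lambda>i. if i = 0 then 1 - t else if i = 1 then t else 0)"
      "\<forall>j. j \<notin> {1..m} \<longrightarrow> \<beta> j = 0" "G \<beta> \<in> S"
      "\<alpha> 1 = 0 \<Longrightarrow> \<exists>z\<in>\<Gamma>. \<forall>j\<in>{1..m}. z (en j) = \<beta> j"
    if ab: "(\<alpha>, \<beta>) \<in> \<Delta>" for \<alpha> \<beta>
  proof -
    obtain a b where s: "\<And>n. (a n, b n) \<in> B" "\<And>i. (\<lambda>n. a n i) \<longlonglongrightarrow> \<alpha> i" "\<And>j. (\<lambda>n. b n j) \<longlonglongrightarrow> \<beta> j"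
      using seq[OF ab] by blast
    define Q where "Q n t z \<longleftrightarrow> t \<in> {0..1} \<and> z \<in> \<Gamma> \<and>
      a n = (\<lambda>i. if i = 0 then 1 - t else if i = 1 then t else 0) \<and>
      (\<forall>j. j \<notin> {1..m} \<longrightarrow> b n j = 0) \<and> G (b n) \<in> S \<and> (\<forall>j\<in>{1..m}. \<bar>b n j - z (en j)\<bar> \<le> t)" for n t z
    have "\<forall>n. \<exists>t z. Q n t z"
      using s(1) unfolding B_def Q_def by blast
    then obtain t z where "\<forall>n. Q n (t n) (z n)" by (auto simp: choice_iff)
    then have tz: "\<And>n. t n \<in> {0..1}" "\<And>n. z n \<in> \<Gamma>"
      "\<And>n. a n = (\<lambda>i. if i = 0 then 1 - t n else if i = 1 then t n else 0)"
      "\<And>n j. j \<notin> {1..m} \<Longrightarrow> b n j = 0" "\<And>n. G (b n) \<in> S"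
      "\<And>n j. j \<in> {1..m} \<Longrightarrow> \<bar>b n j - z n (en j)\<bar> \<le> t n"
      unfolding Q_def by blast+
    have t1: "t \<longlonglongrightarrow> \<alpha> 1" using s(2)[of 1] by (simp add: tz(3))
    have t0: "(\<lambda>n. 1 - t n) \<longlonglongrightarrow> \<alpha> 0" using s(2)[of 0] by (simp add: tz(3))
    have "\<alpha> 0 = 1 - \<alpha> 1" using LIMSEQ_unique[OF t0 tendsto_diff[OF tendsto_const t1]] .
    moreover have "\<alpha> i = 0" if "i \<noteq> 0" "i \<noteq> 1" for i
      using s(2)[of i] that by (simp add: tz(3) LIMSEQ_const_iff)
    ultimately have "\<alpha> = (\<lambda>i. if i = 0 then 1 - \<alpha> 1 else if i = 1 then \<alpha> 1 else 0)" by auto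
    moreover have "\<alpha> 1 \<in> {0..1}"
      using closed_sequentially[OF closed_atLeastAtMost tz(1) t1] .
    ultimately show "\<exists>t\<in>{0..1}. \<alpha> = (\<lambda>i. if i = 0 then 1 - t else if i = 1 then t else 0)" by blast
    show "\<forall>j. j \<notin> {1..m} \<longrightarrow> \<beta> j = 0"
    proof (intro allI impI)
      fix j assume "j \<notin> {1..m}"
      then show "\<beta> j = 0" using s(3)[of j] by (simp add: tz(4) LIMSEQ_const_iff del: atLeastAtMost_iff)
    qed
    have "(\<lambda>n. G (b n)) \<longlonglongrightarrow> G \<beta>" unfolding G_def using s(3) by (intro tendsto_intros)
    then show "G \<beta> \<in> S" by (rule closed_sequentially[OF Scl tz(5)])
    \<comment> \<open>If the limiting weight is 0, the tolerances tend to 0 and the comparison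
      vectors from \<open>\<Gamma>\<close> converge to the limit of the \<open>b n\<close>, so
      closedness of \<open>\<Gamma>\<close> applies.\<close>
    assume a1: "\<alpha> 1 = 0"
    have zl: "(\<lambda>n. z n (en j)) \<longlonglongrightarrow> \<beta> j" if j: "j \<in> {1..m}" for j
    proof -
      have "(\<lambda>n. b n j - z n (en j)) \<longlonglongrightarrow> 0"
      proof (rule Lim_null_comparison)
        show "\<forall>\<^sub>F n in sequentially. norm (b n j - z n (en j)) \<le> t n" using tz(6)[OF j] by simp
        show "t \<longlonglongrightarrow> 0" using t1 a1 by simp
      qed
      from tendsto_diff[OF s(3)[of j] this] show ?thesis by simp
    qed
    \<comment> \<open>\<open>\<beta>\<close> carried back to the index set \<open>K\<close>, with
      value 0 outside it, where the vectors of \<open>\<Gamma>\<close> vanish too.\<close>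
    define w where "w k = (if k \<in> K then \<beta> (inv_into {1..m} en k) else 0)" for k
    have wen: "w (en j) = \<beta> j" if j: "j \<in> {1..m}" for j
      using enK[OF j] en j by (simp add: w_def bij_betw_inv_into_left)
    have "z \<longlonglongrightarrow> w"
      unfolding tendsto_fun_iff
    proof
      fix k
      show "(\<lambda>n. z n k) \<longlonglongrightarrow> w k"
      proof (cases "k \<in> K")
        case True
        then obtain j where j: "j \<in> {1..m}" "k = en j" using en by (auto simp: bij_betw_def)
        then show ?thesis using zl wen by simp
      next
        case False
        then show ?thesis using supp[OF tz(2)] by (simp add: w_def)
      qed
    qed
    then have "w \<in> \<Gamma>" by (rule closed_sequentially[OF cl tz(2)])
    then show "\<exists>z\<in>\<Gamma>. \<forall>j\<in>{1..m}. z (en j) = \<beta> j" using wen by blast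
  qed
  have Bconv: "(\<lambda>i. (1 - s) * \<alpha> i + s * \<alpha>' i, \<lambda>j. (1 - s) * \<beta> j + s * \<beta>' j) \<in> B"
    if ab: "(\<alpha>, \<beta>) \<in> B" and ab': "(\<alpha>', \<beta>') \<in> B" and s: "s \<in> {0..1}" for \<alpha> \<beta> \<alpha>' \<beta>' s
  proof -
    obtain t z where t: "t \<in> {0..1}" "z \<in> \<Gamma>" "\<alpha> = (\<lambda>i. if i = 0 then 1 - t else if i = 1 then t else 0)"
      "\<forall>j. j \<notin> {1..m} \<longrightarrow> \<beta> j = 0" "G \<beta> \<in> S" "\<forall>j\<in>{1..m}. \<bar>\<beta> j - z (en j)\<bar> \<le> t"
      using ab unfolding B_def by blast
    obtain t' z' where t': "t' \<in> {0..1}" "z' \<in> \<Gamma>" "\<alpha>' = (\<lambda>i. if i = 0 then 1 - t' else if i = 1 then t' else 0)"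
      "\<forall>j. j \<notin> {1..m} \<longrightarrow> \<beta>' j = 0" "G \<beta>' \<in> S" "\<forall>j\<in>{1..m}. \<bar>\<beta>' j - z' (en j)\<bar> \<le> t'"
      using ab' unfolding B_def by blast
    define T where "T = (1 - s) * t + s * t'"
    have "T \<in> {0..1}"
      using s t(1) t'(1) convex_bound_le[of t 1 t' "1 - s" s] by (auto simp: T_def)
    moreover have "(\<lambda>k. (1 - s) * z k + s * z' k) \<in> \<Gamma>" by (rule conv[OF t(2) t'(2) s])
    moreover have "(\<lambda>i. (1 - s) * \<alpha> i + s * \<alpha>' i) = (\<lambda>i. if i = 0 then 1 - T else if i = 1 then T else 0)"
      by (auto simp: t(3) t'(3) T_def algebra_simps)
    moreover have "\<forall>j. j \<notin> {1..m} \<longrightarrow> (1 - s) * \<beta> j + s * \<beta>' j = 0" using t(4) t'(4) by simp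
    moreover have "G (\<lambda>j. (1 - s) * \<beta> j + s * \<beta>' j) \<in> S" unfolding mix by (rule Sconv[OF t(5) t'(5) s])
    moreover have "\<forall>j\<in>{1..m}. \<bar>((1 - s) * \<beta> j + s * \<beta>' j) - ((1 - s) * z (en j) + s * z' (en j))\<bar> \<le> T"
    proof
      fix j assume j: "j \<in> {1..m}"
      have "((1 - s) * \<beta> j + s * \<beta>' j) - ((1 - s) * z (en j) + s * z' (en j)) =
          (1 - s) * (\<beta> j - z (en j)) + s * (\<beta>' j - z' (en j))" by (simp add: algebra_simps)
      also have "\<bar>\<dots>\<bar> \<le> \<bar>(1 - s) * (\<beta> j - z (en j))\<bar> + \<bar>s * (\<beta>' j - z' (en j))\<bar>" by (rule abs_triangle_ineq)
      also have "\<dots> = (1 - s) * \<bar>\<beta> j - z (en j)\<bar> + s * \<bar>\<beta>' j - z' (en j)\<bar>" using s by (simp add: abs_mult)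
      also have "\<dots> \<le> T"
        unfolding T_def using s t(6) t'(6) j by (intro add_mono mult_left_mono) auto
      finally show "\<bar>((1 - s) * \<beta> j + s * \<beta>' j) - ((1 - s) * z (en j) + s * z' (en j))\<bar> \<le> T" .
    qed
    ultimately show ?thesis unfolding B_def mem_Collect_eq split_conv
      by (intro bexI[of _ T] bexI[of _ "\<lambda>k. (1 - s) * z k + s * z' k"] conjI)
  qed
  have \<Delta>conv: "(\<lambda>i. (1 - s) * \<alpha> i + s * \<alpha>' i, \<lambda>j. (1 - s) * \<beta> j + s * \<beta>' j) \<in> \<Delta>"
    if ab: "(\<alpha>, \<beta>) \<in> \<Delta>" and ab': "(\<alpha>', \<beta>') \<in> \<Delta>" and s: "s \<in> {0..1}" for \<alpha> \<beta> \<alpha>' \<beta>' s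
  proof -
    obtain a b where 1: "\<And>n. (a n, b n) \<in> B" "\<And>i. (\<lambda>n. a n i) \<longlonglongrightarrow> \<alpha> i" "\<And>j. (\<lambda>n. b n j) \<longlonglongrightarrow> \<beta> j"
      using seq[OF ab] by blast
    obtain a' b' where 2: "\<And>n. (a' n, b' n) \<in> B" "\<And>i. (\<lambda>n. a' n i) \<longlonglongrightarrow> \<alpha>' i" "\<And>j. (\<lambda>n. b' n j) \<longlonglongrightarrow> \<beta>' j"
      using seq[OF ab'] by blast
    show ?thesis
    proof (rule lim\<Delta>[where a = "\<lambda>n i. (1 - s) * a n i + s * a' n i" and b = "\<lambda>n j. (1 - s) * b n j + s * b' n j"])
      show "((\<lambda>i. (1 - s) * a n i + s * a' n i), (\<lambda>j. (1 - s) * b n j + s * b' n j)) \<in> \<Delta>" for n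
        using Bconv[OF 1(1) 2(1) s] B\<Delta> by blast
    qed (intro tendsto_intros 1 2)+
  qed
  define fs where "fs i = (if i = (0::nat) then q else (\<lambda>y. q y + (y - x) \<bullet> (y - x)))" for i
  define \<psi> where "\<psi> j = \<phi> (en j)" for j
  have fs1: "fs 1 p = q p \<longleftrightarrow> p = x" for p by (simp add: fs_def)
  have ilt: "i \<le> 1 \<longleftrightarrow> i = 0 \<or> i = 1" for i :: nat by auto
  have sum1: "(\<Sum>i\<le>1. F i) = F 0 + F 1" for F :: "nat \<Rightarrow> 'b::comm_monoid_add"
    by (simp add: atMost_Suc add.commute)
  have C2fs: "\<forall>i\<le>1. C2_on (E \<inter> ball x \<delta>) (fs i)"
    using q C2_on_add[OF q C2_on_norm_square[of _ x]] by (auto simp: fs_def)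
  have C2\<psi>: "\<forall>j\<in>{1..m}. C2_on (E \<inter> ball x \<delta>) (\<psi> j)"
    using \<phi> enK by (auto simp: \<psi>_def)
  have \<Delta>supp: "\<forall>(\<alpha>, \<beta>)\<in>\<Delta>. (\<forall>i. i > 1 \<longrightarrow> \<alpha> i = 0) \<and> (\<forall>j. j \<notin> {1..m} \<longrightarrow> \<beta> j = 0)"
  proof clarify
    fix \<alpha> \<beta> assume ab: "(\<alpha>, \<beta>) \<in> \<Delta>"
    show "(\<forall>i. i > 1 \<longrightarrow> \<alpha> i = 0) \<and> (\<forall>j. j \<notin> {1..m} \<longrightarrow> \<beta> j = 0)"
      using props(1)[OF ab] props(2)[OF ab] by auto
  qed
  have \<Delta>conv': "\<forall>(\<alpha>, \<beta>)\<in>\<Delta>. \<forall>(\<alpha>', \<beta>')\<in>\<Delta>. \<forall>t\<in>{0..1}.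
      (\<lambda>i. (1 - t) * \<alpha> i + t * \<alpha>' i, \<lambda>j. (1 - t) * \<beta> j + t * \<beta>' j) \<in> \<Delta>"
    using \<Delta>conv by (intro ballI) (simp only: split_paired_all split_conv, blast)
  have i1: "x \<in> {y \<in> E \<inter> ball x \<delta>. (\<forall>i\<le>1. ereal (fs i y) = f y) \<and> (\<forall>j\<in>{1..m}. \<psi> j y = 0)}"
    using xE \<delta> fq[OF xb] \<phi>0 enK by (auto simp: fs_def \<psi>_def)
  \<comment> \<open>The two structure functions agree only at \<open>x\<close>, so this set contains
    no other point, whatever \<open>f\<close> does off \<open>M\<close>.\<close>
  have i2: "{y \<in> E \<inter> ball x \<delta>. (\<forall>i\<le>1. ereal (fs i y) = f y) \<and> (\<forall>j\<in>{1..m}. \<psi> j y = 0)} \<subseteq> M \<inter> ball x \<delta>"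
  proof
    fix y assume y: "y \<in> {y \<in> E \<inter> ball x \<delta>. (\<forall>i\<le>1. ereal (fs i y) = f y) \<and> (\<forall>j\<in>{1..m}. \<psi> j y = 0)}"
    then have "ereal (fs 0 y) = f y" "ereal (fs 1 y) = f y" by auto
    then have "ereal (fs 1 y) = ereal (fs 0 y)" by simp
    then have "y = x" using fs1[of y] by (simp add: fs_def)
    then show "y \<in> M \<inter> ball x \<delta>" using xb by simp
  qed
  have ii: "\<forall>(\<alpha>, \<beta>)\<in>\<Delta>. (\<forall>i\<le>1. \<alpha> i \<ge> 0) \<and> (\<Sum>i\<le>1. \<alpha> i) = 1"
  proof clarify
    fix \<alpha> \<beta> assume ab: "(\<alpha>, \<beta>) \<in> \<Delta>"
    show "(\<forall>i\<le>1. \<alpha> i \<ge> 0) \<and> (\<Sum>i\<le>1. \<alpha> i) = 1"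
      using props(1)[OF ab] by (auto simp: sum1 ilt)
  qed
  have G0: "G (\<lambda>j. 0) \<in> S" using GS[OF zero] .
  have iii: "\<forall>i\<le>1. (\<lambda>k. if k = i then 1 else 0, \<lambda>j. 0) \<in> \<Delta>"
  proof (intro allI impI)
    fix i :: nat assume "i \<le> 1"
    \<comment> \<open>Weight 0 or 1 on the second function, with the zero vector of
      \<open>\<Gamma>\<close> for comparison.\<close>
    then have "(\<lambda>k. if k = i then 1 else 0 :: real) =
        (\<lambda>k. if k = 0 then 1 - real i else if k = 1 then real i else 0)" by (auto simp: ilt)
    moreover have "real i \<in> {0..1}" using \<open>i \<le> 1\<close> by simp
    ultimately have "(\<lambda>k. if k = i then 1 else 0, \<lambda>j. 0) \<in> B"
      unfolding B_def mem_Collect_eq split_conv using zero G0 by (intro bexI[of _ "real i"] bexI[of _ "\<lambda>k. 0"]) auto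
    with B\<Delta> show "(\<lambda>k. if k = i then 1 else 0, \<lambda>j. 0) \<in> \<Delta>" by blast
  qed
  have iv: "\<forall>j0\<in>{1..m}. \<exists>(\<alpha>, \<beta>)\<in>\<Delta>. \<beta> j0 \<noteq> 0 \<and> (\<forall>j. j \<noteq> j0 \<longrightarrow> \<beta> j = 0)"
  proof
    fix j0 assume j0: "j0 \<in> {1..m}"
    obtain b where b: "b \<noteq> 0" "\<bar>b\<bar> \<le> 1" "gradient E q x + b *\<^sub>R gradient E (\<phi> (en j0)) x \<in> S"
      using ax[OF enK[OF j0]] unfolding S_def by blast
    define \<beta> where "\<beta> j = (if j = j0 then b else 0)" for j
    have "G \<beta> = gradient E q x + b *\<^sub>R gradient E (\<phi> (en j0)) x"
      using j0 by (simp add: G_def \<beta>_def if_distrib[of "\<lambda>c. c *\<^sub>R _"] cong: if_cong)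
    \<comment> \<open>With all weight on the second function the tolerance is 1. The bound
      \<open>\<bar>b\<bar> \<le> 1\<close> therefore admits \<open>\<beta>\<close>, compared with
      the zero vector.\<close>
    then have "(\<lambda>i. if i = 0 then 1 - 1 else if i = 1 then 1 else 0, \<beta>) \<in> B"
      unfolding B_def mem_Collect_eq split_conv using zero b j0
      by (intro bexI[of _ 1] bexI[of _ "\<lambda>k. 0"]) (auto simp: \<beta>_def)
    then show "\<exists>(\<alpha>, \<beta>)\<in>\<Delta>. \<beta> j0 \<noteq> 0 \<and> (\<forall>j. j \<noteq> j0 \<longrightarrow> \<beta> j = 0)"
      using B\<Delta> b(1) by (intro bexI[of _ "(\<lambda>i. if i = 0 then 1 - 1 else if i = 1 then 1 else 0, \<beta>)"])
        (auto simp: \<beta>_def)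
  qed
  have v1: "\<exists>i\<le>1. f p = ereal (fs i p)" if "p \<in> M \<inter> ball x \<delta>" for p
    using fq[OF that] by (intro exI[of _ 0]) (simp add: fs_def)
  have v2: "g \<in> limiting_subdiff E f p \<longleftrightarrow> (\<exists>(\<alpha>, \<beta>)\<in>\<Delta>.
       (\<forall>i\<le>1. ereal (fs i p) \<noteq> f p \<longrightarrow> \<alpha> i = 0) \<and> (\<forall>j\<in>{1..m}. \<psi> j p \<noteq> 0 \<longrightarrow> \<beta> j = 0) \<and>
       g = (\<Sum>i\<le>1. \<alpha> i *\<^sub>R gradient E (fs i) p) + (\<Sum>j\<in>{1..m}. \<beta> j *\<^sub>R gradient E (\<psi> j) p))"
    (is "_ \<longleftrightarrow> ?R") if p: "p \<in> M \<inter> ball x \<delta>" for p g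
  proof
    assume "g \<in> limiting_subdiff E f p"
    then obtain z where z: "z \<in> \<Gamma>" "\<forall>k\<in>K. \<phi> k p \<noteq> 0 \<longrightarrow> z k = 0"
      "g = gradient E q p + (\<Sum>k\<in>K. z k *\<^sub>R gradient E (\<phi> k) p)"
      unfolding sub[OF p] by blast
    define \<alpha> where "\<alpha> i = (if i = 0 then 1 - 0 else if i = 1 then 0 else 0 :: real)" for i :: nat
    define \<beta> where "\<beta> j = (if j \<in> {1..m} then z (en j) else 0)" for j
    have "G \<beta> = G (\<lambda>j. z (en j))" by (simp add: G_def \<beta>_def)
    then have "(\<alpha>, \<beta>) \<in> B"
      unfolding B_def mem_Collect_eq split_conv using z(1) GS[OF z(1)]
      by (intro bexI[of _ 0] bexI[of _ z]) (auto simp: \<alpha>_def \<beta>_def)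
    then have "(\<alpha>, \<beta>) \<in> \<Delta>" using B\<Delta> by blast
    moreover have "\<forall>i\<le>1. ereal (fs i p) \<noteq> f p \<longrightarrow> \<alpha> i = 0"
      using fq[OF p] by (auto simp: ilt fs_def \<alpha>_def)
    moreover have "\<forall>j\<in>{1..m}. \<psi> j p \<noteq> 0 \<longrightarrow> \<beta> j = 0"
      using z(2) enK by (auto simp: \<psi>_def \<beta>_def)
    moreover have "g = (\<Sum>i\<le>1. \<alpha> i *\<^sub>R gradient E (fs i) p) + (\<Sum>j\<in>{1..m}. \<beta> j *\<^sub>R gradient E (\<psi> j) p)"
      by (simp add: z(3) sum1 \<alpha>_def fs_def reindex \<beta>_def \<psi>_def)
    ultimately show ?R by (intro bexI[of _ "(\<alpha>, \<beta>)"]) simp_all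
  next
    assume ?R
    then obtain \<alpha> \<beta> where ab: "(\<alpha>, \<beta>) \<in> \<Delta>" "\<forall>i\<le>1. ereal (fs i p) \<noteq> f p \<longrightarrow> \<alpha> i = 0"
      "\<forall>j\<in>{1..m}. \<psi> j p \<noteq> 0 \<longrightarrow> \<beta> j = 0"
      "g = (\<Sum>i\<le>1. \<alpha> i *\<^sub>R gradient E (fs i) p) + (\<Sum>j\<in>{1..m}. \<beta> j *\<^sub>R gradient E (\<psi> j) p)"
      by blast
    obtain t where t: "t \<in> {0..1}" "\<alpha> = (\<lambda>i. if i = 0 then 1 - t else if i = 1 then t else 0)"
      using props(1)[OF ab(1)] by blast
    \<comment> \<open>At \<open>x\<close> the square has gradient 0, so any weights give
      \<open>G \<beta>\<close>, which is a subgradient. Elsewhere on \<open>M\<close> the second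
      function is inactive, which forces its weight to be 0 and \<open>\<beta>\<close> to come from
      \<open>\<Gamma>\<close>.\<close>
    show "g \<in> limiting_subdiff E f p"
    proof (cases "p = x")
      case True
      have "gradient E (fs 1) x = gradient E q x"
      proof (rule gradient_eqI[OF E xE])
        obtain D where D: "(q has_derivative D) (at x within E)"
          using C2_on_ball_differentiable[OF q xE] \<delta> by auto
        note gq = gradient_works[OF E xE D]
        show "gradient E q x \<in> E" by (rule gq(1))
        show "(fs 1 has_derivative (\<bullet>) (gradient E q x)) (at x within E)"
          using has_derivative_add[OF gq(2) has_derivative_norm_square[of x x E]] by (simp add: fs_def)
      qed
      then have "g = G \<beta>"
        unfolding ab(4) True by (simp add: sum1 t(2) G_def fs_def \<psi>_def flip: scaleR_add_left)
      then show ?thesis using props(3)[OF ab(1)] by (simp add: S_def True)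
    next
      case False
      then have "ereal (fs 1 p) \<noteq> f p" using fq[OF p] fs1[of p] by simp
      then have a1: "\<alpha> 1 = 0" using ab(2) by simp
      then have t0: "t = 0" by (simp add: t(2))
      obtain z where z: "z \<in> \<Gamma>" "\<forall>j\<in>{1..m}. z (en j) = \<beta> j" using props(4)[OF ab(1) a1] by blast
      have "\<forall>k\<in>K. \<phi> k p \<noteq> 0 \<longrightarrow> z k = 0"
        using ab(3) z(2) en by (auto simp: \<psi>_def bij_betw_def)
      moreover have "g = gradient E q p + (\<Sum>k\<in>K. z k *\<^sub>R gradient E (\<phi> k) p)"
        unfolding ab(4) using z(2) by (simp add: sum1 t(2) t0 fs_def reindex \<psi>_def)
      ultimately show ?thesis unfolding sub[OF p] using z(1) by blast
    qed
  qed
  have v: "\<forall>p\<in>M \<inter> ball x \<delta>. (\<exists>i\<le>1. f p = ereal (fs i p)) \<and>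
     (\<forall>g. g \<in> limiting_subdiff E f p \<longleftrightarrow> (\<exists>(\<alpha>, \<beta>)\<in>\<Delta>.
       (\<forall>i\<le>1. ereal (fs i p) \<noteq> f p \<longrightarrow> \<alpha> i = 0) \<and> (\<forall>j\<in>{1..m}. \<psi> j p \<noteq> 0 \<longrightarrow> \<beta> j = 0) \<and>
       g = (\<Sum>i\<le>1. \<alpha> i *\<^sub>R gradient E (fs i) p) + (\<Sum>j\<in>{1..m}. \<beta> j *\<^sub>R gradient E (\<psi> j) p)))"
    using v1 v2 by blast
  have cl\<Delta>: "closed \<Delta>" by (simp add: \<Delta>_def)
  have "PDG_data E f x M \<delta> 1 m fs \<psi> \<Delta>"
    unfolding PDG_data_def by (intro conjI C2fs C2\<psi> \<Delta>supp cl\<Delta> \<Delta>conv' i1 i2 ii iii iv v)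
  then have "\<exists>\<delta>>0. \<exists>m1 m2 fs \<phi> \<Delta>. PDG_data E f x M \<delta> m1 m2 fs \<phi> \<Delta>"
    using \<delta> by blast
  then show ?thesis
    unfolding PDG_iff_data using xE M f by (intro conjI ballI)
qed

subsection \<open>Fast tracks have a normal form\<close>

lemma bex_case_prod: "(\<exists>(\<alpha>, \<beta>)\<in>D. P \<alpha> \<beta>) \<longleftrightarrow> (\<exists>\<alpha> \<beta>. (\<alpha>, \<beta>) \<in> D \<and> P \<alpha> \<beta>)"
  by auto

lemma ball_case_prod: "(\<forall>(\<alpha>, \<beta>)\<in>D. P \<alpha> \<beta>) \<longleftrightarrow> (\<forall>\<alpha> \<beta>. (\<alpha>, \<beta>) \<in> D \<longrightarrow> P \<alpha> \<beta>)"
  by auto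

lemma PDG_dataD:
  assumes "PDG_data E f x M \<delta> m1 m2 fs \<phi> \<Delta>"
  shows "i \<le> m1 \<Longrightarrow> C2_on (E \<inter> ball x \<delta>) (fs i)"
    and "j \<in> {1..m2} \<Longrightarrow> C2_on (E \<inter> ball x \<delta>) (\<phi> j)"
    and "(\<alpha>, \<beta>) \<in> \<Delta> \<Longrightarrow> (\<forall>i. i > m1 \<longrightarrow> \<alpha> i = 0) \<and> (\<forall>j. j \<notin> {1..m2} \<longrightarrow> \<beta> j = 0)"
    and "closed \<Delta>"
    and "(\<alpha>, \<beta>) \<in> \<Delta> \<Longrightarrow> (\<alpha>', \<beta>') \<in> \<Delta> \<Longrightarrow> t \<in> {0..1} \<Longrightarrow>
       (\<lambda>i. (1 - t) * \<alpha> i + t * \<alpha>' i, \<lambda>j. (1 - t) * \<beta> j + t * \<beta>' j) \<in> \<Delta>"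
    and "i \<le> m1 \<Longrightarrow> ereal (fs i x) = f x"
    and "j \<in> {1..m2} \<Longrightarrow> \<phi> j x = 0"
    and "(\<alpha>, \<beta>) \<in> \<Delta> \<Longrightarrow> (\<forall>i\<le>m1. \<alpha> i \<ge> 0) \<and> (\<Sum>i\<le>m1. \<alpha> i) = 1"
    and "i \<le> m1 \<Longrightarrow> (\<lambda>k. if k = i then 1 else 0, \<lambda>j. 0) \<in> \<Delta>"
    and "j0 \<in> {1..m2} \<Longrightarrow> \<exists>\<alpha> \<beta>. (\<alpha>, \<beta>) \<in> \<Delta> \<and> \<beta> j0 \<noteq> 0 \<and> (\<forall>j. j \<noteq> j0 \<longrightarrow> \<beta> j = 0)"
    and "p \<in> M \<inter> ball x \<delta> \<Longrightarrow> \<exists>i\<le>m1. f p = ereal (fs i p)"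
    and "p \<in> M \<inter> ball x \<delta> \<Longrightarrow> g \<in> limiting_subdiff E f p \<longleftrightarrow>
        (\<exists>\<alpha> \<beta>. (\<alpha>, \<beta>) \<in> \<Delta> \<and>
           (\<forall>i\<le>m1. ereal (fs i p) \<noteq> f p \<longrightarrow> \<alpha> i = 0) \<and>
           (\<forall>j\<in>{1..m2}. \<phi> j p \<noteq> 0 \<longrightarrow> \<beta> j = 0) \<and>
           g = (\<Sum>i\<le>m1. \<alpha> i *\<^sub>R gradient E (fs i) p) + (\<Sum>j\<in>{1..m2}. \<beta> j *\<^sub>R gradient E (\<phi> j) p))"
proof -
  note D = assms[unfolded PDG_data_def ball_case_prod bex_case_prod mem_Collect_eq]
  note 1 = D[THEN conjunct1] and D1 = D[THEN conjunct2]
  note 2 = D1[THEN conjunct1] and D2 = D1[THEN conjunct2]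
  note 3 = D2[THEN conjunct1] and D3 = D2[THEN conjunct2]
  note 4 = D3[THEN conjunct1] and D4 = D3[THEN conjunct2]
  note 5 = D4[THEN conjunct1] and D5 = D4[THEN conjunct2]
  note 6 = D5[THEN conjunct1] and D6 = D5[THEN conjunct2]
  note D7 = D6[THEN conjunct2]
  note 8 = D7[THEN conjunct1] and D8 = D7[THEN conjunct2]
  note 9 = D8[THEN conjunct1] and D9 = D8[THEN conjunct2]
  note 10 = D9[THEN conjunct1] and 11 = D9[THEN conjunct2]
  show "i \<le> m1 \<Longrightarrow> C2_on (E \<inter> ball x \<delta>) (fs i)" using 1 by blast
  show "j \<in> {1..m2} \<Longrightarrow> C2_on (E \<inter> ball x \<delta>) (\<phi> j)" using 2 by blast
  show "(\<alpha>, \<beta>) \<in> \<Delta> \<Longrightarrow> (\<forall>i. i > m1 \<longrightarrow> \<alpha> i = 0) \<and> (\<forall>j. j \<notin> {1..m2} \<longrightarrow> \<beta> j = 0)" using 3 by blast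
  show "closed \<Delta>" by (rule 4)
  show "(\<alpha>, \<beta>) \<in> \<Delta> \<Longrightarrow> (\<alpha>', \<beta>') \<in> \<Delta> \<Longrightarrow> t \<in> {0..1} \<Longrightarrow>
       (\<lambda>i. (1 - t) * \<alpha> i + t * \<alpha>' i, \<lambda>j. (1 - t) * \<beta> j + t * \<beta>' j) \<in> \<Delta>" using 5 by blast
  show "i \<le> m1 \<Longrightarrow> ereal (fs i x) = f x" "j \<in> {1..m2} \<Longrightarrow> \<phi> j x = 0" using 6 by blast+
  show "(\<alpha>, \<beta>) \<in> \<Delta> \<Longrightarrow> (\<forall>i\<le>m1. \<alpha> i \<ge> 0) \<and> (\<Sum>i\<le>m1. \<alpha> i) = 1" using 8 by blast
  show "i \<le> m1 \<Longrightarrow> (\<lambda>k. if k = i then 1 else 0, \<lambda>j. 0) \<in> \<Delta>" using 9 by blast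
  show "j0 \<in> {1..m2} \<Longrightarrow> \<exists>\<alpha> \<beta>. (\<alpha>, \<beta>) \<in> \<Delta> \<and> \<beta> j0 \<noteq> 0 \<and> (\<forall>j. j \<noteq> j0 \<longrightarrow> \<beta> j = 0)" using 10 by blast
  assume p: "p \<in> M \<inter> ball x \<delta>"
  show "\<exists>i\<le>m1. f p = ereal (fs i p)" using 11[rule_format, OF p] by (rule conjunct1)
  show "g \<in> limiting_subdiff E f p \<longleftrightarrow>
        (\<exists>\<alpha> \<beta>. (\<alpha>, \<beta>) \<in> \<Delta> \<and>
           (\<forall>i\<le>m1. ereal (fs i p) \<noteq> f p \<longrightarrow> \<alpha> i = 0) \<and>
           (\<forall>j\<in>{1..m2}. \<phi> j p \<noteq> 0 \<longrightarrow> \<beta> j = 0) \<and>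
           g = (\<Sum>i\<le>m1. \<alpha> i *\<^sub>R gradient E (fs i) p) + (\<Sum>j\<in>{1..m2}. \<beta> j *\<^sub>R gradient E (\<phi> j) p))"
    using bspec[OF 11 p, THEN conjunct2, THEN spec, of g] .
qed

context
  fixes E :: "'a::euclidean_space set" and f :: "'a \<Rightarrow> ereal" and x :: 'a and v :: "'a \<Rightarrow> 'a"
  assumes E: "subspace E" and ft: "fast_track E f x v"
begin

text \<open>At \<open>x\<close> every structure function is active, so the subdifferential is the
  image of all of \<open>\<Delta>\<close> under a linear map: convex, and nonempty by (iii). Such a
  set has relative interior points.\<close>

lemma fast_track_subdiff_nonempty: "rel_interior (limiting_subdiff E f x) \<noteq> {}"
proof -
  have "PDG E f x (track_manifold E f x v)" using ft by (simp add: fast_track_def)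
  then obtain \<delta> m1 m2 fs \<phi> \<Delta> where \<delta>: "\<delta> > 0"
      and D: "PDG_data E f x (track_manifold E f x v) \<delta> m1 m2 fs \<phi> \<Delta>"
    unfolding PDG_iff_data by blast
  have xM: "x \<in> track_manifold E f x v" using ft by (auto simp: fast_track_def C2_manifold_about_def)
  note conv = PDG_dataD(5)[OF D] and act = PDG_dataD(6,7)[OF D] and unit = PDG_dataD(9)[OF D]
    and sub = PDG_dataD(12)[OF D]
  have xb: "x \<in> track_manifold E f x v \<inter> ball x \<delta>" using xM \<delta> by simp
  define G where "G = (\<lambda>(\<alpha>, \<beta>). (\<Sum>i\<le>m1. \<alpha> i *\<^sub>R gradient E (fs i) x) + (\<Sum>j\<in>{1..m2}. \<beta> j *\<^sub>R gradient E (\<phi> j) x))"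
  have S: "limiting_subdiff E f x = G ` \<Delta>"
    using sub[OF xb] act by (auto simp: G_def image_iff Bex_def)
  have "convex (G ` \<Delta>)"
    unfolding convex_alt
  proof clarify
    fix \<alpha> \<beta> \<alpha>' \<beta>' and t :: real assume ab: "(\<alpha>, \<beta>) \<in> \<Delta>" "(\<alpha>', \<beta>') \<in> \<Delta>" and t: "0 \<le> t" "t \<le> 1"
    have "(1 - t) *\<^sub>R G (\<alpha>, \<beta>) + t *\<^sub>R G (\<alpha>', \<beta>') = G (\<lambda>i. (1 - t) * \<alpha> i + t * \<alpha>' i, \<lambda>j. (1 - t) * \<beta> j + t * \<beta>' j)"
      by (simp add: G_def algebra_simps sum.distrib sum_subtractf scaleR_sum_right)
    moreover have "(\<lambda>i. (1 - t) * \<alpha> i + t * \<alpha>' i, \<lambda>j. (1 - t) * \<beta> j + t * \<beta>' j) \<in> \<Delta>"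
      using t by (intro conv ab) simp
    ultimately show "(1 - t) *\<^sub>R G (\<alpha>, \<beta>) + t *\<^sub>R G (\<alpha>', \<beta>') \<in> G ` \<Delta>" by simp
  qed
  moreover have "G ` \<Delta> \<noteq> {}" using unit[of 0] by blast
  ultimately show ?thesis unfolding S by (simp add: rel_interior_eq_empty)
qed

lemmas U_space_ft = U_space_eq[OF E fast_track_subdiff_nonempty]
lemmas V_space_ft = V_space_eq[OF fast_track_subdiff_nonempty]

lemma fast_track_near:
  assumes "g \<in> rel_interior (limiting_subdiff E f x)"
  shows "\<exists>\<epsilon>>0. C2_on (U_space E f x \<inter> ball 0 \<epsilon>) v \<and>
        (\<forall>u \<in> U_space E f x \<inter> ball 0 \<epsilon>. v u \<in> U_argmin E f x g u) \<and>
        (\<forall>u \<in> U_space E f x \<inter> ball 0 \<epsilon>. \<bar>U_Lagrangian E f x g u\<bar> \<noteq> \<infinity>) \<and>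
        C2_on (U_space E f x \<inter> ball 0 \<epsilon>) (\<lambda>u. real_of_ereal (U_Lagrangian E f x g u))"
  using ft[unfolded fast_track_def, THEN conjunct2, THEN conjunct2, THEN conjunct2] assms by (rule bspec)

lemma x_in_E: "x \<in> E"
  using ft by (simp add: fast_track_def PDG_def)

text \<open>The last clause holds because the gradient at \<open>x\<close> is the chosen
  \<open>g\<close> itself. It later leaves room for small multiples of the gradients of the
  functions \<phi>_j.\<close>

lemma smooth_minorant:
  "\<exists>\<delta> q. \<delta> > 0 \<and> C2_on (E \<inter> ball x \<delta>) q \<and>
    (\<forall>p\<in>track_manifold E f x v \<inter> ball x \<delta>. f p = ereal (q p)) \<and>
    (\<forall>p\<in>track_manifold E f x v \<inter> ball x \<delta>. gradient E q p \<in> limiting_subdiff E f p) \<and>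
    gradient E q x \<in> rel_interior (limiting_subdiff E f x)"
proof -
  let ?S' = "limiting_subdiff E f" and ?S = "limiting_subdiff E f x" and ?U = "U_space E f x" and ?V = "V_space E f x"
  let ?M = "track_manifold E f x v"
  obtain g where g: "g \<in> rel_interior ?S" using fast_track_subdiff_nonempty by blast
  obtain \<epsilon> where \<epsilon>0: "\<epsilon> > 0" "C2_on (?U \<inter> ball 0 \<epsilon>) v" "\<forall>u\<in>?U \<inter> ball 0 \<epsilon>. v u \<in> U_argmin E f x g u"
    "\<forall>u\<in>?U \<inter> ball 0 \<epsilon>. \<bar>U_Lagrangian E f x g u\<bar> \<noteq> \<infinity>"
    "C2_on (?U \<inter> ball 0 \<epsilon>) (\<lambda>u. real_of_ereal (U_Lagrangian E f x g u))"
    using fast_track_near[OF g] by (elim exE conjE) (rule that)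
  note \<epsilon> = \<epsilon>0(1) bspec[OF \<epsilon>0(3)] bspec[OF \<epsilon>0(4)] \<epsilon>0(5)
  obtain P where P: "bounded_linear P" "\<And>y. P y \<in> ?V" "\<And>y. y \<in> ?V \<Longrightarrow> P y = y" "\<And>y w. w \<in> ?V \<Longrightarrow> (y - P y) \<bullet> w = 0"
    using subspace_projection[OF subspace_V_space[of E f x]] by metis
  have VE: "?V \<subseteq> E" by (rule V_space_subset[OF E fast_track_subdiff_nonempty])
  define R where "R y = y - P y" for y
  have R: "bounded_linear R" unfolding R_def using P(1) by (intro bounded_linear_sub bounded_linear_ident)
  have RU: "R y \<in> ?U" if "y \<in> E" for y
    unfolding U_space_ft R_def using subspace_diff[OF E that subsetD[OF VE P(2)]] P(4) by simp
  \<comment> \<open>The part in \<open>U\<close> is no longer than the displacement, so the ball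
    about \<open>x\<close> is mapped into the ball on which the Lagrangian is smooth.\<close>
  have norm_R: "norm (R y) \<le> norm y" for y
  proof -
    have "(norm y)\<^sup>2 = (norm (R y + P y))\<^sup>2" by (simp add: R_def)
    also have "\<dots> = (norm (R y))\<^sup>2 + (norm (P y))\<^sup>2"
      by (rule norm_add_Pythagorean) (simp only: orthogonal_def R_def P(4)[OF P(2)])
    finally have "(norm (R y))\<^sup>2 \<le> (norm y)\<^sup>2" by simp
    then show ?thesis by (rule power2_le_imp_le) simp
  qed
  define q where "q y = real_of_ereal (U_Lagrangian E f x g (R (y - x))) + g \<bullet> P (y - x)" for y
  have RxU: "R (y - x) \<in> ?U \<inter> ball 0 \<epsilon>" if "y \<in> E \<inter> ball x \<epsilon>" for y
  proof -
    have "y - x \<in> E" using that x_in_E E by (simp add: subspace_diff)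
    moreover have "norm (y - x) < \<epsilon>" using that by (simp add: dist_norm norm_minus_commute)
    ultimately show ?thesis using RU[of "y - x"] norm_R[of "y - x"] by simp
  qed
  have C2q: "C2_on (E \<inter> ball x \<epsilon>) q"
  proof -
    have aff: "R y + R (- x) = R (y - x)" "P y + P (- x) = P (y - x)" for y
      using linear_add[OF bounded_linear.linear[OF R], of y "- x"] linear_add[OF bounded_linear.linear[OF P(1)], of y "- x"]
      by simp_all
    have "C2_on (E \<inter> ball x \<epsilon>) (\<lambda>y. real_of_ereal (U_Lagrangian E f x g (R y + R (- x))))"
      by (rule C2_on_compose_affine[OF R \<epsilon>(4)]) (simp only: aff RxU)
    moreover have "C2_on (E \<inter> ball x \<epsilon>) (\<lambda>y. g \<bullet> (P y + P (- x)))"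
      by (rule C2_on_compose_affine[OF P(1), of UNIV "\<lambda>z. g \<bullet> z"])
        (auto intro: C2_on_linear bounded_linear_inner_right)
    ultimately show ?thesis unfolding q_def using C2_on_add by (simp only: aff) blast
  qed
  \<comment> \<open>The projection of \<open>y - x\<close> to \<open>V\<close> is one competitor in
    the infimum.\<close>
  have qle: "ereal (q y) \<le> f y" if y: "y \<in> E \<inter> ball x \<epsilon>" for y
  proof -
    have "U_Lagrangian E f x g (R (y - x)) \<le> f (x + R (y - x) + P (y - x)) - ereal (g \<bullet> P (y - x))"
      unfolding U_Lagrangian_def by (rule INF_lower[OF P(2)])
    moreover have "x + R (y - x) + P (y - x) = y" by (simp add: R_def)
    ultimately have "U_Lagrangian E f x g (R (y - x)) \<le> f y - ereal (g \<bullet> P (y - x))" by simp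
    then show ?thesis using \<epsilon>(3)[OF RxU[OF y]]
      unfolding q_def by (cases "U_Lagrangian E f x g (R (y - x))"; cases "f y") auto
  qed
  have qeq: "f p = ereal (q p)" if p: "p \<in> ?M \<inter> ball x \<epsilon>" for p
  proof -
    obtain u where u: "u \<in> ?U" "p = x + (u + v u)" using p by (auto simp: track_manifold_def)
    have vV: "v u \<in> ?V" using ft u(1) by (auto simp: fast_track_def)
    \<comment> \<open>\<open>u\<close> is orthogonal to \<open>V\<close>, so the projection
      annihilates it; hence \<open>p - x\<close> has the parts \<open>u\<close> and
      \<open>v u\<close>.\<close>
    have "P u \<bullet> P u = 0"
      using P(4)[OF P(2), of u u] u(1) P(2)[of u] by (simp add: U_space_ft inner_diff_left)
    then have Pp: "P (p - x) = v u"
      using P(3)[OF vV] linear_add[OF bounded_linear.linear[OF P(1)], of u "v u"] by (simp add: u(2))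
    have Rp: "R (p - x) = u" by (simp add: R_def Pp) (simp add: u(2))
    have "p \<in> E" using u vV VE x_in_E E by (auto simp: U_space_ft intro!: subspace_add)
    then have ub: "u \<in> ?U \<inter> ball 0 \<epsilon>" using RxU[of p] p by (simp add: Rp)
    have "f (x + u + v u) - ereal (g \<bullet> v u) = U_Lagrangian E f x g u"
      using \<epsilon>(2)[OF ub] by (simp add: U_argmin_def)
    then have "f p - ereal (g \<bullet> v u) = U_Lagrangian E f x g u" by (simp add: u(2) add.assoc)
    then show ?thesis using \<epsilon>(3)[OF ub]
      unfolding q_def Rp Pp by (cases "U_Lagrangian E f x g u"; cases "f p") auto
  qed
  have ME: "?M \<subseteq> E" using ft by (simp add: fast_track_def PDG_def)
  \<comment> \<open>A differentiable minorant that touches \<open>f\<close> at \<open>p\<close> has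
    a regular subgradient of \<open>f\<close> as its gradient there.\<close>
  have grad: "gradient E q p \<in> regular_subdiff E f p" if p: "p \<in> ?M \<inter> ball x \<epsilon>" for p
  proof -
    have pE: "p \<in> E" using p ME by blast
    obtain D where D: "(q has_derivative D) (at p within E)"
      using C2_on_ball_differentiable[OF C2q pE] p by blast
    note gq = gradient_works[OF E pE D]
    have "\<exists>d>0. \<forall>y\<in>E. norm (y - p) < d \<longrightarrow> f p + ereal (gradient E q p \<bullet> (y - p) - e * norm (y - p)) \<le> f y"
      if e: "e > 0" for e
    proof -
      obtain d where d: "d > 0" "\<And>y. y \<in> E \<Longrightarrow> norm (y - p) < d \<Longrightarrow>
          norm (q y - q p - gradient E q p \<bullet> (y - p)) \<le> e * norm (y - p)"
        using gq(2) e unfolding has_derivative_within_alt by blast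
      obtain r where r: "r > 0" "ball p r \<subseteq> ball x \<epsilon>"
        using p openE[OF open_ball, of p x \<epsilon>] by blast
      have "f p + ereal (gradient E q p \<bullet> (y - p) - e * norm (y - p)) \<le> f y"
        if y: "y \<in> E" "norm (y - p) < min d r" for y
      proof -
        have "norm (q y - q p - gradient E q p \<bullet> (y - p)) \<le> e * norm (y - p)" using d(2) y by simp
        then have "q p + (gradient E q p \<bullet> (y - p) - e * norm (y - p)) \<le> q y" by (simp add: abs_le_iff)
        then have "f p + ereal (gradient E q p \<bullet> (y - p) - e * norm (y - p)) \<le> ereal (q y)" by (simp add: qeq[OF p])
        also have "\<dots> \<le> f y"
          using y r(2) by (intro qle) (auto simp: dist_norm norm_minus_commute)
        finally show ?thesis .
      qed
      then show ?thesis using d(1) r(1) by (intro exI[of _ "min d r"]) auto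
    qed
    then show ?thesis using gq(1) pE qeq[OF p] unfolding regular_subdiff_iff by simp
  qed
  have xM: "x \<in> ?M \<inter> ball x \<epsilon>"
    using ft \<epsilon>(1) by (auto simp: fast_track_def C2_manifold_about_def)
  have gradS: "gradient E q x \<in> ?S"
    using grad[OF xM] regular_subset_limiting by blast
  \<comment> \<open>Both vectors are subgradients, so their difference lies in \<open>V\<close>. On
    lines through \<open>x\<close> in directions of \<open>V\<close> the Lagrangian part of
    \<open>q\<close> is constant and \<open>q\<close> has slope given by \<open>g\<close>. So the
    difference is orthogonal to \<open>V\<close>, hence to itself.\<close>
  have "gradient E q x = g"
  proof -
    obtain D where D: "(q has_derivative D) (at x within E)"
      using C2_on_ball_differentiable[OF C2q x_in_E] \<epsilon>(1) by auto
    have gS: "g \<in> ?S" using g by (simp add: rel_interior_iff)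
    have dV: "gradient E q x - g \<in> ?V" unfolding V_space_ft using gradS gS by (rule diff_in_diff_span)
    have "gradient E q x \<bullet> w = g \<bullet> w" if w: "w \<in> ?V" for w
    proof -
      have im: "(\<lambda>t. x + t *\<^sub>R w) ` UNIV \<subseteq> E"
        using w VE x_in_E E by (auto intro!: subspace_add subspace_scale)
      have "((\<lambda>t. x + t *\<^sub>R w) has_derivative (\<lambda>t. t *\<^sub>R w)) (at 0)"
        by (auto intro!: derivative_eq_intros)
      then have "((\<lambda>t. q (x + t *\<^sub>R w)) has_derivative (\<lambda>t. gradient E q x \<bullet> (t *\<^sub>R w))) (at 0)"
      proof (rule has_derivative_in_compose)
        show "(q has_derivative (\<bullet>) (gradient E q x)) (at (x + 0 *\<^sub>R w) within range (\<lambda>t. x + t *\<^sub>R w))"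
          using has_derivative_subset[OF gradient_works(2)[OF E x_in_E D] im] by simp
      qed
      moreover have "q (x + t *\<^sub>R w) = q x + t * (g \<bullet> w)" for t
      proof -
        have tw: "t *\<^sub>R w \<in> ?V" using w by (rule subspace_scale[OF subspace_V_space])
        have "P 0 = 0" "R 0 = 0" using P(1) R by (auto simp: linear_simps)
        then show ?thesis using P(3)[OF tw] by (simp add: q_def R_def)
      qed
      moreover have "((\<lambda>t. q x + t * (g \<bullet> w)) has_derivative (\<lambda>t. t * (g \<bullet> w))) (at 0)"
        by (auto intro!: derivative_eq_intros)
      ultimately have "(\<lambda>t. gradient E q x \<bullet> (t *\<^sub>R w)) = (\<lambda>t. t * (g \<bullet> w))"
        using has_derivative_unique by simp blast
      from fun_cong[OF this, of 1] show ?thesis by simp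
    qed
    from this[OF dV] have "(gradient E q x - g) \<bullet> (gradient E q x - g) = 0"
      by (simp add: inner_diff_left)
    then show ?thesis by simp
  qed
  with g have "gradient E q x \<in> rel_interior ?S" by simp
  moreover have "gradient E q p \<in> ?S' p" if "p \<in> ?M \<inter> ball x \<epsilon>" for p
    using grad[OF that] regular_subset_limiting by blast
  ultimately show ?thesis
    using \<epsilon>(1) C2q qeq by (intro exI[of _ \<epsilon>] exI[of _ q] conjI ballI)
qed

text \<open>Every vector of \<open>\<Delta>\<close> is read as one vector on \<open>K\<close>, all
  of whose entries are coefficients of functions vanishing at \<open>x\<close>. Convexity and
  closedness of the subdifferentials along the track ensure that the enlarged set
  \<open>\<Gamma>\<close> yields no new vectors there.\<close>

lemma normal_form_of_fast_track:
  "\<exists>\<delta> (K :: nat set) q \<phi> \<Gamma>. normal_form E f x (track_manifold E f x v) \<delta> K q \<phi> \<Gamma>"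
proof -
  let ?M = "track_manifold E f x v" and ?S = "limiting_subdiff E f"
  have pdg: "PDG E f x ?M" using ft by (simp add: fast_track_def)
  then have xE: "x \<in> E" and ME: "?M \<subseteq> E" by (auto simp: PDG_def)
  obtain \<delta>1 m1 m2 fs \<phi> \<Delta> where \<delta>1: "\<delta>1 > 0" and D: "PDG_data E f x ?M \<delta>1 m1 m2 fs \<phi> \<Delta>"
    using pdg unfolding PDG_iff_data by blast
  have xM: "x \<in> ?M" using ft by (auto simp: fast_track_def C2_manifold_about_def)
  note fs = PDG_dataD(1)[OF D] and \<phi> = PDG_dataD(2)[OF D] and supp = PDG_dataD(3)[OF D] and cl = PDG_dataD(4)[OF D]
    and conv = PDG_dataD(5)[OF D] and act = PDG_dataD(6,7)[OF D] and simplex = PDG_dataD(8)[OF D]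
    and unit = PDG_dataD(9)[OF D] and ax = PDG_dataD(10)[OF D] and some_act = PDG_dataD(11)[OF D]
    and sub = PDG_dataD(12)[OF D]
  obtain \<delta>2 q where \<delta>2: "\<delta>2 > 0" and q2: "C2_on (E \<inter> ball x \<delta>2) q"
    and fq: "\<forall>p\<in>?M \<inter> ball x \<delta>2. f p = ereal (q p)"
    and gq: "\<forall>p\<in>?M \<inter> ball x \<delta>2. gradient E q p \<in> ?S p"
    and ri: "gradient E q x \<in> rel_interior (?S x)"
    using smooth_minorant by (elim exE conjE) (rule that)
  note fq2 = bspec[OF fq] and gq2 = bspec[OF gq]
  define \<delta> where "\<delta> = min \<delta>1 \<delta>2"
  have \<delta>: "\<delta> > 0" using \<delta>1 \<delta>2 by (simp add: \<delta>_def)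
  have b1: "p \<in> ?M \<inter> ball x \<delta>1" and b2: "p \<in> ?M \<inter> ball x \<delta>2" if "p \<in> ?M \<inter> ball x \<delta>" for p
    using that by (auto simp: \<delta>_def)
  have xb: "x \<in> ?M \<inter> ball x \<delta>" using xM \<delta> by simp
  have C2fs: "C2_on (E \<inter> ball x \<delta>) (fs i)" if "i \<le> m1" for i
    by (rule C2_on_subset[OF fs[OF that]]) (auto simp: \<delta>_def)
  have C2\<phi>: "C2_on (E \<inter> ball x \<delta>) (\<phi> j)" if "j \<in> {1..m2}" for j
    by (rule C2_on_subset[OF \<phi>[OF that]]) (auto simp: \<delta>_def)
  have C2q: "C2_on (E \<inter> ball x \<delta>) q"
    by (rule C2_on_subset[OF q2]) (auto simp: \<delta>_def)
  \<comment> \<open>Indices up to \<open>m1\<close> stand for the differences of \<open>fs i\<close>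
    and \<open>q\<close>. The index of \<open>\<phi> j\<close> is \<open>m1 + j\<close>; as
    \<open>j\<close> starts at 1, no index is used twice.\<close>
  define K where "K = {..m1 + m2}"
  define \<psi> where "\<psi> k = (if k \<le> m1 then (\<lambda>y. fs k y - q y) else \<phi> (k - m1))" for k
  \<comment> \<open>Undoes this encoding; the value 0 outside the two ranges matches the support
    condition on \<open>\<Delta>\<close>.\<close>
  define split :: "(nat \<Rightarrow> real) \<Rightarrow> (nat \<Rightarrow> real) \<times> (nat \<Rightarrow> real)" where
    "split z = (\<lambda>i. if i \<le> m1 then z i else 0, \<lambda>j. if j \<in> {1..m2} then z (m1 + j) else 0)" for z
  \<comment> \<open>The total weight of the demoted \<open>fs i\<close>, which is 1 for vectors that
    come from \<open>\<Delta>\<close>.\<close>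
  define \<tau> :: "(nat \<Rightarrow> real) \<Rightarrow> real" where "\<tau> z = (\<Sum>i\<le>m1. z i)" for z
  define \<Delta>0 where "\<Delta>0 = {z. (\<forall>k. k \<notin> K \<longrightarrow> z k = 0) \<and> split z \<in> \<Delta>}"
  \<comment> \<open>This is the closure of \<open>{t z | t z. t \<in> {0..1} \<and> z \<in> \<Delta>0}\<close>, in a form that is evidently closed and convex.\<close>
  define \<Gamma> where "\<Gamma> = {w. (\<forall>k. k \<notin> K \<longrightarrow> w k = 0) \<and> \<tau> w \<in> {0..1} \<and>
      (\<forall>z\<in>\<Delta>0. (\<lambda>k. (1 - \<tau> w) * z k + w k) \<in> \<Delta>0)}"
  have K_split: "(\<Sum>k\<in>K. F k) = (\<Sum>i\<le>m1. F i) + (\<Sum>j\<in>{1..m2}. F (m1 + j))" for F :: "nat \<Rightarrow> 'b::comm_monoid_add"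
  proof -
    have "K = {..m1} \<union> (\<lambda>j. m1 + j) ` {1..m2}"
      unfolding K_def
    proof (rule set_eqI)
      fix k show "k \<in> {..m1 + m2} \<longleftrightarrow> k \<in> {..m1} \<union> (\<lambda>j. m1 + j) ` {1..m2}"
        by (cases "k \<le> m1") (auto simp: image_iff intro!: bexI[of _ "k - m1"])
    qed
    then have "(\<Sum>k\<in>K. F k) = (\<Sum>i\<le>m1. F i) + sum F ((\<lambda>j. m1 + j) ` {1..m2})"
      by (simp add: sum.union_disjoint disjoint_iff image_iff)
    moreover have "sum F ((\<lambda>j. m1 + j) ` {1..m2}) = (\<Sum>j\<in>{1..m2}. F (m1 + j))"
      by (subst sum.reindex) (auto simp: inj_on_def)
    ultimately show ?thesis by (simp only:)
  qed
  have K_cases: "P k" if "k \<in> K" "\<And>i. i \<le> m1 \<Longrightarrow> P i" "\<And>j. j \<in> {1..m2} \<Longrightarrow> P (m1 + j)" for P and k :: nat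
  proof (cases "k \<le> m1")
    case False
    then have "k - m1 \<in> {1..m2}" and eq: "m1 + (k - m1) = k"
      using \<open>k \<in> K\<close> unfolding K_def atMost_iff atLeastAtMost_iff by linarith+
    from that(3)[OF this(1)] show ?thesis unfolding eq .
  qed (rule that(2))
  have \<tau>\<Delta>0: "\<tau> z = 1" if "z \<in> \<Delta>0" for z
    using that simplex[of "fst (split z)" "snd (split z)"] by (simp add: \<Delta>0_def \<tau>_def split_def)

  have \<Delta>0conv: "(\<lambda>k. (1 - t) * z k + t * w k) \<in> \<Delta>0" if "z \<in> \<Delta>0" "w \<in> \<Delta>0" "t \<in> {0..1}" for z w t
  proof -
    have "split (\<lambda>k. (1 - t) * z k + t * w k) =
        (\<lambda>i. (1 - t) * fst (split z) i + t * fst (split w) i, \<lambda>j. (1 - t) * snd (split z) j + t * snd (split w) j)"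
      by (auto simp: split_def)
    moreover have "\<dots> \<in> \<Delta>"
      using that by (intro conv) (auto simp: \<Delta>0_def)
    ultimately show ?thesis using that by (simp add: \<Delta>0_def)
  qed
  have cont_if: "continuous_on UNIV (\<lambda>z. if b then F z else 0)" if "continuous_on UNIV F"
    for b and F :: "(nat \<Rightarrow> real) \<Rightarrow> real"
    using that by (cases b) simp_all
  have split_cont: "continuous_on UNIV split"
    unfolding split_def
    by (intro continuous_on_Pair continuous_on_coordinatewise_then_product cont_if continuous_on_product_coordinates)
  have closed_supp: "closed {z. \<forall>k. k \<notin> K \<longrightarrow> z k = (0::real)}"
    by (intro closed_Collect_all closed_Collect_imp closed_Collect_eq continuous_on_product_coordinates continuous_on_const) auto
  have cl0: "closed \<Delta>0"
  proof -
    have "closed ({z. \<forall>k. k \<notin> K \<longrightarrow> z k = 0} \<inter> split -` \<Delta>)"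
      using closed_supp closed_vimage[OF cl split_cont] by blast
    moreover have "{z. \<forall>k. k \<notin> K \<longrightarrow> z k = 0} \<inter> split -` \<Delta> = \<Delta>0" by (auto simp: \<Delta>0_def)
    ultimately show ?thesis by simp
  qed
  have \<tau>_cont: "continuous_on UNIV \<tau>"
    unfolding \<tau>_def by (intro continuous_on_sum continuous_on_product_coordinates)
  have cl\<Gamma>: "closed \<Gamma>"
  proof -
    have "closed ((\<lambda>w k. (1 - \<tau> w) * z k + w k) -` \<Delta>0)" for z :: "nat \<Rightarrow> real"
      by (intro closed_vimage[OF cl0] continuous_on_coordinatewise_then_product continuous_intros
          \<tau>_cont continuous_on_product_coordinates)
    moreover have "closed (\<tau> -` {0..1})" by (intro closed_vimage[OF _ \<tau>_cont]) simp
    ultimately have "closed ({w. \<forall>k. k \<notin> K \<longrightarrow> w k = 0} \<inter> \<tau> -` {0..1} \<inter>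
        (\<Inter>z\<in>\<Delta>0. (\<lambda>w k. (1 - \<tau> w) * z k + w k) -` \<Delta>0))"
      using closed_supp by (intro closed_Int closed_INT) auto
    moreover have "{w. \<forall>k. k \<notin> K \<longrightarrow> w k = 0} \<inter> \<tau> -` {0..1} \<inter>
        (\<Inter>z\<in>\<Delta>0. (\<lambda>w k. (1 - \<tau> w) * z k + w k) -` \<Delta>0) = \<Gamma>" by (auto simp: \<Gamma>_def)
    ultimately show ?thesis by simp
  qed
  have conv\<Gamma>: "(\<lambda>k. (1 - t) * w k + t * w' k) \<in> \<Gamma>" if w: "w \<in> \<Gamma>" "w' \<in> \<Gamma>" and t: "t \<in> {0..1}" for w w' t
  proof -
    define W where "W k = (1 - t) * w k + t * w' k" for k
    have \<tau>W: "\<tau> W = (1 - t) * \<tau> w + t * \<tau> w'"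
      by (simp add: \<tau>_def W_def sum.distrib sum_distrib_left)
    have "\<tau> W \<in> {0..1}"
      unfolding \<tau>W using w t convex_bound_le[of "\<tau> w" 1 "\<tau> w'" "1 - t" t] by (auto simp: \<Gamma>_def)
    moreover have "(\<lambda>k. (1 - \<tau> W) * z k + W k) \<in> \<Delta>0" if z: "z \<in> \<Delta>0" for z
    proof -
      \<comment> \<open>For fixed \<open>z\<close>, the vector
        \<open>(1 - \<tau> w) * z k + w k\<close> depends affinely on \<open>w\<close>, because
        \<open>\<tau>\<close> is linear.\<close>
      have "(\<lambda>k. (1 - \<tau> W) * z k + W k) =
          (\<lambda>k. (1 - t) * ((1 - \<tau> w) * z k + w k) + t * ((1 - \<tau> w') * z k + w' k))"
        by (auto simp: \<tau>W W_def algebra_simps)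
      also have "\<dots> \<in> \<Delta>0" using w z t by (intro \<Delta>0conv) (auto simp: \<Gamma>_def)
      finally show ?thesis .
    qed
    moreover have "\<forall>k. k \<notin> K \<longrightarrow> W k = 0" using w by (simp add: W_def \<Gamma>_def)
    ultimately have "W \<in> \<Gamma>" by (simp add: \<Gamma>_def)
    then show ?thesis unfolding W_def .
  qed
  have zero\<Gamma>: "(\<lambda>k. 0) \<in> \<Gamma>" by (simp add: \<Gamma>_def \<tau>_def)
  \<comment> \<open>With total weight 1 the defining condition of \<open>\<Gamma>\<close> reduces to
    membership in \<open>\<Delta>0\<close>.\<close>
  have \<Delta>0\<Gamma>: "z \<in> \<Gamma>" if "z \<in> \<Delta>0" for z
    using that \<tau>\<Delta>0[OF that] by (simp add: \<Gamma>_def) (simp add: \<Delta>0_def)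
  have join: "\<exists>z\<in>\<Delta>0. (\<forall>i\<le>m1. z i = \<alpha> i) \<and> (\<forall>j\<in>{1..m2}. z (m1 + j) = \<beta> j)" if ab: "(\<alpha>, \<beta>) \<in> \<Delta>" for \<alpha> \<beta>
  proof -
    define z where "z k = (if k \<le> m1 then \<alpha> k else \<beta> (k - m1))" for k
    have "split z = (\<alpha>, \<beta>)"
      using supp[OF ab] by (auto simp: split_def z_def not_le)
    moreover have "z k = 0" if "k \<notin> K" for k
    proof -
      have "\<not> k \<le> m1" "k - m1 \<notin> {1..m2}" using that by (auto simp: K_def)
      then show ?thesis using supp[OF ab] by (simp add: z_def del: atLeastAtMost_iff)
    qed
    ultimately have "z \<in> \<Delta>0" using ab by (simp add: \<Delta>0_def)
    then show ?thesis by (intro bexI[of _ z]) (auto simp: z_def)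
  qed
  define Act where "Act p z \<longleftrightarrow> (\<forall>k\<in>K. \<psi> k p \<noteq> 0 \<longrightarrow> z k = 0)" for p and z :: "nat \<Rightarrow> real"
  define L where "L p z = (\<Sum>k\<in>K. z k *\<^sub>R gradient E (\<psi> k) p)" for p and z :: "nat \<Rightarrow> real"
  have Llin: "L p (\<lambda>k. a * z k + b * w k) = a *\<^sub>R L p z + b *\<^sub>R L p w" for p a b z w
    by (simp add: L_def scaleR_add_left sum.distrib scaleR_sum_right)
  have \<psi>lo: "\<psi> i = (\<lambda>y. fs i y - q y)" if "i \<le> m1" for i using that by (simp add: \<psi>_def)
  have \<psi>hi: "\<psi> (m1 + j) = \<phi> j" if "j \<in> {1..m2}" for j using that by (simp add: \<psi>_def)
  have gr\<psi>: "gradient E (\<psi> i) p = gradient E (fs i) p - gradient E q p" if i: "i \<le> m1" and p: "p \<in> E \<inter> ball x \<delta>" for i p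
  proof -
    have pE: "p \<in> E" using p by blast
    obtain D1 where D1: "(fs i has_derivative D1) (at p within E)"
      using C2_on_ball_differentiable[OF C2fs[OF i] pE] p by blast
    obtain D2 where D2: "(q has_derivative D2) (at p within E)"
      using C2_on_ball_differentiable[OF C2q pE] p by blast
    note g1 = gradient_works[OF E pE D1] and g2 = gradient_works[OF E pE D2]
    show ?thesis unfolding \<psi>lo[OF i]
    proof (rule gradient_eqI[OF E pE])
      show "gradient E (fs i) p - gradient E q p \<in> E" using g1(1) g2(1) E by (simp add: subspace_diff)
      have "(\<bullet>) (gradient E (fs i) p - gradient E q p) = (\<lambda>d. gradient E (fs i) p \<bullet> d - gradient E q p \<bullet> d)"
        by (simp add: fun_eq_iff inner_diff_left)
      then show "((\<lambda>y. fs i y - q y) has_derivative (\<bullet>) (gradient E (fs i) p - gradient E q p)) (at p within E)"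
        using has_derivative_diff[OF g1(2) g2(2)] by simp
    qed
  qed
  have L\<Delta>0: "gradient E q p + L p z =
      (\<Sum>i\<le>m1. z i *\<^sub>R gradient E (fs i) p) + (\<Sum>j\<in>{1..m2}. z (m1 + j) *\<^sub>R gradient E (\<phi> j) p)"
    if "z \<in> \<Delta>0" "p \<in> E \<inter> ball x \<delta>" for z p
  proof -
    have "(\<Sum>i\<le>m1. z i *\<^sub>R gradient E (\<psi> i) p) =
        (\<Sum>i\<le>m1. z i *\<^sub>R gradient E (fs i) p - z i *\<^sub>R gradient E q p)"
      using gr\<psi> that(2) by (intro sum.cong refl) (simp add: scaleR_diff_right)
    also have "\<dots> = (\<Sum>i\<le>m1. z i *\<^sub>R gradient E (fs i) p) - \<tau> z *\<^sub>R gradient E q p"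
      by (simp add: sum_subtractf scaleR_sum_left \<tau>_def)
    finally show ?thesis
      using \<tau>\<Delta>0[OF that(1)] \<psi>hi by (simp add: L_def K_split)
  qed
  \<comment> \<open>On the track \<open>f\<close> equals \<open>q\<close>, so \<open>fs i\<close> is
    active exactly where its difference to \<open>q\<close> vanishes.\<close>
  have act_iff: "Act p z \<longleftrightarrow> (\<forall>i\<le>m1. ereal (fs i p) \<noteq> f p \<longrightarrow> z i = 0) \<and> (\<forall>j\<in>{1..m2}. \<phi> j p \<noteq> 0 \<longrightarrow> z (m1 + j) = 0)"
    if p: "p \<in> ?M \<inter> ball x \<delta>" for p z
  proof
    assume A: "Act p z"
    have "z i = 0" if "i \<le> m1" "ereal (fs i p) \<noteq> f p" for i
      using A that fq2[OF b2[OF p]] by (auto simp: Act_def K_def \<psi>_def)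
    moreover have "z (m1 + j) = 0" if "j \<in> {1..m2}" "\<phi> j p \<noteq> 0" for j
      using A that \<psi>hi[of j] by (auto simp: Act_def K_def)
    ultimately show "(\<forall>i\<le>m1. ereal (fs i p) \<noteq> f p \<longrightarrow> z i = 0) \<and> (\<forall>j\<in>{1..m2}. \<phi> j p \<noteq> 0 \<longrightarrow> z (m1 + j) = 0)"
      by blast
  next
    assume A: "(\<forall>i\<le>m1. ereal (fs i p) \<noteq> f p \<longrightarrow> z i = 0) \<and> (\<forall>j\<in>{1..m2}. \<phi> j p \<noteq> 0 \<longrightarrow> z (m1 + j) = 0)"
    show "Act p z"
      unfolding Act_def
    proof
      fix k assume "k \<in> K"
      then show "\<psi> k p \<noteq> 0 \<longrightarrow> z k = 0"
        by (rule K_cases) (use A fq2[OF b2[OF p]] \<psi>lo \<psi>hi in auto)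
    qed
  qed
  have sub0: "g \<in> ?S p \<longleftrightarrow> (\<exists>z\<in>\<Delta>0. Act p z \<and> g = gradient E q p + L p z)" if p: "p \<in> ?M \<inter> ball x \<delta>" for p g
  proof
    have pE: "p \<in> E \<inter> ball x \<delta>" using p ME by blast
    assume "g \<in> ?S p"
    then obtain \<alpha> \<beta> where ab: "(\<alpha>, \<beta>) \<in> \<Delta>" "\<forall>i\<le>m1. ereal (fs i p) \<noteq> f p \<longrightarrow> \<alpha> i = 0"
      "\<forall>j\<in>{1..m2}. \<phi> j p \<noteq> 0 \<longrightarrow> \<beta> j = 0"
      "g = (\<Sum>i\<le>m1. \<alpha> i *\<^sub>R gradient E (fs i) p) + (\<Sum>j\<in>{1..m2}. \<beta> j *\<^sub>R gradient E (\<phi> j) p)"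
      unfolding sub[OF b1[OF p]] by blast
    obtain z where z: "z \<in> \<Delta>0" "\<forall>i\<le>m1. z i = \<alpha> i" "\<forall>j\<in>{1..m2}. z (m1 + j) = \<beta> j" using join[OF ab(1)] by blast
    have "Act p z" unfolding act_iff[OF p] using z ab by simp
    moreover have "g = gradient E q p + L p z" unfolding L\<Delta>0[OF z(1) pE] ab(4) using z by simp
    ultimately show "\<exists>z\<in>\<Delta>0. Act p z \<and> g = gradient E q p + L p z" using z(1) by blast
  next
    have pE: "p \<in> E \<inter> ball x \<delta>" using p ME by blast
    assume "\<exists>z\<in>\<Delta>0. Act p z \<and> g = gradient E q p + L p z"
    then obtain z where z: "z \<in> \<Delta>0" "Act p z" "g = gradient E q p + L p z" by blast
    have "(fst (split z), snd (split z)) \<in> \<Delta>" using z(1) by (simp add: \<Delta>0_def)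
    moreover have "\<forall>i\<le>m1. ereal (fs i p) \<noteq> f p \<longrightarrow> fst (split z) i = 0"
      "\<forall>j\<in>{1..m2}. \<phi> j p \<noteq> 0 \<longrightarrow> snd (split z) j = 0"
      using z(2) unfolding act_iff[OF p] by (auto simp: split_def)
    moreover have "g = (\<Sum>i\<le>m1. fst (split z) i *\<^sub>R gradient E (fs i) p) +
        (\<Sum>j\<in>{1..m2}. snd (split z) j *\<^sub>R gradient E (\<phi> j) p)"
      unfolding z(3) L\<Delta>0[OF z(1) pE] by (simp add: split_def)
    ultimately show "g \<in> ?S p" unfolding sub[OF b1[OF p]] by blast
  qed
  have Sconv: "(1 - t) *\<^sub>R g + t *\<^sub>R g' \<in> ?S p" if p: "p \<in> ?M \<inter> ball x \<delta>" and g: "g \<in> ?S p" "g' \<in> ?S p" and t: "t \<in> {0..1}" for p g g' t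
  proof -
    obtain z z' where z: "z \<in> \<Delta>0" "Act p z" "g = gradient E q p + L p z"
      "z' \<in> \<Delta>0" "Act p z'" "g' = gradient E q p + L p z'" using g unfolding sub0[OF p] by blast
    have "(1 - t) *\<^sub>R g + t *\<^sub>R g' = gradient E q p + L p (\<lambda>k. (1 - t) * z k + t * z' k)"
      unfolding Llin by (simp add: z(3,6) algebra_simps)
    moreover have "Act p (\<lambda>k. (1 - t) * z k + t * z' k)" using z(2,5) by (simp add: Act_def)
    ultimately show ?thesis unfolding sub0[OF p] using \<Delta>0conv[OF z(1,4) t] by blast
  qed
  have \<Gamma>sub: "gradient E q p + L p w \<in> ?S p" if p: "p \<in> ?M \<inter> ball x \<delta>" and w: "w \<in> \<Gamma>" "Act p w" for p w
  proof -
    \<comment> \<open>The iteration below must start from a vector that is active at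
      \<open>p\<close>, so that all iterates are; the unit vector of a function active at
      \<open>p\<close> is one.\<close>
    obtain i where i: "i \<le> m1" "f p = ereal (fs i p)" using some_act[OF b1[OF p]] by blast
    obtain z where z: "z \<in> \<Delta>0" "\<forall>l\<le>m1. z l = (if l = i then 1 else 0)" "\<forall>j\<in>{1..m2}. z (m1 + j) = 0"
      using join[OF unit[OF i(1)]] by blast
    have zA: "Act p z" unfolding act_iff[OF p] using z i by auto
    define r where "r = 1 - \<tau> w"
    have r: "0 \<le> r" "r \<le> 1" using w(1) by (auto simp: \<Gamma>_def r_def)
    define c where "c n = (\<Sum>l<n. r ^ l)" for n
    \<comment> \<open>These iterates of \<open>z \<mapsto> r z + w\<close>, divided by \<open>c n\<close>, converge to \<open>w\<close>, also when \<open>w\<close> is a recession direction (\<open>r = 1\<close>).\<close>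
    have it: "(\<lambda>k. r ^ n * z k + c n * w k) \<in> \<Delta>0" for n
    proof (induction n)
      case 0
      then show ?case using z(1) by (simp add: c_def)
    next
      case (Suc n)
      have "(\<lambda>k. r * (r ^ n * z k + c n * w k) + w k) \<in> \<Delta>0"
        using w(1) Suc.IH by (simp add: \<Gamma>_def r_def)
      moreover have "c (Suc n) = r * c n + 1"
        unfolding c_def sum.lessThan_Suc_shift by (simp add: sum_distrib_left)
      ultimately show ?case by (simp add: algebra_simps)
    qed
    have c1: "c (Suc n) \<ge> 1" for n
      using r unfolding c_def sum.lessThan_Suc_shift by (simp add: sum_nonneg)
    \<comment> \<open>Each of the \<open>n\<close> terms of \<open>c n\<close> is at least
      \<open>r ^ n\<close>. This covers \<open>r = 1\<close> as well, and bounds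
      \<open>r ^ n / c n\<close> by the reciprocal of \<open>n\<close> for positive
      \<open>n\<close>.\<close>
    have cge: "r ^ n * real n \<le> c n" for n
    proof -
      have "(\<Sum>l<n. r ^ n) \<le> (\<Sum>l<n. r ^ l)" using r by (intro sum_mono power_decreasing) auto
      then show ?thesis by (simp add: c_def mult.commute)
    qed
    \<comment> \<open>The subgradient of an iterate is averaged with the gradient of
      \<open>q\<close>, itself a subgradient. The weight \<open>1 / c (Suc n)\<close> brings the
      coefficient of \<open>w\<close> to exactly 1; \<open>Suc n\<close> avoids
      \<open>c 0 = 0\<close>.\<close>
    have inS: "gradient E q p + ((r ^ Suc n / c (Suc n)) *\<^sub>R L p z + L p w) \<in> ?S p" for n
    proof -
      let ?c = "c (Suc n)"
      have "Act p (\<lambda>k. r ^ Suc n * z k + ?c * w k)" using zA w(2) by (simp add: Act_def)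
      then have "gradient E q p + L p (\<lambda>k. r ^ Suc n * z k + ?c * w k) \<in> ?S p"
        unfolding sub0[OF p] using it by blast
      then have "(1 - 1 / ?c) *\<^sub>R gradient E q p + (1 / ?c) *\<^sub>R (gradient E q p + L p (\<lambda>k. r ^ Suc n * z k + ?c * w k)) \<in> ?S p"
        using c1[of n] by (intro Sconv[OF p gq2[OF b2[OF p]]]) auto
      also have "(1 - 1 / ?c) *\<^sub>R gradient E q p + (1 / ?c) *\<^sub>R (gradient E q p + L p (\<lambda>k. r ^ Suc n * z k + ?c * w k)) =
          gradient E q p + ((r ^ Suc n / ?c) *\<^sub>R L p z + L p w)"
        using c1[of n] unfolding Llin by (simp add: scaleR_add_right scaleR_diff_left)
      finally show ?thesis .
    qed
    have "(\<lambda>n. r ^ Suc n / c (Suc n)) \<longlonglongrightarrow> 0"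
    proof (rule Lim_null_comparison[OF always_eventually])
      show "\<forall>n. norm (r ^ Suc n / c (Suc n)) \<le> inverse (real (Suc n))"
      proof
        fix n
        have "r ^ Suc n * real (Suc n) \<le> c (Suc n)" by (rule cge)
        then have "r ^ Suc n / c (Suc n) \<le> inverse (real (Suc n))"
          using c1[of n] by (simp add: field_simps)
        moreover have "r ^ Suc n / c (Suc n) \<ge> 0" using r c1[of n] by simp
        ultimately show "norm (r ^ Suc n / c (Suc n)) \<le> inverse (real (Suc n))" by simp
      qed
      show "(\<lambda>n. inverse (real (Suc n))) \<longlonglongrightarrow> 0" by (rule LIMSEQ_inverse_real_of_nat)
    qed
    then have "(\<lambda>n. gradient E q p + ((r ^ Suc n / c (Suc n)) *\<^sub>R L p z + L p w)) \<longlonglongrightarrow> gradient E q p + (0 *\<^sub>R L p z + L p w)"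
      by (intro tendsto_intros)
    from closed_sequentially[OF closed_limiting_subdiff inS this] show ?thesis by simp
  qed
  have gS: "gradient E (fs i) x \<in> ?S x" if i: "i \<le> m1" for i
  proof -
    have "gradient E (fs i) x = (\<Sum>l\<le>m1. (if l = i then 1 else 0) *\<^sub>R gradient E (fs l) x) +
        (\<Sum>j\<in>{1..m2}. 0 *\<^sub>R gradient E (\<phi> j) x)"
      using i by (simp add: if_distrib[of "\<lambda>c. c *\<^sub>R _"] cong: if_cong)
    moreover have "\<dots> \<in> ?S x"
      unfolding sub[OF b1[OF xb]] using unit[OF i] act by blast
    ultimately show ?thesis by simp
  qed
  have "\<exists>b. b \<noteq> 0 \<and> \<bar>b\<bar> \<le> 1 \<and> gradient E q x + b *\<^sub>R gradient E (\<psi> k) x \<in> ?S x" if "k \<in> K" for k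
    using that
  proof (rule K_cases)
    have x1: "x \<in> E \<inter> ball x \<delta>" using xE \<delta> by simp
    fix i assume i: "i \<le> m1"
    \<comment> \<open>Here \<open>b = 1\<close>: adding the gradient of the difference to that of
      \<open>q\<close> gives the gradient of \<open>fs i\<close>.\<close>
    have "gradient E q x + 1 *\<^sub>R gradient E (\<psi> i) x \<in> ?S x"
      unfolding gr\<psi>[OF i x1] using gS[OF i] by simp
    then show "\<exists>b. b \<noteq> 0 \<and> \<bar>b\<bar> \<le> 1 \<and> gradient E q x + b *\<^sub>R gradient E (\<psi> i) x \<in> ?S x"
      by (intro exI[of _ 1]) simp
  next
    fix j assume j: "j \<in> {1..m2}"
    obtain \<alpha> \<beta> where ab: "(\<alpha>, \<beta>) \<in> \<Delta>" "\<beta> j \<noteq> 0" "\<forall>j'. j' \<noteq> j \<longrightarrow> \<beta> j' = 0" using ax[OF j] by blast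
    let ?D = "diff_span (?S x)"

    \<comment> \<open>The subgradient that belongs to the vector from (iv). As the weights total 1,
      subtracting the weighted gradients of the \<open>fs i\<close> from it leaves a combination of
      differences of subgradients. So the gradient of \<open>\<phi> j\<close> is a direction in
      which a relative interior point can be moved.\<close>
    define s where "s = (\<Sum>i\<le>m1. \<alpha> i *\<^sub>R gradient E (fs i) x) + (\<Sum>j\<in>{1..m2}. \<beta> j *\<^sub>R gradient E (\<phi> j) x)"
    have sS: "s \<in> ?S x" unfolding s_def sub[OF b1[OF xb]] using ab(1) act by blast
    have sum\<beta>: "(\<Sum>j'\<in>{1..m2}. \<beta> j' *\<^sub>R gradient E (\<phi> j') x) = \<beta> j *\<^sub>R gradient E (\<phi> j) x"
      using j ab(3) by (subst sum.remove[of _ j]) auto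
    have sum\<alpha>: "(\<Sum>i\<le>m1. \<alpha> i *\<^sub>R s) = s" using simplex[OF ab(1)] by (simp flip: scaleR_sum_left)
    have "\<beta> j *\<^sub>R gradient E (\<phi> j) x = (\<Sum>i\<le>m1. \<alpha> i *\<^sub>R (s - gradient E (fs i) x))"
      using sum\<alpha> sum\<beta> by (simp add: scaleR_diff_right sum_subtractf) (simp add: s_def)
    also have "\<dots> \<in> ?D"
      using diff_in_diff_span[OF sS gS] by (intro subspace_sum subspace_scale subspace_diff_span) auto
    finally have "(1 / \<beta> j) *\<^sub>R (\<beta> j *\<^sub>R gradient E (\<phi> j) x) \<in> ?D" by (rule subspace_scale[OF subspace_diff_span])
    then have d: "gradient E (\<phi> j) x \<in> ?D" using ab(2) by simp
    obtain e where e: "e > 0" "\<And>d. d \<in> ?D \<Longrightarrow> norm d < e \<Longrightarrow> gradient E q x + d \<in> ?S x"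
      using ri unfolding rel_interior_iff by blast
    \<comment> \<open>The cap 1 is demanded by the normal form; the 1 added in the denominator
      covers a vanishing gradient, and the factor 2 makes the norm bound strict.\<close>
    define b where "b = min 1 (e / (2 * (1 + norm (gradient E (\<phi> j) x))))"
    have b: "b > 0" "b \<le> 1" using e(1) by (auto simp: b_def add_pos_nonneg)
    have "b * norm (gradient E (\<phi> j) x) \<le> e / (2 * (1 + norm (gradient E (\<phi> j) x))) * (1 + norm (gradient E (\<phi> j) x))"
      using b(1) by (intro mult_mono) (auto simp: b_def)
    also have "\<dots> = e / 2"
    proof -
      have "e / (2 * N) * N = e / 2" if "N > 0" for N using that by simp
      then show ?thesis by (simp only: add_pos_nonneg[OF zero_less_one norm_ge_zero])
    qed
    finally have "norm (b *\<^sub>R gradient E (\<phi> j) x) < e" using b(1) e(1) by simp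
    then have "gradient E q x + b *\<^sub>R gradient E (\<phi> j) x \<in> ?S x"
      by (intro e(2) subspace_scale[OF subspace_diff_span d])
    then show "\<exists>b. b \<noteq> 0 \<and> \<bar>b\<bar> \<le> 1 \<and> gradient E q x + b *\<^sub>R gradient E (\<psi> (m1 + j)) x \<in> ?S x"
      using b unfolding \<psi>hi[OF j] by (intro exI[of _ b]) simp
  qed
  moreover have "C2_on (E \<inter> ball x \<delta>) (\<psi> k) \<and> \<psi> k x = 0" if "k \<in> K" for k
    using that
  proof (rule K_cases)
    fix i assume i: "i \<le> m1"
    have "fs i x = q x" using act(1)[OF i] fq2[OF b2[OF xb]] by simp
    then show "C2_on (E \<inter> ball x \<delta>) (\<psi> i) \<and> \<psi> i x = 0"
      unfolding \<psi>lo[OF i] using C2_on_diff[OF C2fs[OF i] C2q] by simp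
  next
    fix j assume j: "j \<in> {1..m2}"
    then show "C2_on (E \<inter> ball x \<delta>) (\<psi> (m1 + j)) \<and> \<psi> (m1 + j) x = 0"
      unfolding \<psi>hi[OF j] using C2\<phi>[OF j] act(2)[OF j] by simp
  qed
  moreover have "f p = ereal (q p) \<and> (\<forall>g. g \<in> ?S p \<longleftrightarrow> (\<exists>z\<in>\<Gamma>. (\<forall>k\<in>K. \<psi> k p \<noteq> 0 \<longrightarrow> z k = 0) \<and>
        g = gradient E q p + (\<Sum>k\<in>K. z k *\<^sub>R gradient E (\<psi> k) p)))" if p: "p \<in> ?M \<inter> ball x \<delta>" for p
  proof (intro conjI allI)
    show "f p = ereal (q p)" by (rule fq2[OF b2[OF p]])
    fix g
    have "g \<in> ?S p \<longleftrightarrow> (\<exists>z\<in>\<Gamma>. Act p z \<and> g = gradient E q p + L p z)"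
      using sub0[OF p, of g] \<Gamma>sub[OF p] \<Delta>0\<Gamma> by blast
    then show "g \<in> ?S p \<longleftrightarrow> (\<exists>z\<in>\<Gamma>. (\<forall>k\<in>K. \<psi> k p \<noteq> 0 \<longrightarrow> z k = 0) \<and>
        g = gradient E q p + (\<Sum>k\<in>K. z k *\<^sub>R gradient E (\<psi> k) p))"
      unfolding Act_def L_def .
  qed
  moreover have "finite K" by (simp add: K_def)
  moreover have "\<forall>z\<in>\<Gamma>. \<forall>k. k \<notin> K \<longrightarrow> z k = 0" by (simp add: \<Gamma>_def)
  ultimately have "normal_form E f x ?M \<delta> K q \<psi> \<Gamma>"
    unfolding normal_form_def using \<delta> xM ME C2q cl\<Gamma> conv\<Gamma> zero\<Gamma> by blast
  then show ?thesis by blast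
qed

end

subsection \<open>Fast tracks of separable sums\<close>

text \<open>The defining maps are combined componentwise. In the ball of the smallest radius every
  component is within reach of its local description, and a block-diagonal Jacobian is onto because
  its blocks are.\<close>

lemma C2_manifold_about_prod:
  fixes x :: "'a::euclidean_space ^ 'k"
  assumes E: "\<And>i. subspace (E i)" and M: "\<And>i. C2_manifold_about (E i) (d i) (M i) (x $ i)"
  shows "C2_manifold_about (prod_space E) (\<Sum>i\<in>UNIV. d i) (prod_space M) x"
proof -
  define Q where "Q i r Z F \<longleftrightarrow> r > 0 \<and> subspace Z \<and> Z \<subseteq> E i \<and> dim Z + d i = dim (E i) \<and>
        F ` (E i \<inter> ball (x $ i) r) \<subseteq> Z \<and> C2_on (E i \<inter> ball (x $ i) r) F \<and>
        jacobian (E i) F (x $ i) ` E i = Z \<and>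
        M i \<inter> ball (x $ i) r = {y \<in> E i \<inter> ball (x $ i) r. F y = 0}" for i r Z and F :: "'a \<Rightarrow> 'a"
  have "\<exists>r Z F. Q i r Z F" for i
    using M[of i] unfolding C2_manifold_about_def Q_def
    by (elim conjE exE) (rule exI, rule exI, rule exI, intro conjI; assumption)
  then obtain r Z F where Q: "\<And>i. Q i (r i) (Z i) (F i)" by metis
  have r: "\<And>i. r i > 0" and Z: "\<And>i. subspace (Z i)" "\<And>i. Z i \<subseteq> E i" and dim: "\<And>i. dim (Z i) + d i = dim (E i)"
    and FZ: "\<And>i. F i ` (E i \<inter> ball (x $ i) (r i)) \<subseteq> Z i" and C2: "\<And>i. C2_on (E i \<inter> ball (x $ i) (r i)) (F i)"
    and J: "\<And>i. jacobian (E i) (F i) (x $ i) ` E i = Z i"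
    and MF: "\<And>i. M i \<inter> ball (x $ i) (r i) = {y \<in> E i \<inter> ball (x $ i) (r i). F i y = 0}"
    using Q unfolding Q_def by blast+
  have xM: "\<And>i. x $ i \<in> M i" and ME: "\<And>i. M i \<subseteq> E i" using M by (auto simp: C2_manifold_about_def)
  have xE: "x \<in> prod_space E" using xM ME by (auto simp: mem_prod_space)
  define R where "R = Min (range r)"
  have R: "R > 0" "\<And>i. R \<le> r i" using r by (auto simp: R_def)
  have comp: "y $ i \<in> ball (x $ i) (r i)" if "y \<in> ball x R" for y i
    using that R(2)[of i] Finite_Cartesian_Product.norm_nth_le[of "x - y" i] by (auto simp: dist_norm)
  define G where "G y = (\<chi> i. F i (y $ i))" for y
  have "\<exists>D. (F i has_derivative D) (at (x $ i) within E i)" for i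
  proof -
    have "x $ i \<in> E i" "x $ i \<in> ball (x $ i) (r i)" using xE r by (simp_all add: mem_prod_space)
    from C2_on_ball_differentiable[OF C2 this] show ?thesis by blast
  qed
  then obtain D where D: "\<And>i. (F i has_derivative D i) (at (x $ i) within E i)" by metis
  have "jacobian (prod_space E) G x ` prod_space E = prod_space Z"
  proof -
    have jac: "jacobian (prod_space E) G x = (\<lambda>d. \<chi> i. jacobian (E i) (F i) (x $ i) (d $ i))"
      unfolding G_def by (rule jacobian_prod[OF E xE D])
    show ?thesis
    proof (intro equalityI subsetI)
      fix z assume "z \<in> jacobian (prod_space E) G x ` prod_space E"
      then obtain e where e: "e \<in> prod_space E" "z = jacobian (prod_space E) G x e" by blast
      have "jacobian (E i) (F i) (x $ i) (e $ i) \<in> Z i" for i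
        using J[of i] e(1) by (auto simp: mem_prod_space)
      then show "z \<in> prod_space Z" by (simp add: e(2) jac mem_prod_space)
    next
      fix z assume z: "z \<in> prod_space Z"
      have "\<forall>i. \<exists>e\<in>E i. z $ i = jacobian (E i) (F i) (x $ i) e"
    proof
      fix i
      have "z $ i \<in> jacobian (E i) (F i) (x $ i) ` E i" using z unfolding J by (simp add: mem_prod_space)
      then show "\<exists>e\<in>E i. z $ i = jacobian (E i) (F i) (x $ i) e" by blast
    qed
      then obtain e where e: "\<And>i. e i \<in> E i" "\<And>i. z $ i = jacobian (E i) (F i) (x $ i) (e i)" by metis
      have "z = jacobian (prod_space E) G x (\<chi> i. e i)" using e(2) by (simp add: jac vec_eq_iff)
      moreover have "(\<chi> i. e i) \<in> prod_space E" using e(1) by (simp add: mem_prod_space)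
      ultimately show "z \<in> jacobian (prod_space E) G x ` prod_space E" by blast
    qed
  qed
  moreover have "dim (prod_space Z) + (\<Sum>i\<in>UNIV. d i) = dim (prod_space E)"
    by (simp add: dim_prod_space[OF Z(1)] dim_prod_space[OF E] dim sum.distrib[symmetric])
  moreover have "G ` (prod_space E \<inter> ball x R) \<subseteq> prod_space Z"
  proof
    fix z assume "z \<in> G ` (prod_space E \<inter> ball x R)"
    then obtain y where y: "y \<in> prod_space E" "y \<in> ball x R" "z = G y" by blast
    have "F i (y $ i) \<in> Z i" for i
      using FZ[of i] comp[OF y(2), of i] y(1) by (auto simp: mem_prod_space)
    then show "z \<in> prod_space Z" by (simp add: y(3) G_def mem_prod_space)
  qed
  moreover have "C2_on (prod_space E \<inter> ball x R) G"
    unfolding G_def by (rule C2_on_prod[OF C2]) (use comp in \<open>simp add: mem_prod_space\<close>)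
  moreover have "prod_space M \<inter> ball x R = {y \<in> prod_space E \<inter> ball x R. G y = 0}"
  proof -
    have "y \<in> prod_space M \<longleftrightarrow> y \<in> prod_space E \<and> G y = 0" if y: "y \<in> ball x R" for y
    proof -
      have "y $ i \<in> M i \<longleftrightarrow> y $ i \<in> E i \<and> F i (y $ i) = 0" for i
        using MF[of i] comp[OF y, of i] by blast
      then show ?thesis by (auto simp: mem_prod_space G_def vec_eq_iff)
    qed
    then show ?thesis by blast
  qed
  moreover have "subspace (prod_space Z)" by (rule subspace_prod_space[OF Z(1)])
  moreover have "prod_space Z \<subseteq> prod_space E" "prod_space M \<subseteq> prod_space E" "x \<in> prod_space M"
    using subsetD[OF Z(2)] subsetD[OF ME] xM by (auto simp: mem_prod_space)
  ultimately show ?thesis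
    unfolding C2_manifold_about_def using R(1) by blast
qed

context separable_sum
begin

context
  fixes x v
  assumes ft: "\<And>i. fast_track (X i) (f i) (x $ i) (v i)"
begin

lemma ne_ft: "rel_interior (subdiff_comp x i) \<noteq> {}"
  by (rule fast_track_subdiff_nonempty[OF X ft])

lemma track_manifold_total:
  "track_manifold (prod_space X) total x (\<lambda>u. \<chi> i. v i (u $ i)) =
    prod_space (\<lambda>i. track_manifold (X i) (f i) (x $ i) (v i))"
proof (intro equalityI subsetI)
  fix y assume "y \<in> track_manifold (prod_space X) total x (\<lambda>u. \<chi> i. v i (u $ i))"
  then show "y \<in> prod_space (\<lambda>i. track_manifold (X i) (f i) (x $ i) (v i))"
    by (auto simp: track_manifold_def U_space_total[OF ne_ft] mem_prod_space)
next
  fix y assume "y \<in> prod_space (\<lambda>i. track_manifold (X i) (f i) (x $ i) (v i))"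
  then have "\<forall>i. \<exists>u. y $ i = x $ i + (u + v i u) \<and> u \<in> U_comp x i"
    by (auto simp: track_manifold_def mem_prod_space)
  then obtain u where u: "\<And>i. y $ i = x $ i + (u i + v i (u i))" "\<And>i. u i \<in> U_comp x i" by metis
  have "y = x + ((\<chi> i. u i) + (\<chi> i. v i ((\<chi> i. u i) $ i)))" using u(1) by (simp add: vec_eq_iff)
  moreover have "(\<chi> i. u i) \<in> U_total x"
    using u(2) by (simp add: U_space_total[OF ne_ft] mem_prod_space)
  ultimately show "y \<in> track_manifold (prod_space X) total x (\<lambda>u. \<chi> i. v i (u $ i))"
    unfolding track_manifold_def by blast
qed

lemma fast_track_total: "fast_track (prod_space X) total x (\<lambda>u. \<chi> i. v i (u $ i))"
proof -
  let ?w = "\<lambda>u :: 'a ^ 'k. \<chi> i. v i (u $ i)"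
  let ?M = "\<lambda>i. track_manifold (X i) (f i) (x $ i) (v i)"
  have x: "x \<in> prod_space X" using ft by (auto simp: mem_prod_space fast_track_def PDG_def)
  have manifold: "\<exists>d. C2_manifold_about (prod_space X) d (track_manifold (prod_space X) total x ?w) x \<and>
      dim (V_total x) + d = dim (prod_space X)"
  proof -
    have "\<forall>i. \<exists>d. C2_manifold_about (X i) d (?M i) (x $ i) \<and> dim (V_comp x i) + d = dim (X i)"
      using ft unfolding fast_track_def by blast
    then obtain d where d: "\<And>i. C2_manifold_about (X i) (d i) (?M i) (x $ i)"
      "\<And>i. dim (V_comp x i) + d i = dim (X i)" by metis
    have "dim (V_total x) + (\<Sum>i\<in>UNIV. d i) = dim (prod_space X)"
      by (simp add: V_space_total[OF ne_ft] dim_prod_space[OF subspace_V_space] dim_prod_space[OF X]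
          d(2) sum.distrib[symmetric])
    then show ?thesis
      using C2_manifold_about_prod[OF X d(1)] unfolding track_manifold_total by blast
  qed
  have pdg: "PDG (prod_space X) total x (track_manifold (prod_space X) total x ?w)"
  proof -
    have "\<forall>i. \<exists>\<delta> (K :: nat set) q \<phi> \<Gamma>. normal_form (X i) (f i) (x $ i) (?M i) \<delta> K q \<phi> \<Gamma>"
      using normal_form_of_fast_track[OF X ft] by blast
    then obtain \<delta> K q \<phi> \<Gamma> where
      "\<And>i. normal_form (X i) (f i) (x $ i) (?M i) (\<delta> i) (K i :: nat set) (q i) (\<phi> i) (\<Gamma> i)"
      by (simp only: choice_iff) blast
    note nf = normal_form_prod[OF separable_sum_axioms this]
    show ?thesis unfolding track_manifold_total
      by (rule PDG_of_normal_form[OF subspace_X lsc_total total_not_MInfty nf])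
  qed
  have image: "?w ` U_total x \<subseteq> V_total x"
  proof -
    have "v i ` U_comp x i \<subseteq> V_comp x i" for i
      using ft[of i] by (simp add: fast_track_def)
    then have "v i u \<in> V_comp x i" if "u \<in> U_comp x i" for i u
      using that by blast
    then show ?thesis
      unfolding U_space_total[OF ne_ft] V_space_total[OF ne_ft] by (auto simp: mem_prod_space)
  qed
  have near: "\<exists>\<epsilon>>0. C2_on (U_total x \<inter> ball 0 \<epsilon>) ?w \<and>
        (\<forall>u \<in> U_total x \<inter> ball 0 \<epsilon>. ?w u \<in> argmin_total x g u) \<and>
        (\<forall>u \<in> U_total x \<inter> ball 0 \<epsilon>. \<bar>L_total x g u\<bar> \<noteq> \<infinity>) \<and>
        C2_on (U_total x \<inter> ball 0 \<epsilon>) (\<lambda>u. real_of_ereal (L_total x g u))"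
    if g: "g \<in> rel_interior (subdiff_total x)" for g
  proof -
    let ?U = "\<lambda>i. U_comp x i"
    let ?L = "\<lambda>i. L_comp x g i"
    define Q where "Q i \<epsilon> \<longleftrightarrow> \<epsilon> > 0 \<and> C2_on (?U i \<inter> ball 0 \<epsilon>) (v i) \<and>
        (\<forall>u \<in> ?U i \<inter> ball 0 \<epsilon>. v i u \<in> argmin_comp x g i u) \<and>
        (\<forall>u \<in> ?U i \<inter> ball 0 \<epsilon>. \<bar>?L i u\<bar> \<noteq> \<infinity>) \<and>
        C2_on (?U i \<inter> ball 0 \<epsilon>) (\<lambda>u. real_of_ereal (?L i u))" for i \<epsilon>
    have "g $ i \<in> rel_interior (subdiff_comp x i)" for i
      using g by (simp add: rel_interior_subdiff_total mem_prod_space)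
    then have "\<forall>i. \<exists>\<epsilon>. Q i \<epsilon>" using fast_track_near[OF X ft] unfolding Q_def by simp
    then obtain \<epsilon> where Q: "\<And>i. Q i (\<epsilon> i)" by metis
    have \<epsilon>: "\<And>i. \<epsilon> i > 0" and C2v: "\<And>i. C2_on (?U i \<inter> ball 0 (\<epsilon> i)) (v i)"
      and argmin: "\<And>i u. u \<in> ?U i \<inter> ball 0 (\<epsilon> i) \<Longrightarrow> v i u \<in> argmin_comp x g i u"
      and fin: "\<And>i u. u \<in> ?U i \<inter> ball 0 (\<epsilon> i) \<Longrightarrow> \<bar>?L i u\<bar> \<noteq> \<infinity>"
      and C2L: "\<And>i. C2_on (?U i \<inter> ball 0 (\<epsilon> i)) (\<lambda>u. real_of_ereal (?L i u))"
      using Q unfolding Q_def by simp_all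
    define r where "r = Min (range \<epsilon>)"
    have r: "r > 0" "\<And>i. r \<le> \<epsilon> i" using \<epsilon> by (auto simp: r_def)
    have comp: "u $ i \<in> ?U i \<inter> ball 0 (\<epsilon> i)" if "u \<in> U_total x \<inter> ball 0 r" for u i
    proof -
      have "u $ i \<in> ?U i" using that by (simp add: U_space_total[OF ne_ft] mem_prod_space)
      moreover have "norm (u $ i) < \<epsilon> i"
        using Finite_Cartesian_Product.norm_nth_le[of u i] that r(2)[of i] by simp
      ultimately show ?thesis by simp
    qed
    have L: "L_total x g u = ereal (\<Sum>i\<in>UNIV. real_of_ereal (?L i (u $ i)))"
      if u: "u \<in> U_total x \<inter> ball 0 r" for u
    proof (rule U_Lagrangian_total_real(2)[OF ne_ft x])
      show "argmin_comp x g i (u $ i) \<noteq> {}" for i using argmin[OF comp[OF u]] by blast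
      show "\<bar>?L i (u $ i)\<bar> \<noteq> \<infinity>" for i by (rule fin[OF comp[OF u]])
    qed
    have "C2_on (U_total x \<inter> ball 0 r) ?w"
      by (rule C2_on_prod[OF C2v comp])
    moreover have "?w u \<in> argmin_total x g u"
      if u: "u \<in> U_total x \<inter> ball 0 r" for u
      by (rule U_argmin_total_intro(1)[OF ne_ft x]) (simp add: argmin[OF comp[OF u]])
    moreover have "\<bar>L_total x g u\<bar> \<noteq> \<infinity>"
      if u: "u \<in> U_total x \<inter> ball 0 r" for u
      by (simp add: L[OF u])
    moreover have "C2_on (U_total x \<inter> ball 0 r)
        (\<lambda>u. real_of_ereal (L_total x g u))"
    proof (rule C2_on_cong)
      show "C2_on (U_total x \<inter> ball 0 r) (\<lambda>u. \<Sum>i\<in>UNIV. real_of_ereal (?L i (u $ i)))"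
        by (intro C2_on_sum C2_on_component[OF C2L] comp)
    qed (simp add: L)
    ultimately show ?thesis using r(1) by (intro exI[of _ r] conjI ballI)
  qed
  show ?thesis
    unfolding fast_track_def using manifold pdg image near by (intro conjI ballI)
qed

end

end

theorem lemma4p5:
  fixes X :: "'k::finite \<Rightarrow> 'a::euclidean_space set"
    and Y :: "'k \<Rightarrow> 'b::euclidean_space set"
    and \<Phi> :: "'k \<Rightarrow> 'a \<Rightarrow> 'b"
    and h :: "'k \<Rightarrow> 'b \<Rightarrow> ereal"
    and v :: "'k \<Rightarrow> 'b \<Rightarrow> 'b"
    and xbar :: "'a ^ 'k"
  assumes "\<And>i. subspace (X i)" and "\<And>i. subspace (Y i)"
    and "\<And>i. \<Phi> i ` X i \<subseteq> Y i" and "\<And>i. C2_on (X i) (\<Phi> i)"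
    and "\<And>i y. y \<in> Y i \<Longrightarrow> h i y \<noteq> -\<infinity>"
    and "\<And>i. xbar $ i \<in> X i"
    and "\<And>i. fast_track (Y i) (h i) (\<Phi> i (xbar $ i)) (v i)"
    and "\<And>i. transversal (X i) (Y i) (\<Phi> i)
               (track_manifold (Y i) (h i) (\<Phi> i (xbar $ i)) (v i)) (xbar $ i)"
  shows
    "let f = (\<lambda>i z. h i (\<Phi> i z));
         H = (\<lambda>y :: 'b ^ 'k. \<Sum>i\<in>UNIV. h i (y $ i));
         P = (\<lambda>x :: 'a ^ 'k. \<chi> i. \<Phi> i (x $ i));
         F = (\<lambda>x :: 'a ^ 'k. \<Sum>i\<in>UNIV. f i (x $ i))
     in (\<exists>w. fast_track (prod_space Y) H (P xbar) w \<and>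
             transversal (prod_space X) (prod_space Y) P
               (track_manifold (prod_space Y) H (P xbar) w) xbar) \<and>
        (\<forall>(d :: 'k \<Rightarrow> nat) (Ub :: 'k \<Rightarrow> nat \<Rightarrow> 'a).
           (\<forall>i. U_basis (X i) (f i) (xbar $ i) {..<d i} (Ub i)) \<longrightarrow>
           U_basis (prod_space X) F xbar (SIGMA i:UNIV. {..<d i}) (block_diag Ub) \<and>
           (\<forall>g. (U_gradient_defined (prod_space X) F xbar g \<longleftrightarrow>
                   (\<forall>i. U_gradient_defined (X i) (f i) (xbar $ i) (g $ i))) \<and>
                (U_gradient_defined (prod_space X) F xbar g \<longrightarrow>
                   U_gradient (prod_space X) F xbar (SIGMA i:UNIV. {..<d i}) (block_diag Ub) g =
                   (\<chi> i. U_gradient (X i) (f i) (xbar $ i) {..<d i} (Ub i) (g $ i)))))"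
proof -
  let ?f = "\<lambda>i z. h i (\<Phi> i z)" and ?y = "\<chi> i. \<Phi> i (xbar $ i)"
  have lsc: "lsc_on (Y i) (h i)" for i using assms(7)[of i] by (simp add: fast_track_def PDG_def)
  have D: "\<exists>D. (\<Phi> i has_derivative D) (at z within X i)" if "z \<in> X i" for i z
    using C2_on_differentiable[OF assms(4) that] by blast
  have "continuous_on (X i) (\<Phi> i)" for i
    using D has_derivative_continuous by (meson continuous_on_eq_continuous_within)
  then have lsc': "lsc_on (X i) (?f i)" for i
    by (intro lsc_on_compose[OF lsc] assms(3))
  have sepH: "separable_sum Y h" using assms(2,5) lsc by (simp add: separable_sum_def)
  have sepF: "separable_sum X ?f"
  proof
    show "?f i z \<noteq> -\<infinity>" if "z \<in> X i" for i z using assms(3)[of i] that by (intro assms(5)[of _ i]) blast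
  qed (use assms(1) lsc' in auto)
  note totH = separable_sum.total_def[OF sepH, abs_def] and totF = separable_sum.total_def[OF sepF, abs_def]
  \<comment> \<open>The track of the sum moves each component along its own track.\<close>
  let ?w = "\<lambda>u. \<chi> i. v i (u $ i)"
  have ft: "fast_track (Y i) (h i) (?y $ i) (v i)" for i using assms(7) by simp
  have x: "xbar \<in> prod_space X" using assms(6) by (simp add: mem_prod_space)
  have "fast_track (prod_space Y) (separable_sum.total h) ?y ?w"
    by (rule separable_sum.fast_track_total[OF sepH ft])
  moreover have "transversal (prod_space X) (prod_space Y) (\<lambda>x. \<chi> i. \<Phi> i (x $ i))
      (track_manifold (prod_space Y) (separable_sum.total h) ?y ?w) xbar"
  proof -
    obtain D where "\<And>i. (\<Phi> i has_derivative D i) (at (xbar $ i) within X i)"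
      using D[OF assms(6)] by metis
    moreover have "transversal (X i) (Y i) (\<Phi> i) (track_manifold (Y i) (h i) (?y $ i) (v i)) (xbar $ i)" for i
      using assms(8) by simp
    ultimately show ?thesis
      unfolding separable_sum.track_manifold_total[OF sepH ft] by (rule transversal_prod[OF assms(1,2) x])
  qed
  moreover have "U_basis (prod_space X) (separable_sum.total ?f) xbar (SIGMA i:UNIV. {..<d i}) (block_diag Ub) \<and>
      (\<forall>g. (U_gradient_defined (prod_space X) (separable_sum.total ?f) xbar g \<longleftrightarrow>
              (\<forall>i. U_gradient_defined (X i) (?f i) (xbar $ i) (g $ i))) \<and>
           (U_gradient_defined (prod_space X) (separable_sum.total ?f) xbar g \<longrightarrow>
              U_gradient (prod_space X) (separable_sum.total ?f) xbar (SIGMA i:UNIV. {..<d i}) (block_diag Ub) g =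
              (\<chi> i. U_gradient (X i) (?f i) (xbar $ i) {..<d i} (Ub i) (g $ i))))"
    if B: "\<forall>i. U_basis (X i) (?f i) (xbar $ i) {..<d i} (Ub i)" for d :: "'k \<Rightarrow> nat" and Ub :: "'k \<Rightarrow> nat \<Rightarrow> 'a"
  proof (intro conjI allI)
    have Bi: "U_basis (X i) (?f i) (xbar $ i) {..<d i} (Ub i)" for i using B by blast
    \<comment> \<open>\<open>U_basis\<close> contains the nonemptiness of the relative interior,
      which frees \<open>U\<close> and \<open>V\<close> from the arbitrary
      \<open>ri_point\<close>.\<close>
    have ne: "rel_interior (limiting_subdiff (X i) (?f i) (xbar $ i)) \<noteq> {}" for i
      using Bi[of i] by (simp add: U_basis_def)
    show "U_basis (prod_space X) (separable_sum.total ?f) xbar (SIGMA i:UNIV. {..<d i}) (block_diag Ub)"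
      by (rule separable_sum.U_basis_total[OF sepF Bi])
    fix g
    show iff: "U_gradient_defined (prod_space X) (separable_sum.total ?f) xbar g \<longleftrightarrow>
        (\<forall>i. U_gradient_defined (X i) (?f i) (xbar $ i) (g $ i))"
      using separable_sum.U_gradient_defined_components[OF sepF ne x]
        separable_sum.U_gradient_defined_total[OF sepF ne x] by blast
    show "U_gradient_defined (prod_space X) (separable_sum.total ?f) xbar g \<longrightarrow>
        U_gradient (prod_space X) (separable_sum.total ?f) xbar (SIGMA i:UNIV. {..<d i}) (block_diag Ub) g =
        (\<chi> i. U_gradient (X i) (?f i) (xbar $ i) {..<d i} (Ub i) (g $ i))"
    proof
      assume "U_gradient_defined (prod_space X) (separable_sum.total ?f) xbar g"
      then have def: "U_gradient_defined (X i) (?f i) (xbar $ i) (g $ i)" for i using iff by blast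
      have "Ub i j \<in> U_space (X i) (?f i) (xbar $ i)" if "j \<in> {..<d i}" for i j
        using Bi[of i] span_base[of "Ub i j" "Ub i ` {..<d i}"] that by (simp add: U_basis_def)
      then show "U_gradient (prod_space X) (separable_sum.total ?f) xbar (SIGMA i:UNIV. {..<d i}) (block_diag Ub) g =
          (\<chi> i. U_gradient (X i) (?f i) (xbar $ i) {..<d i} (Ub i) (g $ i))"
        by (intro separable_sum.U_gradient_total[OF sepF ne x def]) auto
    qed
  qed
  ultimately show ?thesis
    unfolding Let_def totH totF by blast
qed

end
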